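(* Let $(\mu_t)_{t\ge0}$ be a $\boxplus$-semigroup with Lévy measure $\sigma_{\mu_1}$. Then $\mu_t$ has property (H) for every $t>0$ if and only if $m_2(\sigma_{\mu_1})=\int_{\mathbb{R}}s^2\,d\sigma_{\mu_1}(s)=+\infty$ and $$\int_{\mathbb{R}}\frac{1+s^2}{(x-s)^2}\,d\sigma_{\mu_1}(s)=+\infty,\quad x\in\mathbb{R}.$$
   Context: $\mathcal{P}_{\mathbb{R}}$ is the set of Borel probability measures on $\mathbb{R}$ and $\boxplus$ is free additive convolution. A $\boxplus$-semigroup is a family $(\mu_t)_{t\ge0}\subset\mathcal{P}_{\mathbb{R}}$ with $\mu_{t+s}=\mu_t\boxplus\mu_s$ for $s,t\ge0$, $\mu_0=\delta_0$, and $\mu_t\to\delta_0$ weakly as $t\to0$. Each $\mu_t$ is $\boxplus$-infinitely divisible. For a $\boxplus$-infinitely divisible $\mu$, with $F_\mu=1/G_\mu$, $G_\mu(z)=\int\frac{d\mu(s)}{z-s}$, the Voiculescu transform $\varphi_\mu(z)=F_\mu^{-1}(z)-z$ (defined first on a truncated cone) extends to the upper half-plane $\mathbb{C}^+$ by the free Lévy-Hinčin formula $\varphi_\mu(z)=\gamma_\mu+\int_{\mathbb{R}}\frac{1+sz}{z-s}\,d\sigma_\mu(s)$ with unique $\gamma_\mu\in\mathbb{R}$ and finite positive Borel measure $\sigma_\mu$, called the Lévy measure of $\mu$. One has $\sigma_{\mu_t}=t\sigma_{\mu_1}$, and $\sigma_{\mu_1}$ is called the Lévy measure of the semigroup. Property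 (H) for $\mu\in\mathcal{P}_{\mathbb{R}}$: for all $\nu\in\mathcal{P}_{\mathbb{R}}$, the measure $\mu\boxplus\nu$ is Lebesgue absolutely continuous and has a strictly positive, analytic density everywhere on $\mathbb{R}$. *)

theory Defs
  imports "HOL-Probability.Probability"
begin

text \<open>
  Borel probability measures on the real line are the measures satisfying the library predicate
  \<open>real_distribution\<close>.
\<close>

definition cauchy_transform :: "real measure \<Rightarrow> complex \<Rightarrow> complex" where
  "cauchy_transform \<mu> z = (\<integral>s. 1 / (z - complex_of_real s) \<partial>\<mu>)"

definition F_transform :: "real measure \<Rightarrow> complex \<Rightarrow> complex" where
  "F_transform \<mu> z = 1 / cauchy_transform \<mu> z"

definition truncated_cone :: "real \<Rightarrow> real \<Rightarrow> complex set" where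
  "truncated_cone \<alpha> \<beta> = {z. \<beta> < Im z \<and> \<bar>Re z\<bar> < \<alpha> * Im z}"

text \<open>
  \<open>voiculescu_transform_on \<mu> \<phi> \<alpha> \<beta>\<close> means that the Voiculescu transform of \<open>\<mu>\<close> is defined on the
  truncated cone with parameters \<open>\<alpha>\<close>, \<open>\<beta>\<close> and equals \<open>\<phi>\<close> there. On the upper half-plane
  \<open>F_transform \<mu>\<close> need not be injective, so the branch of its inverse has to be fixed: it is the
  inverse of the restriction to a truncated cone on which the function is injective. The choice of
  that cone is immaterial, since \<open>F_transform \<mu> w / w\<close> tends to \<open>1\<close> as \<open>w\<close> tends to
  infinity within a truncated cone.
\<close>

definition voiculescu_transform_on ::
    "real measure \<Rightarrow> (complex \<Rightarrow> complex) \<Rightarrow> real \<Rightarrow> real \<Rightarrow> bool" where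
  "voiculescu_transform_on \<mu> \<phi> \<alpha> \<beta> \<longleftrightarrow>
     \<alpha> > 0 \<and> \<beta> > 0 \<and>
     (\<exists>\<alpha>'>0. \<exists>\<beta>'>0.
        inj_on (F_transform \<mu>) (truncated_cone \<alpha>' \<beta>') \<and>
        truncated_cone \<alpha> \<beta> \<subseteq> F_transform \<mu> ` truncated_cone \<alpha>' \<beta>' \<and>
        (\<forall>z\<in>truncated_cone \<alpha> \<beta>.
           \<phi> z = inv_into (truncated_cone \<alpha>' \<beta>') (F_transform \<mu>) z - z))"

text \<open>
  The free additive convolution is the unique probability measure whose Voiculescu transform is
  the sum of the two given ones on a common truncated cone. For all Borel probability measures on
  the line, such a measure exists by a theorem of Bercovici and Voiculescu.
\<close>

definition free_conv :: "real measure \<Rightarrow> real measure \<Rightarrow> real measure" (infixl "\<boxplus>" 65) where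
  "\<mu> \<boxplus> \<nu> = (THE \<rho>. real_distribution \<rho> \<and>
     (\<exists>\<alpha> \<beta> \<phi> \<psi>. voiculescu_transform_on \<mu> \<phi> \<alpha> \<beta> \<and> voiculescu_transform_on \<nu> \<psi> \<alpha> \<beta> \<and>
        voiculescu_transform_on \<rho> (\<lambda>z. \<phi> z + \<psi> z) \<alpha> \<beta>))"

text \<open>
  Only the measures \<open>\<mu> t\<close> with \<open>t \<ge> 0\<close> matter. Since \<open>weak_conv_m\<close> is a notion for sequences, weak
  convergence as \<open>t\<close> tends to \<open>0\<close> is expressed along all sequences tending to \<open>0\<close> from the right.
\<close>

definition free_semigroup :: "(real \<Rightarrow> real measure) \<Rightarrow> bool" where
  "free_semigroup \<mu> \<longleftrightarrow>
     (\<forall>t\<ge>0. real_distribution (\<mu> t)) \<and>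
     (\<forall>s\<ge>0. \<forall>t\<ge>0. \<mu> (t + s) = \<mu> t \<boxplus> \<mu> s) \<and>
     \<mu> 0 = return borel 0 \<and>
     (\<forall>r. filterlim r (at_right 0) sequentially \<longrightarrow>
        weak_conv_m (\<lambda>n. \<mu> (r n)) (return borel 0))"

text \<open>
  The measure in the free Levy-Hincin formula. The right-hand side of the formula is defined on the
  whole upper half-plane and provides the analytic extension of the Voiculescu transform, so it
  suffices to require the equality on some truncated cone.
\<close>

definition free_levy_measure :: "real measure \<Rightarrow> real measure \<Rightarrow> bool" where
  "free_levy_measure \<mu> \<sigma> \<longleftrightarrow>
     finite_borel_measure \<sigma> \<and>
     (\<exists>\<gamma>::real. \<exists>\<alpha> \<beta>. voiculescu_transform_on \<mu>
        (\<lambda>z. complex_of_real \<gamma> +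
           (\<integral>s. (1 + complex_of_real s * z) / (z - complex_of_real s) \<partial>\<sigma>)) \<alpha> \<beta>)"

definition real_analytic :: "(real \<Rightarrow> real) \<Rightarrow> bool" where
  "real_analytic f \<longleftrightarrow> (\<forall>x. \<exists>A. (\<lambda>h. f (x + h)) has_fps_expansion A)"

definition property_H :: "real measure \<Rightarrow> bool" where
  "property_H \<mu> \<longleftrightarrow>
     (\<forall>\<nu>. real_distribution \<nu> \<longrightarrow>
        (\<exists>f. (\<forall>x. f x > 0) \<and> real_analytic f \<and>
           \<mu> \<boxplus> \<nu> = density lborel (\<lambda>x. ennreal (f x))))"

text \<open>
  The quotient is taken in the extended nonnegative reals, where \<open>a / 0 = \<infinity>\<close> for \<open>a > 0\<close>. Hence the
  integrand is infinite at \<open>s = x\<close>, and the integral is infinite whenever \<open>\<sigma>\<close> has an atom at \<open>x\<close>.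
  With division of real numbers the integrand would be \<open>0\<close> there.
\<close>

definition singular_integral :: "real measure \<Rightarrow> real \<Rightarrow> ennreal" where
  "singular_integral \<sigma> x = (\<integral>\<^sup>+s. ennreal (1 + s\<^sup>2) / ennreal ((x - s)\<^sup>2) \<partial>\<sigma>)"

definition second_moment :: "real measure \<Rightarrow> ennreal" where
  "second_moment \<sigma> = (\<integral>\<^sup>+s. ennreal (s\<^sup>2) \<partial>\<sigma>)"

end

theory Submission
  imports Defs "HOL-Complex_Analysis.Complex_Analysis"
begin

text \<open>
  Write \<open>F = 1 / G\<close>. Free convolution is governed by subordination: \<open>F\<close> of \<open>\<mu> t \<boxplus> \<nu>\<close> is
  \<open>F \<nu> \<circ> \<omega>\<close>, where \<open>\<omega>\<close> is a right inverse on the upper half-plane of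
  \<open>H w = w + t \<Phi> (F \<nu> w)\<close> and \<open>\<Phi>\<close> is the Levy-Hincin integral. The imaginary part of \<open>H w\<close> is
  \<open>(1 - a w) Im w\<close>, where \<open>a w\<close> is the product of \<open>t \<integral> (1 + s\<^sup>2) / |F \<nu> w - s|\<^sup>2 d\<sigma>\<close> and
  \<open>Im (F \<nu> w) / Im w\<close>; by the Cauchy-Schwarz inequality \<open>a\<close> also controls the difference
  quotients of \<open>H w - w\<close>, so \<open>H\<close> is injective where its imaginary part is positive.

  If both integrals diverge, Fatou's lemma shows that \<open>F \<nu> (\<omega> z)\<close> cannot approach a real number
  or infinity as \<open>z\<close> tends to a real point \<open>x\<close>. Hence \<open>x = H w0\<close> for some \<open>w0\<close> in the upper
  half-plane, the derivative of \<open>H\<close> at \<open>w0\<close> is nonzero because \<open>\<sigma>\<close> is not a point mass, and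
  \<open>\<omega>\<close> extends analytically across \<open>x\<close>. Conversely, if the singular integral converges at \<open>x\<close>, then for
  small \<open>t\<close> and \<open>\<nu> = \<delta>\<^sub>0\<close> the function \<open>F\<close> takes the real boundary value \<open>x\<close>; if the second moment is finite,
  then for small \<open>t\<close> and a symmetric two-point measure \<open>\<nu>\<close> it takes the boundary value infinity.
  Both contradict a positive finite density.

  Existence of \<open>\<mu> \<boxplus> \<nu>\<close> is proved by iterating \<open>w \<mapsto> z + h2 (z + h1 w)\<close> with \<open>h = F - id\<close>. The
  iterates converge in a truncated cone by contraction, and Montel's theorem propagates the limit to
  the half-plane.
\<close>

section \<open>Quadratic kernels on the upper half-plane\<close>

text \<open>One two-variable integral, \<open>kernel_form\<close>, carries most estimates: for the
  Cauchy transform and the Levy-Hincin integral it is minus a difference quotient off the diagonal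
  and minus a derivative on it, while its absolute version \<open>kernel_norm\<close> gives their
  imaginary parts. Injectivity, critical points and membership in the half-plane are thus all
  measured by the same numbers. An obstacle is that \<open>\<boxplus>\<close> is a definite
  description built from locally chosen inverses; nothing can be said about it before a convolution
  has been constructed and shown to be unique. Relations are proved near infinity, where F is close
  to the identity, and then moved to the half-plane in the form F u + \<phi> (F u) = u, which unlike
  F (z + \<phi> z) = z makes sense on all of it. In the sufficiency direction \<omega> itself might
  escape to infinity; it is bounded by an inequality that has |\<omega>| on both sides, with a
  coefficient below 1 on the right.\<close>

definition upper_half_plane :: "complex set" where
  "upper_half_plane = {z. 0 < Im z}"

lemma upper_half_plane_iff [simp]: "z \<in> upper_half_plane \<longleftrightarrow> 0 < Im z"
  by (simp add: upper_half_plane_def)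

lemma open_upper_half_plane [intro]: "open upper_half_plane"
  unfolding upper_half_plane_def by (rule open_halfspace_Im_gt)

lemma convex_upper_half_plane: "convex upper_half_plane"
  unfolding upper_half_plane_def by (rule convex_halfspace_Im_gt)

lemma connected_upper_half_plane [intro]: "connected upper_half_plane"
  using convex_upper_half_plane by (rule convex_connected)

lemma upper_half_plane_identity:
  assumes "f holomorphic_on upper_half_plane" "g holomorphic_on upper_half_plane"
    and "open S" "S \<noteq> {}" "S \<subseteq> upper_half_plane" "\<And>z. z \<in> S \<Longrightarrow> f z = g z" "0 < Im z"
  shows "f z = g z"
  using analytic_continuation_open[of S upper_half_plane f g z] assms by auto

lemma norm_diff_real_ge_Im: "\<bar>Im u\<bar> \<le> cmod (u - complex_of_real s)"
  using abs_Im_le_cmod[of "u - complex_of_real s"] by simp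

lemma diff_real_nonzero: "0 < Im u \<Longrightarrow> u - complex_of_real s \<noteq> 0"
  by (auto simp: complex_eq_iff)

lemma one_plus_square_le_norm_diff_real:
  "1 + s\<^sup>2 \<le> 2 * (cmod (u - complex_of_real s))\<^sup>2 + (1 + 2 * (Re u)\<^sup>2)"
proof -
  have "(cmod (u - complex_of_real s))\<^sup>2 = (Re u - s)\<^sup>2 + (Im u)\<^sup>2"
    by (simp add: cmod_power2)
  moreover have "0 \<le> (s - 2 * Re u)\<^sup>2 + (Im u)\<^sup>2 * 2" by simp
  ultimately show ?thesis
    by (simp add: power2_eq_square algebra_simps)
qed

text \<open>A weight of quadratic growth is matched by the squared denominator, and
  \<open>Im u\<close> keeps that denominator away from zero. The integrand is therefore bounded,
  which suffices for integrability against a finite measure.\<close>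

lemma weight_le:
  assumes "0 < Im u" "k \<le> 1 + s\<^sup>2"
  shows "k / (cmod (u - complex_of_real s))\<^sup>2 \<le> 2 + (1 + 2 * (Re u)\<^sup>2) / (Im u)\<^sup>2"
proof -
  have pos: "0 < (cmod (u - complex_of_real s))\<^sup>2"
    using diff_real_nonzero[OF assms(1)] by simp
  have le: "(Im u)\<^sup>2 \<le> (cmod (u - complex_of_real s))\<^sup>2"
    using norm_diff_real_ge_Im[of u s] assms(1) by (intro power_mono) auto
  have "k \<le> 2 * (cmod (u - complex_of_real s))\<^sup>2 + (1 + 2 * (Re u)\<^sup>2)"
    using one_plus_square_le_norm_diff_real[of s u] assms(2) by linarith
  then have "k / (cmod (u - complex_of_real s))\<^sup>2 \<le>
      2 + (1 + 2 * (Re u)\<^sup>2) / (cmod (u - complex_of_real s))\<^sup>2"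
    using pos by (simp add: field_simps)
  also have "(1 + 2 * (Re u)\<^sup>2) / (cmod (u - complex_of_real s))\<^sup>2 \<le> (1 + 2 * (Re u)\<^sup>2) / (Im u)\<^sup>2"
    using le assms(1) pos by (intro divide_left_mono mult_pos_pos) auto
  finally show ?thesis by simp
qed

text \<open>For the weight 1 this is minus the difference quotient of the Cauchy transform at
  \<open>u\<close> and \<open>v\<close>, for the weight 1 + s^2 that of the Levy-Hincin integral; at
  \<open>u = v\<close> it is minus the derivative.\<close>

definition kernel_form :: "real measure \<Rightarrow> (real \<Rightarrow> real) \<Rightarrow> complex \<Rightarrow> complex \<Rightarrow> complex" where
  "kernel_form M k u v =
     (\<integral>s. complex_of_real (k s) / ((u - complex_of_real s) * (v - complex_of_real s)) \<partial>M)"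

text \<open>For the two weights that occur this is also minus the imaginary part of the transform
  divided by \<open>Im u\<close>. The double role links bounds on derivatives to signs of imaginary
  parts.\<close>

definition kernel_norm :: "real measure \<Rightarrow> (real \<Rightarrow> real) \<Rightarrow> complex \<Rightarrow> real" where
  "kernel_norm M k u = (\<integral>s. k s / (cmod (u - complex_of_real s))\<^sup>2 \<partial>M)"

text \<open>Serves the weights 1 and 1 + s^2 at once; \<open>k_le\<close> is the growth for which
  \<open>weight_le\<close> applies.\<close>

locale weighted_measure = finite_borel_measure M for M :: "real measure" +
  fixes k :: "real \<Rightarrow> real"
  assumes k_borel [measurable]: "k \<in> borel_measurable borel"
    and k_nonneg: "0 \<le> k s"
    and k_le: "k s \<le> 1 + s\<^sup>2"
begin

lemma measurable_M [measurable_cong]: "sets M = sets borel"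
  by (rule M_is_borel)

lemma integrable_kernel_norm:
  assumes "0 < Im u"
  shows "integrable M (\<lambda>s. k s / (cmod (u - complex_of_real s))\<^sup>2)"
proof (rule integrable_const_bound)
  show "AE s in M. norm (k s / (cmod (u - complex_of_real s))\<^sup>2)
      \<le> 2 + (1 + 2 * (Re u)\<^sup>2) / (Im u)\<^sup>2"
    using weight_le[OF assms k_le] k_nonneg by simp
qed measurable

text \<open>Weighted inequality of arithmetic and geometric means. The parameter \<open>c\<close>
  stays free so that it can be optimised after integration, which turns this pointwise bound into
  the Cauchy-Schwarz inequality.\<close>

lemma norm_kernel_le:
  assumes "0 < Im u" "0 < Im v" "0 < c"
  shows "cmod (complex_of_real (k s) / ((u - complex_of_real s) * (v - complex_of_real s)))
    \<le> (c * (k s / (cmod (u - complex_of_real s))\<^sup>2) + k s / (cmod (v - complex_of_real s))\<^sup>2 / c) / 2"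
proof -
  define a where "a = 1 / cmod (u - complex_of_real s)"
  define b where "b = 1 / cmod (v - complex_of_real s)"
  have "0 \<le> (sqrt c * a - b / sqrt c)\<^sup>2" by simp
  then have "2 * (a * b) \<le> c * a\<^sup>2 + b\<^sup>2 / c"
    using assms(3) by (simp add: power2_diff power_mult_distrib power_divide)
  then have "k s * (2 * (a * b)) \<le> k s * (c * a\<^sup>2 + b\<^sup>2 / c)"
    by (rule mult_left_mono) (rule k_nonneg)
  moreover have "cmod (complex_of_real (k s) / ((u - complex_of_real s) * (v - complex_of_real s)))
      = k s * (a * b)"
    using k_nonneg[of s] by (simp only: norm_divide norm_mult a_def b_def) simp
  moreover have "k s / (cmod (u - complex_of_real s))\<^sup>2 = k s * a\<^sup>2"
      "k s / (cmod (v - complex_of_real s))\<^sup>2 = k s * b\<^sup>2"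
    by (auto simp: a_def b_def power_divide)
  ultimately show ?thesis
    by (simp add: algebra_simps)
qed

lemma integrable_kernel_form:
  assumes "0 < Im u" "0 < Im v"
  shows "integrable M (\<lambda>s. complex_of_real (k s) / ((u - complex_of_real s) * (v - complex_of_real s)))"
proof (rule Bochner_Integration.integrable_bound)
  show "integrable M (\<lambda>s. (1 * (k s / (cmod (u - complex_of_real s))\<^sup>2)
      + k s / (cmod (v - complex_of_real s))\<^sup>2 / 1) / 2)"
    using integrable_kernel_norm[OF assms(1)] integrable_kernel_norm[OF assms(2)] by simp
  show "AE s in M. norm (complex_of_real (k s) / ((u - complex_of_real s) * (v - complex_of_real s)))
     \<le> norm ((1 * (k s / (cmod (u - complex_of_real s))\<^sup>2)
      + k s / (cmod (v - complex_of_real s))\<^sup>2 / 1) / 2)"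
    using norm_kernel_le[OF assms, of 1] k_nonneg by (intro AE_I2) (auto intro: order_trans)
qed measurable

lemma kernel_norm_nonneg: "0 \<le> kernel_norm M k u"
  unfolding kernel_norm_def using k_nonneg by (intro integral_nonneg_AE) auto

lemma norm_kernel_form_le_aux:
  assumes "0 < Im u" "0 < Im v" "0 < c"
  shows "cmod (kernel_form M k u v) \<le> (c * kernel_norm M k u + kernel_norm M k v / c) / 2"
proof -
  have "cmod (kernel_form M k u v) \<le>
     (\<integral>s. (c * (k s / (cmod (u - complex_of_real s))\<^sup>2) + k s / (cmod (v - complex_of_real s))\<^sup>2 / c) / 2 \<partial>M)"
    unfolding kernel_form_def
    by (intro integral_norm_bound[THEN order_trans] integral_mono norm_kernel_le assms integrable_norm
        integrable_kernel_form integrable_divide_zero Bochner_Integration.integrable_add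
        integrable_mult_right integrable_kernel_norm)
  also have "\<dots> = (c * kernel_norm M k u + kernel_norm M k v / c) / 2"
    unfolding kernel_norm_def
    by (simp only: integral_divide_zero Bochner_Integration.integral_add integral_mult_right_zero
        integrable_mult_right integrable_divide_zero integrable_kernel_norm assms)
  finally show ?thesis .
qed

text \<open>The optimal parameter is \<open>sqrt (B / A)\<close>. If one of the norms vanishes there
  is no optimum; a very large or very small parameter then leaves an error \<open>e\<close>, which
  is why the proof runs through \<open>field_le_epsilon\<close>.\<close>

lemma norm_kernel_form_le:
  assumes "0 < Im u" "0 < Im v"
  shows "cmod (kernel_form M k u v) \<le> sqrt (kernel_norm M k u * kernel_norm M k v)"
proof (rule field_le_epsilon)
  fix e :: real assume e: "0 < e"
  define A where "A = kernel_norm M k u"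
  define B where "B = kernel_norm M k v"
  have AB: "0 \<le> A" "0 \<le> B" unfolding A_def B_def by (rule kernel_norm_nonneg)+
  consider "A > 0" "B > 0" | "A = 0" | "B = 0" using AB by linarith
  then show "cmod (kernel_form M k u v) \<le> sqrt (kernel_norm M k u * kernel_norm M k v) + e"
  proof cases
    case 1
    have "(sqrt (B / A) * A + B / sqrt (B / A)) / 2 = sqrt (A * B)"
      using 1 by (simp add: real_sqrt_divide real_sqrt_mult field_simps flip: power2_eq_square)
    then show ?thesis
      using norm_kernel_form_le_aux[OF assms, of "sqrt (B / A)"] 1 e by (simp add: A_def B_def)
  next
    case 2
    have "B / ((B + 1) / e) / 2 \<le> e"
      using AB e by (simp add: field_simps)
    then show ?thesis
      using norm_kernel_form_le_aux[OF assms, of "(B + 1) / e"] 2 e AB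
      by (simp add: A_def[symmetric] B_def[symmetric])
  next
    case 3
    have "e / (A + 1) * A / 2 \<le> e"
      using AB e by (simp add: field_simps)
    then show ?thesis
      using norm_kernel_form_le_aux[OF assms, of "e / (A + 1)"] 3 e AB
      by (simp add: A_def[symmetric] B_def[symmetric])
  qed
qed

lemma norm_kernel_form_diag_le:
  "0 < Im u \<Longrightarrow> cmod (kernel_form M k u u) \<le> kernel_norm M k u"
  using norm_kernel_form_le[of u u] kernel_norm_nonneg[of u] by simp

text \<open>Only one factor changes, by (u - v) / ((v - s) (u - s)), and |1 / (v - s)| is at most 1
  / Im v. This explicit rate of continuity takes the place of dominated convergence.\<close>

lemma kernel_form_diff_le:
  assumes "0 < Im u" "0 < Im v"
  shows "cmod (kernel_form M k v u - kernel_form M k u u) \<le> cmod (u - v) * (kernel_norm M k u / Im v)"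
proof -
  have "kernel_form M k v u - kernel_form M k u u =
    (\<integral>s. complex_of_real (k s) / ((v - complex_of_real s) * (u - complex_of_real s))
        - complex_of_real (k s) / ((u - complex_of_real s) * (u - complex_of_real s)) \<partial>M)"
    unfolding kernel_form_def
    by (intro Bochner_Integration.integral_diff[symmetric] integrable_kernel_form assms)
  also have "cmod \<dots> \<le> (\<integral>s. cmod (u - v) / Im v * (k s / (cmod (u - complex_of_real s))\<^sup>2) \<partial>M)"
  proof (intro integral_norm_bound[THEN order_trans] integral_mono integrable_norm
      Bochner_Integration.integrable_diff integrable_kernel_form assms integrable_mult_right
      integrable_kernel_norm)
    fix s
    have nz: "u - complex_of_real s \<noteq> 0" "v - complex_of_real s \<noteq> 0"
      using diff_real_nonzero assms by auto
    have "complex_of_real (k s) / ((v - complex_of_real s) * (u - complex_of_real s))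
        - complex_of_real (k s) / ((u - complex_of_real s) * (u - complex_of_real s))
      = (complex_of_real (k s) * (u - v)) / ((v - complex_of_real s) * (u - complex_of_real s)\<^sup>2)"
      using nz by (simp add: divide_simps power2_eq_square) (simp add: algebra_simps)
    then have "norm (complex_of_real (k s) / ((v - complex_of_real s) * (u - complex_of_real s))
        - complex_of_real (k s) / ((u - complex_of_real s) * (u - complex_of_real s)))
      = cmod (u - v) / cmod (v - complex_of_real s) * (k s / (cmod (u - complex_of_real s))\<^sup>2)"
      using k_nonneg[of s] by (simp add: norm_divide norm_mult norm_power)
    also have "\<dots> \<le> cmod (u - v) / Im v * (k s / (cmod (u - complex_of_real s))\<^sup>2)"
      using norm_diff_real_ge_Im[of v s] assms k_nonneg[of s]
      by (intro mult_right_mono divide_left_mono) (auto intro!: mult_pos_pos simp: nz)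
    finally show "norm (complex_of_real (k s) / ((v - complex_of_real s) * (u - complex_of_real s))
        - complex_of_real (k s) / ((u - complex_of_real s) * (u - complex_of_real s)))
       \<le> cmod (u - v) / Im v * (k s / (cmod (u - complex_of_real s))\<^sup>2)" .
  qed
  also have "\<dots> = cmod (u - v) * (kernel_norm M k u / Im v)"
    unfolding kernel_norm_def by (subst Bochner_Integration.integral_mult_right_zero) simp
  finally show ?thesis .
qed

lemma tendsto_kernel_form:
  assumes "0 < Im u"
  shows "((\<lambda>v. kernel_form M k v u) \<longlongrightarrow> kernel_form M k u u) (at u)"
proof -
  have "((\<lambda>v. kernel_form M k v u - kernel_form M k u u) \<longlongrightarrow> 0) (at u)"
  proof (rule Lim_null_comparison)
    have "eventually (\<lambda>v. v \<in> upper_half_plane) (at u)"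
      using assms by (intro eventually_at_in_open') auto
    then show "\<forall>\<^sub>F v in at u. norm (kernel_form M k v u - kernel_form M k u u)
        \<le> cmod (u - v) * (kernel_norm M k u / Im v)"
      by eventually_elim (use kernel_form_diff_le[OF assms] in auto)
    show "((\<lambda>v. cmod (u - v) * (kernel_norm M k u / Im v)) \<longlongrightarrow> 0) (at u)"
      using assms by (auto intro!: tendsto_eq_intros)
  qed
  then show ?thesis by (simp add: LIM_zero_iff)
qed

text \<open>The first assumption is a resolvent identity. Under it the difference quotient is
  literally a kernel value, so differentiation reduces to continuity of the kernel in one
  argument.\<close>

lemma has_field_derivative_from_kernel:
  assumes "\<And>u v. 0 < Im u \<Longrightarrow> 0 < Im v \<Longrightarrow> f u - f v = - (u - v) * kernel_form M k u v"
    and "0 < Im u"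
  shows "(f has_field_derivative - kernel_form M k u u) (at u)"
  unfolding has_field_derivative_iff
proof (rule Lim_transform_eventually)
  show "((\<lambda>v. - kernel_form M k v u) \<longlongrightarrow> - kernel_form M k u u) (at u)"
    by (intro tendsto_minus tendsto_kernel_form assms)
  have "eventually (\<lambda>v. v \<in> upper_half_plane - {u}) (at u)"
    using assms by (intro eventually_at_in_open) auto
  then show "\<forall>\<^sub>F v in at u. - kernel_form M k v u = (f v - f u) / (v - u)"
  proof eventually_elim
    case (elim v)
    then have "f v - f u = (v - u) * - kernel_form M k v u" "v - u \<noteq> 0"
      using assms(1)[of v u] assms(2) by (auto simp: algebra_simps)
    then show ?case by (simp only: nonzero_mult_div_cancel_left not_False_eq_True)
  qed
qed

end

lemma has_field_derivative_imp_holomorphic_on_upper_half_plane: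
  assumes "\<And>z. 0 < Im z \<Longrightarrow> (f has_field_derivative f' z) (at z)"
  shows "f holomorphic_on upper_half_plane"
  using assms by (subst holomorphic_on_open[OF open_upper_half_plane]) fastforce

lemma weighted_measure_one:
  "finite_borel_measure M \<Longrightarrow> weighted_measure M (\<lambda>_. 1)"
  by (simp add: weighted_measure_def weighted_measure_axioms_def)

lemma weighted_measure_square:
  "finite_borel_measure M \<Longrightarrow> weighted_measure M (\<lambda>s. 1 + s\<^sup>2)"
  by (simp add: weighted_measure_def weighted_measure_axioms_def)

section \<open>Cauchy transform and Levy-Hincin integral as kernel integrals\<close>

abbreviation poisson_mass :: "real measure \<Rightarrow> complex \<Rightarrow> real" where
  "poisson_mass \<mu> \<equiv> kernel_norm \<mu> (\<lambda>_. 1)"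

abbreviation levy_mass :: "real measure \<Rightarrow> complex \<Rightarrow> real" where
  "levy_mass \<sigma> \<equiv> kernel_norm \<sigma> (\<lambda>s. 1 + s\<^sup>2)"

definition levy_integral :: "real measure \<Rightarrow> complex \<Rightarrow> complex" where
  "levy_integral \<sigma> z = (\<integral>s. (1 + complex_of_real s * z) / (z - complex_of_real s) \<partial>\<sigma>)"

lemma integrable_cauchy_kernel:
  assumes "finite_borel_measure \<mu>" "0 < Im z"
  shows "integrable \<mu> (\<lambda>s. 1 / (z - complex_of_real s))"
proof -
  interpret finite_borel_measure \<mu> by fact
  note M_is_borel[measurable_cong]
  show ?thesis
  proof (rule integrable_const_bound)
    show "AE s in \<mu>. norm (1 / (z - complex_of_real s)) \<le> 1 / Im z"
      using norm_diff_real_ge_Im[of z] assms(2)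
      by (intro AE_I2) (auto simp: norm_divide intro!: divide_left_mono mult_pos_pos
          simp: diff_real_nonzero)
  qed measurable
qed

lemma integrable_levy_kernel:
  assumes "finite_borel_measure \<sigma>" "0 < Im z"
  shows "integrable \<sigma> (\<lambda>s. (1 + complex_of_real s * z) / (z - complex_of_real s))"
proof -
  interpret finite_borel_measure \<sigma> by fact
  \<comment> \<open>Polynomial division in \<open>s\<close> reduces the Levy-Hincin kernel to a
    constant plus a multiple of the Cauchy kernel.\<close>
  have "(1 + complex_of_real s * z) / (z - complex_of_real s)
      = - z + (1 + z\<^sup>2) * (1 / (z - complex_of_real s))" for s
    using diff_real_nonzero[OF assms(2), of s] by (simp add: field_simps power2_eq_square)
  note eq = this
  show ?thesis
    by (simp only: eq)
      (intro Bochner_Integration.integrable_add integrable_const integrable_mult_right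
        integrable_cauchy_kernel assms)
qed

lemma cauchy_transform_diff:
  assumes "finite_borel_measure \<mu>" "0 < Im u" "0 < Im v"
  shows "cauchy_transform \<mu> u - cauchy_transform \<mu> v = - (u - v) * kernel_form \<mu> (\<lambda>_. 1) u v"
proof -
  have "1 / (u - complex_of_real s) - 1 / (v - complex_of_real s) =
      - (u - v) * (complex_of_real 1 / ((u - complex_of_real s) * (v - complex_of_real s)))" for s
    using diff_real_nonzero[OF assms(2), of s] diff_real_nonzero[OF assms(3), of s]
    by (simp add: divide_simps)
  then show ?thesis
    unfolding cauchy_transform_def kernel_form_def
    by (simp only: Bochner_Integration.integral_diff[symmetric] integrable_cauchy_kernel assms
        integral_mult_right_zero)
qed

lemma levy_integral_diff:
  assumes "finite_borel_measure \<sigma>" "0 < Im u" "0 < Im v"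
  shows "levy_integral \<sigma> u - levy_integral \<sigma> v = - (u - v) * kernel_form \<sigma> (\<lambda>s. 1 + s\<^sup>2) u v"
proof -
  have "(1 + complex_of_real s * u) / (u - complex_of_real s)
       - (1 + complex_of_real s * v) / (v - complex_of_real s) =
      - (u - v) * (complex_of_real (1 + s\<^sup>2) / ((u - complex_of_real s) * (v - complex_of_real s)))" for s
    using diff_real_nonzero[OF assms(2), of s] diff_real_nonzero[OF assms(3), of s]
    by (simp add: divide_simps) (simp add: algebra_simps power2_eq_square)
  then show ?thesis
    unfolding levy_integral_def kernel_form_def
    by (simp only: Bochner_Integration.integral_diff[symmetric] integrable_levy_kernel assms
        integral_mult_right_zero)
qed

lemma has_field_derivative_cauchy_transform:
  assumes "finite_borel_measure \<mu>" "0 < Im z"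
  shows "(cauchy_transform \<mu> has_field_derivative - kernel_form \<mu> (\<lambda>_. 1) z z) (at z)"
  by (intro weighted_measure.has_field_derivative_from_kernel weighted_measure_one
      cauchy_transform_diff assms)

lemma has_field_derivative_levy_integral:
  assumes "finite_borel_measure \<sigma>" "0 < Im z"
  shows "(levy_integral \<sigma> has_field_derivative - kernel_form \<sigma> (\<lambda>s. 1 + s\<^sup>2) z z) (at z)"
  by (intro weighted_measure.has_field_derivative_from_kernel weighted_measure_square
      levy_integral_diff assms)

lemma holomorphic_cauchy_transform:
  "finite_borel_measure \<mu> \<Longrightarrow> cauchy_transform \<mu> holomorphic_on upper_half_plane"
  by (rule has_field_derivative_imp_holomorphic_on_upper_half_plane)
    (rule has_field_derivative_cauchy_transform)

lemma holomorphic_levy_integral: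
  "finite_borel_measure \<sigma> \<Longrightarrow> levy_integral \<sigma> holomorphic_on upper_half_plane"
  by (rule has_field_derivative_imp_holomorphic_on_upper_half_plane)
    (rule has_field_derivative_levy_integral)

lemma Im_inverse_diff_real: "Im (1 / (z - complex_of_real s)) = - Im z * (1 / (cmod (z - complex_of_real s))\<^sup>2)"
  by (simp add: Im_divide cmod_power2)

lemma Im_cauchy_transform:
  assumes "finite_borel_measure \<mu>" "0 < Im z"
  shows "Im (cauchy_transform \<mu> z) = - Im z * poisson_mass \<mu> z"
proof -
  have "Im (cauchy_transform \<mu> z) = (\<integral>s. Im (1 / (z - complex_of_real s)) \<partial>\<mu>)"
    unfolding cauchy_transform_def by (intro integral_Im[symmetric] integrable_cauchy_kernel assms)
  then show ?thesis
    by (simp only: Im_inverse_diff_real kernel_norm_def integral_mult_right_zero)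
qed

lemma Im_levy_integral:
  assumes "finite_borel_measure \<sigma>" "0 < Im z"
  shows "Im (levy_integral \<sigma> z) = - Im z * levy_mass \<sigma> z"
proof -
  have *: "Im ((1 + complex_of_real s * z) / (z - complex_of_real s))
      = - Im z * ((1 + s\<^sup>2) / (cmod (z - complex_of_real s))\<^sup>2)" for s
  proof -
    have "(cmod (z - complex_of_real s))\<^sup>2 = (Re z - s)\<^sup>2 + (Im z)\<^sup>2" "(Re z - s)\<^sup>2 + (Im z)\<^sup>2 \<noteq> 0"
      using assms(2) by (auto simp: cmod_power2 add_nonneg_eq_0_iff)
    then show ?thesis
      by (simp add: Im_divide divide_simps) (simp add: algebra_simps power2_eq_square)
  qed
  have "Im (levy_integral \<sigma> z) = (\<integral>s. Im ((1 + complex_of_real s * z) / (z - complex_of_real s)) \<partial>\<sigma>)"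
    unfolding levy_integral_def by (intro integral_Im[symmetric] integrable_levy_kernel assms)
  then show ?thesis
    by (simp only: * kernel_norm_def integral_mult_right_zero)
qed

lemma norm_levy_integral_diff_le:
  assumes "finite_borel_measure \<sigma>" "0 < Im u" "0 < Im v"
  shows "cmod (levy_integral \<sigma> u - levy_integral \<sigma> v)
    \<le> cmod (u - v) * sqrt (levy_mass \<sigma> u * levy_mass \<sigma> v)"
proof -
  interpret weighted_measure \<sigma> "\<lambda>s. 1 + s\<^sup>2"
    by (rule weighted_measure_square) (rule assms)
  show ?thesis
    unfolding levy_integral_diff[OF assms]
    using norm_kernel_form_le[OF assms(2,3)] by (simp add: norm_mult mult_left_mono norm_minus_commute)
qed

section \<open>The reciprocal Cauchy transform of a probability measure\<close>

context real_distribution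
begin

lemma kernel_weight: "weighted_measure M (\<lambda>_. 1)"
  by (rule weighted_measure_one) (rule finite_borel_measure_M)

text \<open>The bound |z - s| \<le> (1 + |s|) (1 + |z|) separates the variables, and
  \<open>c\<close> is the integral of 1 / (1 + |s|)^2. The estimate is independent of
  \<open>Im z\<close>, which is what makes it usable near the real axis.\<close>

lemma poisson_mass_lower:
  obtains c where "0 < c" "\<And>z. 0 < Im z \<Longrightarrow> c / (1 + cmod z)\<^sup>2 \<le> poisson_mass M z"
proof -
  define g where "g = (\<lambda>s::real. 1 / (1 + \<bar>s\<bar>)\<^sup>2)"
  have int: "integrable M g"
    unfolding g_def by (rule integrable_const_bound[where B=1]) (auto intro!: AE_I2 one_le_power)
  have "0 < integral\<^sup>L M g"
    using int by (intro expectation_greater) (auto simp: g_def intro!: AE_I2 zero_less_power)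
  moreover have "integral\<^sup>L M g / (1 + cmod z)\<^sup>2 \<le> poisson_mass M z" if "0 < Im z" for z
  proof -
    have "integral\<^sup>L M g / (1 + cmod z)\<^sup>2 = (\<integral>s. g s / (1 + cmod z)\<^sup>2 \<partial>M)" by simp
    also have "\<dots> \<le> poisson_mass M z"
      unfolding kernel_norm_def
    proof (intro integral_mono integrable_divide_zero int
        weighted_measure.integrable_kernel_norm[OF kernel_weight] that)
      fix s
      have "cmod (z - complex_of_real s) \<le> (1 + \<bar>s\<bar>) * (1 + cmod z)"
        using norm_triangle_ineq4[of z "complex_of_real s"]
          mult_nonneg_nonneg[OF abs_ge_zero[of s] norm_ge_zero[of z]]
        unfolding distrib_left distrib_right norm_of_real by linarith
      then have "(cmod (z - complex_of_real s))\<^sup>2 \<le> ((1 + \<bar>s\<bar>) * (1 + cmod z))\<^sup>2"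
        by (intro power_mono) auto
      then have "1 / ((1 + \<bar>s\<bar>) * (1 + cmod z))\<^sup>2 \<le> 1 / (cmod (z - complex_of_real s))\<^sup>2"
        using diff_real_nonzero[OF that, of s]
        by (intro divide_left_mono mult_pos_pos)
          (auto intro!: zero_less_power mult_pos_pos add_pos_nonneg)
      then show "g s / (1 + cmod z)\<^sup>2 \<le> 1 / (cmod (z - complex_of_real s))\<^sup>2"
        by (simp add: g_def power_mult_distrib)
    qed
    finally show ?thesis .
  qed
  ultimately show ?thesis using that by blast
qed

lemma poisson_mass_pos:
  assumes "0 < Im z"
  shows "0 < poisson_mass M z"
proof -
  obtain c where "0 < c" "c / (1 + cmod z)\<^sup>2 \<le> poisson_mass M z"
    using poisson_mass_lower assms by metis
  then show ?thesis
    by (smt (verit) divide_pos_pos norm_ge_zero zero_less_power)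
qed

lemma cauchy_transform_nonzero: "0 < Im z \<Longrightarrow> cauchy_transform M z \<noteq> 0"
  using Im_cauchy_transform[OF finite_borel_measure_M, of z] poisson_mass_pos[of z] by auto

lemma cauchy_transform_eq_inverse_F: "cauchy_transform M z = 1 / F_transform M z"
  by (simp add: F_transform_def)

lemma Im_F_transform:
  assumes "0 < Im z"
  shows "Im (F_transform M z) = (cmod (F_transform M z))\<^sup>2 * poisson_mass M z * Im z"
proof -
  have "Im (F_transform M z) = - Im (cauchy_transform M z) / (cmod (cauchy_transform M z))\<^sup>2"
    by (simp add: F_transform_def Im_divide cmod_power2)
  then show ?thesis
    using Im_cauchy_transform[OF finite_borel_measure_M assms]
    by (simp add: F_transform_def norm_divide power_divide)
qed

text \<open>Jensen's inequality, read off from the nonnegative variance of |1 / (z - s)|. It is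
  equivalent to the fact that F does not decrease imaginary parts.\<close>

lemma norm_cauchy_transform_square_le:
  assumes "0 < Im z"
  shows "(cmod (cauchy_transform M z))\<^sup>2 \<le> poisson_mass M z"
proof -
  have int: "integrable M (\<lambda>s. (cmod (1 / (z - complex_of_real s)))\<^sup>2)"
    using weighted_measure.integrable_kernel_norm[OF kernel_weight assms]
    by (simp add: norm_divide power_divide)
  have int1: "integrable M (\<lambda>s. cmod (1 / (z - complex_of_real s)))"
    by (intro integrable_norm integrable_cauchy_kernel finite_borel_measure_M assms)
  have "cmod (cauchy_transform M z) \<le> expectation (\<lambda>s. cmod (1 / (z - complex_of_real s)))"
    unfolding cauchy_transform_def by (rule integral_norm_bound)
  then have "(cmod (cauchy_transform M z))\<^sup>2 \<le> (expectation (\<lambda>s. cmod (1 / (z - complex_of_real s))))\<^sup>2"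
    by (intro power_mono) auto
  also have "\<dots> \<le> expectation (\<lambda>s. (cmod (1 / (z - complex_of_real s)))\<^sup>2)"
    using variance_eq[OF int1 int] variance_positive[of "\<lambda>s. cmod (1 / (z - complex_of_real s))"] by linarith
  finally show ?thesis
    by (simp add: kernel_norm_def norm_divide power_divide)
qed

lemma Im_F_transform_ge:
  assumes "0 < Im z"
  shows "Im z \<le> Im (F_transform M z)"
proof -
  have "1 \<le> (cmod (F_transform M z))\<^sup>2 * poisson_mass M z"
    using norm_cauchy_transform_square_le[OF assms] cauchy_transform_nonzero[OF assms]
    by (simp add: F_transform_def norm_divide power_divide divide_simps)
  then show ?thesis
    using Im_F_transform[OF assms] assms mult_right_mono[of 1 _ "Im z"] by simp
qed

lemma Im_F_transform_pos: "0 < Im z \<Longrightarrow> 0 < Im (F_transform M z)"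
  using Im_F_transform_ge[of z] by linarith

lemma F_transform_holomorphic: "F_transform M holomorphic_on upper_half_plane"
proof -
  have "(\<lambda>z. 1 / cauchy_transform M z) holomorphic_on upper_half_plane"
    by (intro holomorphic_intros holomorphic_cauchy_transform finite_borel_measure_M)
      (simp add: cauchy_transform_nonzero)
  then show ?thesis by (simp add: F_transform_def[abs_def])
qed

lemma F_transform_diff:
  assumes "0 < Im u" "0 < Im v"
  shows "F_transform M u - F_transform M v =
    (u - v) * (F_transform M u * F_transform M v * kernel_form M (\<lambda>_. 1) u v)"
proof -
  have "F_transform M u - F_transform M v =
    - (cauchy_transform M u - cauchy_transform M v) * (F_transform M u * F_transform M v)"
    using cauchy_transform_nonzero[OF assms(1)] cauchy_transform_nonzero[OF assms(2)]
    by (simp add: F_transform_def field_simps)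
  then show ?thesis
    unfolding cauchy_transform_diff[OF finite_borel_measure_M assms] by (simp add: algebra_simps)
qed

lemma norm_F_transform_diff_le:
  assumes "0 < Im u" "0 < Im v"
  shows "cmod (F_transform M u - F_transform M v) \<le> cmod (u - v) *
    (cmod (F_transform M u) * cmod (F_transform M v) * sqrt (poisson_mass M u * poisson_mass M v))"
  unfolding F_transform_diff[OF assms] norm_mult
  by (intro mult_left_mono weighted_measure.norm_kernel_form_le[OF kernel_weight] assms) auto

lemma has_field_derivative_F_transform:
  assumes "0 < Im z"
  shows "(F_transform M has_field_derivative (F_transform M z)\<^sup>2 * kernel_form M (\<lambda>_. 1) z z) (at z)"
proof -
  have "((\<lambda>w. 1 / cauchy_transform M w) has_field_derivative
      (F_transform M z)\<^sup>2 * kernel_form M (\<lambda>_. 1) z z) (at z)"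
    using cauchy_transform_nonzero[OF assms]
    by (auto intro!: derivative_eq_intros has_field_derivative_cauchy_transform finite_borel_measure_M assms
        simp: F_transform_def power2_eq_square)
  then show ?thesis by (simp add: F_transform_def[abs_def])
qed

text \<open>A lower bound on \<open>Im w\<close> and an upper bound on |w| keep the Cauchy transform
  away from 0. The consequence used later is that a preimage of a distant point under F cannot stay
  in a bounded set of this kind.\<close>

lemma norm_F_transform_bounded:
  assumes "0 < b"
  obtains B where "\<And>w. b \<le> Im w \<Longrightarrow> cmod w \<le> R \<Longrightarrow> cmod (F_transform M w) \<le> B"
proof -
  obtain c where c: "0 < c" "\<And>z. 0 < Im z \<Longrightarrow> c / (1 + cmod z)\<^sup>2 \<le> poisson_mass M z"
    using poisson_mass_lower by metis
  have "cmod (F_transform M w) \<le> (1 + R)\<^sup>2 / (b * c)" if w: "b \<le> Im w" "cmod w \<le> R" for w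
  proof -
    have R: "0 \<le> R" using w(2) norm_ge_zero[of w] by linarith
    have "c / (1 + R)\<^sup>2 \<le> c / (1 + cmod w)\<^sup>2"
      using w R c(1) by (intro divide_left_mono mult_pos_pos power_mono zero_less_power) (auto intro: add_pos_nonneg)
    also have "\<dots> \<le> poisson_mass M w" using c(2) w assms by simp
    finally have "b * (c / (1 + R)\<^sup>2) \<le> Im w * poisson_mass M w"
      using w assms c(1) by (intro mult_mono) auto
    also have "\<dots> \<le> cmod (cauchy_transform M w)"
      using Im_cauchy_transform[OF finite_borel_measure_M, of w] w assms
        abs_Im_le_cmod[of "cauchy_transform M w"] by simp
    finally have *: "b * (c / (1 + R)\<^sup>2) \<le> cmod (cauchy_transform M w)" .
    have "0 < b * (c / (1 + R)\<^sup>2)" using assms c R by (auto intro!: mult_pos_pos divide_pos_pos)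
    then have "1 / cmod (cauchy_transform M w) \<le> 1 / (b * (c / (1 + R)\<^sup>2))"
      using * by (intro divide_left_mono mult_pos_pos[of "cmod (cauchy_transform M w)"]) linarith+
    then show ?thesis by (simp add: F_transform_def norm_divide)
  qed
  then show ?thesis using that by blast
qed

end

section \<open>Inverses of the reciprocal Cauchy transform near infinity\<close>

lemma truncated_cone_upper: "w \<in> truncated_cone \<alpha> \<beta> \<Longrightarrow> 0 \<le> \<beta> \<Longrightarrow> 0 < Im w"
  by (auto simp: truncated_cone_def)

lemma truncated_cone_norm_le:
  assumes "w \<in> truncated_cone \<alpha> \<beta>" "0 \<le> \<beta>"
  shows "cmod w \<le> (1 + \<alpha>) * Im w"
  using cmod_le[of w] assms by (auto simp: truncated_cone_def algebra_simps)

lemma truncated_cone_mono: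
  "\<alpha> \<le> \<alpha>' \<Longrightarrow> \<beta>' \<le> \<beta> \<Longrightarrow> 0 \<le> \<beta> \<Longrightarrow> truncated_cone \<alpha> \<beta> \<subseteq> truncated_cone \<alpha>' \<beta>'"
  by (auto simp: truncated_cone_def intro: less_le_trans mult_right_mono)

lemma truncated_cone_not_empty: "0 < \<alpha> \<Longrightarrow> truncated_cone \<alpha> \<beta> \<noteq> {}"
  by (auto simp: truncated_cone_def intro!: exI[of _ "\<i> * complex_of_real (\<bar>\<beta>\<bar> + 1)"])

lemma open_truncated_cone: "open (truncated_cone \<alpha> \<beta>)"
proof -
  have "truncated_cone \<alpha> \<beta> = {z. \<beta> < Im z} \<inter> {z. \<bar>Re z\<bar> < \<alpha> * Im z}"
    by (auto simp: truncated_cone_def)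
  then show ?thesis
    by (auto intro!: open_Int open_Collect_less continuous_intros)
qed

text \<open>A relative perturbation of this size maps the cone of aperture \<open>\<alpha>\<close> into that of aperture \<open>2 \<alpha> + 1\<close>.\<close>

definition cone_radius :: "real \<Rightarrow> real" where
  "cone_radius \<alpha> = 1 / (4 * (1 + \<alpha>))"

lemma cone_radius_pos: "0 < \<alpha> \<Longrightarrow> 0 < cone_radius \<alpha>"
  and cone_radius_less: "0 < \<alpha> \<Longrightarrow> cone_radius \<alpha> < 1/4"
  by (auto simp: cone_radius_def field_simps)

lemma truncated_cone_perturb:
  assumes "0 < \<alpha>" "0 \<le> R" "z \<in> truncated_cone \<alpha> (2 * R)" "cmod (w - z) \<le> cone_radius \<alpha> * cmod z"
  shows "w \<in> truncated_cone (2 * \<alpha> + 1) R"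
proof -
  have z: "2 * R < Im z" "\<bar>Re z\<bar> < \<alpha> * Im z" "0 < Im z"
    using assms(2,3) by (auto simp: truncated_cone_def)
  have "cmod (w - z) \<le> cone_radius \<alpha> * ((1 + \<alpha>) * Im z)"
    using assms truncated_cone_norm_le[OF assms(3)] cone_radius_pos[OF assms(1)]
    by (auto intro: order_trans mult_left_mono)
  also have "\<dots> = Im z / 4"
    using assms(1) by (simp add: cone_radius_def divide_simps)
  finally have *: "cmod (w - z) \<le> Im z / 4" .
  have "\<bar>Im w - Im z\<bar> \<le> Im z / 4" "\<bar>Re w - Re z\<bar> \<le> Im z / 4"
    using * abs_Im_le_cmod[of "w - z"] abs_Re_le_cmod[of "w - z"] by auto
  then have "3/4 * Im z \<le> Im w" "\<bar>Re w\<bar> < (\<alpha> + 1/4) * Im z"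
    using z by (auto simp: algebra_simps abs_if split: if_splits)
  moreover have "(\<alpha> + 1/4) * Im z \<le> (2 * \<alpha> + 1) * (3/4 * Im z)"
    using z assms(1) by (simp add: algebra_simps)
  moreover have "(2 * \<alpha> + 1) * (3/4 * Im z) \<le> (2 * \<alpha> + 1) * Im w"
    using \<open>3/4 * Im z \<le> Im w\<close> assms(1) by (intro mult_left_mono) auto
  ultimately have "\<bar>Re w\<bar> < (2 * \<alpha> + 1) * Im w" "R < Im w"
    using z assms(2) by (meson less_le_trans order_trans, linarith)
  then show ?thesis by (simp add: truncated_cone_def)
qed

section \<open>Asymptotics of F in truncated cones\<close>

context real_distribution
begin

lemma cone_kernel_small:
  assumes "0 < \<alpha>" "0 < \<delta>"
  obtains R where "0 < R" "\<And>w. w \<in> truncated_cone \<alpha> R \<Longrightarrow>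
    integrable M (\<lambda>s. cmod (w / (w - complex_of_real s) - 1)) \<and>
    (\<integral>s. cmod (w / (w - complex_of_real s) - 1) \<partial>M) \<le> \<delta>"
proof -
  \<comment> \<open>An envelope of the integrand: w / (w - s) - 1 equals s / (w - s) and is at most
    |s| / Im w; it is also at most 2 + \<alpha>, because |w| \<le> (1 + \<alpha>) Im w in the cone.
    The minimum of both is bounded and tends to 0 pointwise.\<close>
  define g where "g = (\<lambda>(n::nat) s. min (2 + \<alpha>) (\<bar>s\<bar> / real (Suc n)))"
  have int: "integrable M (g n)" for n
    unfolding g_def using assms
    by (intro integrable_const_bound[where B="2 + \<alpha>"]) (auto simp: min_def)
  have "(\<lambda>n. integral\<^sup>L M (g n)) \<longlonglongrightarrow> integral\<^sup>L M (\<lambda>_. 0::real)"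
  proof (rule integral_dominated_convergence[where w="\<lambda>_. 2 + \<alpha>"])
    show "AE x in M. (\<lambda>n. g n x) \<longlonglongrightarrow> 0"
    proof (rule AE_I2)
      fix x
      have "(\<lambda>n. min (2 + \<alpha>) (\<bar>x\<bar> / real (Suc n))) \<longlonglongrightarrow> min (2 + \<alpha>) 0"
        by (intro tendsto_min tendsto_const) real_asymp
      then show "(\<lambda>n. g n x) \<longlonglongrightarrow> 0" using assms by (simp add: g_def)
    qed
    show "g n \<in> borel_measurable M" for n using int by auto
    show "AE x in M. norm (g n x) \<le> 2 + \<alpha>" for n
      using assms by (auto simp: g_def min_def)
  qed auto
  then have "\<forall>\<^sub>F n in sequentially. integral\<^sup>L M (g n) < \<delta>"
    using assms by (auto intro: order_tendstoD)
  then obtain n where n: "integral\<^sup>L M (g n) < \<delta>"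
    by (auto simp: eventually_sequentially)
  show ?thesis
  proof (rule that[of "real (Suc n)"])
    fix w assume w: "w \<in> truncated_cone \<alpha> (real (Suc n))"
    then have Im: "real (Suc n) < Im w" by (auto simp: truncated_cone_def)
    then have Im0: "0 < Im w" by linarith
    have le: "cmod (w / (w - complex_of_real s) - 1) \<le> g n s" for s
    proof -
      have nz: "w - complex_of_real s \<noteq> 0" using diff_real_nonzero Im0 by blast
      have ge: "Im w \<le> cmod (w - complex_of_real s)" using norm_diff_real_ge_Im[of w s] Im0 by simp
      have "cmod (w / (w - complex_of_real s) - 1) = \<bar>s\<bar> / cmod (w - complex_of_real s)"
      proof -
        have "w / (w - complex_of_real s) - 1 = complex_of_real s / (w - complex_of_real s)"
          using nz by (simp add: field_simps)
        then show ?thesis by (simp add: norm_divide)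
      qed
      also have "\<dots> \<le> \<bar>s\<bar> / real (Suc n)"
        using ge Im by (intro divide_left_mono mult_pos_pos) auto
      finally have 1: "cmod (w / (w - complex_of_real s) - 1) \<le> \<bar>s\<bar> / real (Suc n)" .
      have "cmod (w / (w - complex_of_real s) - 1) \<le> cmod w / cmod (w - complex_of_real s) + 1"
        using norm_triangle_ineq4[of "w / (w - complex_of_real s)" 1] by (simp add: norm_divide)
      also have "cmod w / cmod (w - complex_of_real s) \<le> 1 + \<alpha>"
        using order_trans[OF truncated_cone_norm_le[OF w] mult_left_mono[OF ge, of "1 + \<alpha>"]] nz assms
        by (simp add: divide_simps)
      finally show ?thesis using 1 by (simp add: g_def)
    qed
    have i: "integrable M (\<lambda>s. cmod (w / (w - complex_of_real s) - 1))"
      using order_trans[OF le abs_ge_self]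
      by (intro Bochner_Integration.integrable_bound[OF int[of n]]) (auto intro!: AE_I2)
    then show "integrable M (\<lambda>s. cmod (w / (w - complex_of_real s) - 1)) \<and>
        (\<integral>s. cmod (w / (w - complex_of_real s) - 1) \<partial>M) \<le> \<delta>"
      using n integral_mono[OF i int[of n] le] by linarith
  qed auto
qed

lemma cone_normalized_transforms:
  assumes "0 < \<alpha>" "0 < \<eta>"
  obtains R where "0 < R"
    "\<And>w. w \<in> truncated_cone \<alpha> R \<Longrightarrow> cmod (w * cauchy_transform M w - 1) \<le> \<eta>"
    "\<And>w v. w \<in> truncated_cone \<alpha> R \<Longrightarrow> v \<in> truncated_cone \<alpha> R \<Longrightarrow>
       cmod (w * v * kernel_form M (\<lambda>_. 1) w v - 1) \<le> \<eta>"
proof -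
  \<comment> \<open>With a = w / (w - s) and b = v / (v - s) the product splits as a b - 1 = (a - 1)
    b + (b - 1), where |b| \<le> 1 + \<alpha>. The errors add up to (2 + \<alpha>) \<delta>.\<close>
  define \<delta> where "\<delta> = \<eta> / (2 + \<alpha>)"
  have "0 < \<delta>" using assms by (simp add: \<delta>_def)
  then obtain R where R: "0 < R" "\<And>w. w \<in> truncated_cone \<alpha> R \<Longrightarrow>
    integrable M (\<lambda>s. cmod (w / (w - complex_of_real s) - 1)) \<and>
    (\<integral>s. cmod (w / (w - complex_of_real s) - 1) \<partial>M) \<le> \<delta>"
    using cone_kernel_small[OF assms(1)] by metis
  have \<delta>\<eta>: "\<delta> \<le> \<eta>" using assms by (simp add: \<delta>_def divide_simps)
  show ?thesis
  proof (rule that[OF R(1)])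
    fix w assume w: "w \<in> truncated_cone \<alpha> R"
    then have Im: "0 < Im w" using R(1) truncated_cone_upper[OF w] by simp
    have "w * cauchy_transform M w - 1 = (\<integral>s. w * (1 / (w - complex_of_real s)) - 1 \<partial>M)"
      unfolding cauchy_transform_def
      using integrable_cauchy_kernel[OF finite_borel_measure_M Im]
      by (subst Bochner_Integration.integral_diff)
        (simp_all only: integral_mult_right_zero integrable_mult_right integrable_const lebesgue_integral_const prob_space, (simp)?)
    also have "cmod \<dots> \<le> (\<integral>s. cmod (w / (w - complex_of_real s) - 1) \<partial>M)"
      by (rule integral_norm_bound[THEN order_trans]) simp
    finally show "cmod (w * cauchy_transform M w - 1) \<le> \<eta>" using R(2)[OF w] \<delta>\<eta> by linarith
  next
    fix w v assume w: "w \<in> truncated_cone \<alpha> R" and v: "v \<in> truncated_cone \<alpha> R"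
    then have Im: "0 < Im w" "0 < Im v"
      using R(1) truncated_cone_upper[OF w] truncated_cone_upper[OF v] by simp_all
    have "w * v * kernel_form M (\<lambda>_. 1) w v - 1 =
       (\<integral>s. w * v * (complex_of_real 1 / ((w - complex_of_real s) * (v - complex_of_real s))) - 1 \<partial>M)"
      unfolding kernel_form_def
      using weighted_measure.integrable_kernel_form[OF kernel_weight Im]
      by (subst Bochner_Integration.integral_diff)
        (simp_all only: integral_mult_right_zero integrable_mult_right integrable_const lebesgue_integral_const prob_space, (simp)?)
    also have "cmod \<dots> \<le> (\<integral>s. cmod (w / (w - complex_of_real s) - 1) * (1 + \<alpha>)
         + cmod (v / (v - complex_of_real s) - 1) \<partial>M)"
    proof (rule order_trans[OF integral_norm_bound integral_mono])
      show "integrable M (\<lambda>s. cmod (w / (w - complex_of_real s) - 1) * (1 + \<alpha>)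
         + cmod (v / (v - complex_of_real s) - 1))"
        using R(2) w v by (intro Bochner_Integration.integrable_add integrable_mult_left) auto
      show "integrable M (\<lambda>s. cmod (w * v * (complex_of_real 1 /
          ((w - complex_of_real s) * (v - complex_of_real s))) - 1))"
        by (intro integrable_norm Bochner_Integration.integrable_diff integrable_mult_right
            weighted_measure.integrable_kernel_form[OF kernel_weight Im] integrable_const)
      fix s
      define a where "a = w / (w - complex_of_real s)"
      define b where "b = v / (v - complex_of_real s)"
      have ge: "Im v \<le> cmod (v - complex_of_real s)" using norm_diff_real_ge_Im[of v s] Im by simp
      have "cmod b \<le> 1 + \<alpha>"
        using order_trans[OF truncated_cone_norm_le[OF v] mult_left_mono[OF ge, of "1 + \<alpha>"]] R(1)
          diff_real_nonzero[OF Im(2), of s] assms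
        by (simp add: b_def norm_divide divide_simps)
      then have "cmod ((a - 1) * b) \<le> cmod (a - 1) * (1 + \<alpha>)"
        by (auto simp: norm_mult intro: mult_left_mono)
      moreover have "a * b - 1 = (a - 1) * b + (b - 1)" by (simp add: algebra_simps)
      ultimately have "cmod (a * b - 1) \<le> cmod (a - 1) * (1 + \<alpha>) + cmod (b - 1)"
        using norm_triangle_ineq[of "(a - 1) * b" "b - 1"] by (simp only:)
      then show "cmod (w * v * (complex_of_real 1 / ((w - complex_of_real s) * (v - complex_of_real s))) - 1)
        \<le> cmod (w / (w - complex_of_real s) - 1) * (1 + \<alpha>) + cmod (v / (v - complex_of_real s) - 1)"
        by (simp add: a_def b_def)
    qed
    also have "\<dots> = (\<integral>s. cmod (w / (w - complex_of_real s) - 1) \<partial>M) * (1 + \<alpha>)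
        + (\<integral>s. cmod (v / (v - complex_of_real s) - 1) \<partial>M)"
      using R(2)[OF w] R(2)[OF v] by simp
    also have "\<dots> \<le> \<delta> * (1 + \<alpha>) + \<delta>"
      using R(2)[OF w] R(2)[OF v] assms by (intro add_mono mult_right_mono) auto
    also have "\<dots> = \<delta> * (2 + \<alpha>)" by (simp add: algebra_simps)
    also have "\<dots> = \<eta>" using assms by (simp add: \<delta>_def)
    finally show "cmod (w * v * kernel_form M (\<lambda>_. 1) w v - 1) \<le> \<eta>" .
  qed
qed

text \<open>In terms of the normalised quantities \<open>A\<close>, \<open>B\<close>,
  \<open>C\<close> of the proof, F w = w / B and the difference quotient of F is A / (B C), all of
  them close to 1. The Lipschitz bound on F w - w is the source of injectivity and of contractions
  in cones.\<close>

lemma F_transform_cone_asymptotics: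
  assumes "0 < \<alpha>" "0 < \<epsilon>"
  obtains R where "0 < R"
    "\<And>w. w \<in> truncated_cone \<alpha> R \<Longrightarrow> cmod (F_transform M w - w) \<le> \<epsilon> * cmod w"
    "\<And>w v. w \<in> truncated_cone \<alpha> R \<Longrightarrow> v \<in> truncated_cone \<alpha> R \<Longrightarrow>
       cmod ((F_transform M w - w) - (F_transform M v - v)) \<le> \<epsilon> * cmod (w - v)"
proof -
  \<comment> \<open>The numerator of A / (B C) - 1 is at most 4 \<eta> and the denominator is at
    least 1/4 in modulus, hence the factor 16.\<close>
  define \<eta> where "\<eta> = min (1/2) (\<epsilon> / 16)"
  have \<eta>: "0 < \<eta>" "\<eta> \<le> 1/2" "16 * \<eta> \<le> \<epsilon>" using assms by (auto simp: \<eta>_def min_def)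
  obtain R where R: "0 < R"
    "\<And>w. w \<in> truncated_cone \<alpha> R \<Longrightarrow> cmod (w * cauchy_transform M w - 1) \<le> \<eta>"
    "\<And>w v. w \<in> truncated_cone \<alpha> R \<Longrightarrow> v \<in> truncated_cone \<alpha> R \<Longrightarrow>
       cmod (w * v * kernel_form M (\<lambda>_. 1) w v - 1) \<le> \<eta>"
    using cone_normalized_transforms[OF assms(1) \<eta>(1)] by metis
  have low: "1/2 \<le> cmod (w * cauchy_transform M w)" if "w \<in> truncated_cone \<alpha> R" for w
    using R(2)[OF that] \<eta>(2) norm_triangle_ineq2[of 1 "1 - w * cauchy_transform M w"]
    by (simp add: norm_minus_commute)
  show ?thesis
  proof (rule that[OF R(1)])
    fix w assume w: "w \<in> truncated_cone \<alpha> R"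
    have Im: "0 < Im w" using truncated_cone_upper[OF w] R(1) by simp
    define B where "B = w * cauchy_transform M w"
    have B: "cmod (B - 1) \<le> \<eta>" "1/2 \<le> cmod B" using R(2)[OF w] low[OF w] by (auto simp: B_def)
    have "F_transform M w = w / B"
      using Im by (auto simp: B_def F_transform_def)
    moreover have "w / B - w = w * ((1 - B) / B)"
    proof -
      have "B \<noteq> 0" using B(2) by auto
      then show ?thesis by (simp add: field_simps)
    qed
    ultimately have "F_transform M w - w = w * ((1 - B) / B)" by simp
    moreover have "cmod ((1 - B) / B) \<le> \<epsilon>"
    proof -
      have "cmod (1 - B) / cmod B \<le> \<eta> / (1/2)"
        using B \<eta>(1) by (intro frac_le) (auto simp: norm_minus_commute)
      then show ?thesis using \<eta> by (simp add: norm_divide)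
    qed
    ultimately show "cmod (F_transform M w - w) \<le> \<epsilon> * cmod w"
      using mult_right_mono[of "cmod ((1 - B) / B)" \<epsilon> "cmod w"]
      by (simp only: norm_mult mult.commute norm_ge_zero)
  next
    fix w v assume w: "w \<in> truncated_cone \<alpha> R" and v: "v \<in> truncated_cone \<alpha> R"
    have Im: "0 < Im w" "0 < Im v"
      using R(1) truncated_cone_upper[OF w] truncated_cone_upper[OF v] by simp_all
    define A where "A = w * v * kernel_form M (\<lambda>_. 1) w v"
    define B where "B = w * cauchy_transform M w"
    define C where "C = v * cauchy_transform M v"
    have A: "cmod (A - 1) \<le> \<eta>" using R(3)[OF w v] by (simp add: A_def)
    have B: "cmod (B - 1) \<le> \<eta>" "1/2 \<le> cmod B" using R(2)[OF w] low[OF w] by (auto simp: B_def)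
    have C: "cmod (C - 1) \<le> \<eta>" "1/2 \<le> cmod C" using R(2)[OF v] low[OF v] by (auto simp: C_def)
    have nz: "B \<noteq> 0" "C \<noteq> 0" "w \<noteq> 0" "v \<noteq> 0" using B C Im by auto
    have "(F_transform M w - w) - (F_transform M v - v) = (w - v) * (A / (B * C) - 1)"
    proof -
      have "F_transform M w * F_transform M v * kernel_form M (\<lambda>_. 1) w v = A / (B * C)"
        using nz(3,4) by (simp add: A_def B_def C_def F_transform_def)
      then show ?thesis
        using F_transform_diff[OF Im] by (simp add: algebra_simps)
    qed
    moreover have "cmod (A / (B * C) - 1) \<le> \<epsilon>"
    proof -
      have "A / (B * C) - 1 = ((A - 1) - (B - 1) * C - (C - 1)) / (B * C)"
        using nz by (simp add: field_simps)
      moreover have "cmod ((A - 1) - (B - 1) * C - (C - 1)) \<le> \<eta> + \<eta> * 2 + \<eta>"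
      proof -
        have "cmod C \<le> 2" using C(1) \<eta>(2) norm_triangle_ineq[of "C - 1" 1] by simp
        then have "cmod ((B - 1) * C) \<le> \<eta> * 2"
          unfolding norm_mult using B(1) \<eta>(1) by (intro mult_mono) auto
        then show ?thesis using A C(1)
          by (smt (verit) norm_triangle_ineq4)
      qed
      moreover have "1/4 \<le> cmod (B * C)"
        using mult_mono[OF B(2) C(2)] by (simp add: norm_mult)
      ultimately have "cmod (A / (B * C) - 1) \<le> (\<eta> + \<eta> * 2 + \<eta>) / (1/4)"
        unfolding norm_divide using \<eta>(1) by (simp only: norm_divide) (intro frac_le, auto)
      then show ?thesis using \<eta> by simp
    qed
    ultimately show "cmod ((F_transform M w - w) - (F_transform M v - v)) \<le> \<epsilon> * cmod (w - v)"
      using mult_right_mono[of "cmod (A / (B * C) - 1)" \<epsilon> "cmod (w - v)"]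
      by (simp add: norm_mult mult.commute)
  qed
qed

lemma F_transform_inj_on_cone:
  assumes "0 < \<alpha>"
  obtains R where "0 < R" "inj_on (F_transform M) (truncated_cone \<alpha> R)"
proof -
  obtain R where R: "0 < R"
    "\<And>w v. w \<in> truncated_cone \<alpha> R \<Longrightarrow> v \<in> truncated_cone \<alpha> R \<Longrightarrow>
       cmod ((F_transform M w - w) - (F_transform M v - v)) \<le> 1/2 * cmod (w - v)"
    using F_transform_cone_asymptotics[OF assms, of "1/2"] by (metis half_gt_zero zero_less_one)
  have "inj_on (F_transform M) (truncated_cone \<alpha> R)"
  proof (rule inj_onI)
    fix w v assume wv: "w \<in> truncated_cone \<alpha> R" "v \<in> truncated_cone \<alpha> R" "F_transform M w = F_transform M v"
    then have "cmod (v - w) \<le> 1/2 * cmod (w - v)" using R(2)[OF wv(1,2)] by simp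
    then show "w = v" by (simp add: norm_minus_commute)
  qed
  then show ?thesis using that R(1) by blast
qed

end

text \<open>
  A branch-free form of \<open>voiculescu_transform_on\<close>: the bound on \<open>\<phi> z\<close> keeps \<open>z + \<phi> z\<close> in a cone where
  the reciprocal Cauchy transform is injective, so that no inverse has to be chosen.
\<close>

definition asymptotic_inverse :: "real measure \<Rightarrow> (complex \<Rightarrow> complex) \<Rightarrow> real \<Rightarrow> bool" where
  "asymptotic_inverse \<mu> \<phi> \<alpha> \<longleftrightarrow> 0 < \<alpha> \<and>
     (\<exists>B>0. \<forall>z\<in>truncated_cone \<alpha> B.
        F_transform \<mu> (z + \<phi> z) = z \<and> cmod (\<phi> z) \<le> cone_radius \<alpha> * cmod z)"

lemma cone_radius_antimono: "0 < \<alpha> \<Longrightarrow> \<alpha> \<le> \<alpha>' \<Longrightarrow> cone_radius \<alpha>' \<le> cone_radius \<alpha>"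
  by (auto simp: cone_radius_def intro!: divide_left_mono)

lemma asymptotic_inverse_mono:
  assumes "asymptotic_inverse \<mu> \<phi> \<alpha>" "0 < \<alpha>'" "\<alpha>' \<le> \<alpha>"
  shows "asymptotic_inverse \<mu> \<phi> \<alpha>'"
proof -
  obtain B where B: "B > 0" "\<And>z. z \<in> truncated_cone \<alpha> B \<Longrightarrow>
      F_transform \<mu> (z + \<phi> z) = z \<and> cmod (\<phi> z) \<le> cone_radius \<alpha> * cmod z"
    using assms(1) by (auto simp: asymptotic_inverse_def)
  have "F_transform \<mu> (z + \<phi> z) = z \<and> cmod (\<phi> z) \<le> cone_radius \<alpha>' * cmod z"
    if "z \<in> truncated_cone \<alpha>' B" for z
  proof -
    have "z \<in> truncated_cone \<alpha> B"
      using that truncated_cone_mono[of \<alpha>' \<alpha> B B] assms B(1) by auto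
    moreover have "cone_radius \<alpha> * cmod z \<le> cone_radius \<alpha>' * cmod z"
      using cone_radius_antimono[of \<alpha>' \<alpha>] assms by (intro mult_right_mono) auto
    ultimately show ?thesis using B(2)[of z] by linarith
  qed
  then show ?thesis using assms(2) B(1) by (auto simp: asymptotic_inverse_def)
qed

lemma asymptotic_inverse_cong:
  assumes "asymptotic_inverse \<mu> \<phi> \<alpha>" "\<And>z. z \<in> truncated_cone \<alpha> C \<Longrightarrow> \<psi> z = \<phi> z"
  shows "asymptotic_inverse \<mu> \<psi> \<alpha>"
proof -
  obtain B where B: "B > 0" "\<And>z. z \<in> truncated_cone \<alpha> B \<Longrightarrow>
      F_transform \<mu> (z + \<phi> z) = z \<and> cmod (\<phi> z) \<le> cone_radius \<alpha> * cmod z"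
    using assms(1) by (auto simp: asymptotic_inverse_def)
  have "F_transform \<mu> (z + \<psi> z) = z \<and> cmod (\<psi> z) \<le> cone_radius \<alpha> * cmod z"
    if "z \<in> truncated_cone \<alpha> (max B C)" for z
    using that B(2)[of z] assms(2)[of z] by (auto simp: truncated_cone_def)
  then show ?thesis using assms(1) B(1)
    by (auto simp: asymptotic_inverse_def intro!: exI[of _ "max B C"])
qed

section \<open>Voiculescu transforms as asymptotic inverses\<close>

context real_distribution
begin

text \<open>The branch takes values in a cone that is only known to keep a distance from the real
  axis, so a preimage of a distant z might a priori stay low. Boundedness of F on bounded parts of
  that cone forces it high up, where F is close to the identity; only then is
  \<open>\<phi> z\<close> known to be small.\<close>

lemma voiculescu_transform_onD:
  assumes "voiculescu_transform_on M \<phi> \<alpha> \<beta>" "0 < \<epsilon>"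
  obtains B where "0 < B" "\<And>z. z \<in> truncated_cone \<alpha> B \<Longrightarrow>
    F_transform M (z + \<phi> z) = z \<and> cmod (\<phi> z) \<le> \<epsilon> * cmod z"
proof -
  obtain \<alpha>' \<beta>' where *: "0 < \<alpha>'" "0 < \<beta>'"
    "truncated_cone \<alpha> \<beta> \<subseteq> F_transform M ` truncated_cone \<alpha>' \<beta>'"
    "\<And>z. z \<in> truncated_cone \<alpha> \<beta> \<Longrightarrow> \<phi> z = inv_into (truncated_cone \<alpha>' \<beta>') (F_transform M) z - z"
    using assms(1) unfolding voiculescu_transform_on_def by blast
  define \<epsilon>' where "\<epsilon>' = min (1/2) (\<epsilon> / 2)"
  have \<epsilon>': "0 < \<epsilon>'" "\<epsilon>' \<le> 1/2" "2 * \<epsilon>' \<le> \<epsilon>" using assms(2) by (auto simp: \<epsilon>'_def)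
  obtain R where R: "0 < R"
    "\<And>w. w \<in> truncated_cone \<alpha>' R \<Longrightarrow> cmod (F_transform M w - w) \<le> \<epsilon>' * cmod w"
    using F_transform_cone_asymptotics[OF *(1) \<epsilon>'(1)] by metis
  obtain B0 where B0: "\<And>w. \<beta>' \<le> Im w \<Longrightarrow> cmod w \<le> (1 + \<alpha>') * R \<Longrightarrow> cmod (F_transform M w) \<le> B0"
    using norm_F_transform_bounded[OF *(2)] by metis
  show ?thesis
  proof (rule that[of "max \<beta> (max B0 1)"])
    fix z assume z: "z \<in> truncated_cone \<alpha> (max \<beta> (max B0 1))"
    then have z\<beta>: "z \<in> truncated_cone \<alpha> \<beta>" and zB: "B0 < Im z" "1 < Im z"
      by (auto simp: truncated_cone_def)
    define w where "w = inv_into (truncated_cone \<alpha>' \<beta>') (F_transform M) z"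
    have w: "w \<in> truncated_cone \<alpha>' \<beta>'" "F_transform M w = z" "\<phi> z = w - z"
      using z\<beta> *(3,4) unfolding w_def by (auto intro: inv_into_into f_inv_into_f)
    have "R < Im w"
    proof (rule ccontr)
      assume "\<not> R < Im w"
      then have "(1 + \<alpha>') * Im w \<le> (1 + \<alpha>') * R" using *(1) by (intro mult_left_mono) auto
      then have "cmod w \<le> (1 + \<alpha>') * R"
        using truncated_cone_norm_le[OF w(1)] *(2) by linarith
      then have "cmod z \<le> B0" using B0[of w] w by (auto simp: truncated_cone_def)
      then show False using zB abs_Im_le_cmod[of z] by linarith
    qed
    then have "w \<in> truncated_cone \<alpha>' R" using w(1) by (auto simp: truncated_cone_def)
    then have d: "cmod (z - w) \<le> \<epsilon>' * cmod w" using R(2) w(2) by force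
    also have "\<dots> \<le> cmod w / 2" using mult_right_mono[OF \<epsilon>'(2), of "cmod w"] by simp
    finally have "cmod w \<le> 2 * cmod z" using norm_triangle_ineq2[of w z] by (simp add: norm_minus_commute)
    then have "\<epsilon>' * cmod w \<le> \<epsilon>' * (2 * cmod z)" using \<epsilon>' by (intro mult_left_mono) auto
    also have "\<dots> \<le> \<epsilon> * cmod z" using mult_right_mono[OF \<epsilon>'(3), of "cmod z"] by simp
    finally have "cmod (w - z) \<le> \<epsilon> * cmod z" using d by (simp add: norm_minus_commute)
    then show "F_transform M (z + \<phi> z) = z \<and> cmod (\<phi> z) \<le> \<epsilon> * cmod z"
      using w by simp
  qed auto
qed

lemma voiculescu_transform_on_imp_asymptotic_inverse:
  assumes "voiculescu_transform_on M \<phi> \<alpha> \<beta>"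
  shows "asymptotic_inverse M \<phi> \<alpha>"
proof -
  have \<alpha>: "0 < \<alpha>" using assms by (simp add: voiculescu_transform_on_def)
  obtain B where "0 < B" "\<And>z. z \<in> truncated_cone \<alpha> B \<Longrightarrow>
      F_transform M (z + \<phi> z) = z \<and> cmod (\<phi> z) \<le> cone_radius \<alpha> * cmod z"
    using voiculescu_transform_onD[OF assms cone_radius_pos[OF \<alpha>]] by metis
  then show ?thesis using \<alpha> by (auto simp: asymptotic_inverse_def)
qed

lemma asymptotic_inverse_in_cone:
  assumes "asymptotic_inverse M \<phi> \<alpha>" "0 \<le> R"
  obtains B where "0 < B" "2 * R \<le> B"
    "\<And>z. z \<in> truncated_cone \<alpha> B \<Longrightarrow> F_transform M (z + \<phi> z) = z"
    "\<And>z. z \<in> truncated_cone \<alpha> B \<Longrightarrow> z + \<phi> z \<in> truncated_cone (2 * \<alpha> + 1) R"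
proof -
  have \<alpha>: "0 < \<alpha>" using assms by (simp add: asymptotic_inverse_def)
  obtain B where B: "B > 0" "\<And>z. z \<in> truncated_cone \<alpha> B \<Longrightarrow>
      F_transform M (z + \<phi> z) = z \<and> cmod (\<phi> z) \<le> cone_radius \<alpha> * cmod z"
    using assms(1) by (auto simp: asymptotic_inverse_def)
  show ?thesis
  proof (rule that[of "max B (2 * R)"])
    fix z assume "z \<in> truncated_cone \<alpha> (max B (2 * R))"
    then have z: "z \<in> truncated_cone \<alpha> B" "z \<in> truncated_cone \<alpha> (2 * R)"
      by (auto simp: truncated_cone_def)
    show "F_transform M (z + \<phi> z) = z" using B(2)[OF z(1)] by simp
    show "z + \<phi> z \<in> truncated_cone (2 * \<alpha> + 1) R"
      using truncated_cone_perturb[OF \<alpha> assms(2) z(2)] B(2)[OF z(1)] by simp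
  qed (use B in auto)
qed

text \<open>The points z + \<phi> z lie in the wider cone of aperture 2 \<alpha> + 1; far enough out
  F is injective there, so this cone can serve as the range of the branch.\<close>

lemma asymptotic_inverse_imp_voiculescu_transform_on:
  assumes "asymptotic_inverse M \<phi> \<alpha>"
  obtains B where "0 < B" "\<And>\<beta>. B \<le> \<beta> \<Longrightarrow> voiculescu_transform_on M \<phi> \<alpha> \<beta>"
proof -
  have \<alpha>: "0 < \<alpha>" using assms by (simp add: asymptotic_inverse_def)
  obtain R where R: "0 < R" "inj_on (F_transform M) (truncated_cone (2 * \<alpha> + 1) R)"
    using F_transform_inj_on_cone[of "2 * \<alpha> + 1"] \<alpha> by auto
  obtain B where B: "0 < B"
    "\<And>z. z \<in> truncated_cone \<alpha> B \<Longrightarrow> F_transform M (z + \<phi> z) = z"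
    "\<And>z. z \<in> truncated_cone \<alpha> B \<Longrightarrow> z + \<phi> z \<in> truncated_cone (2 * \<alpha> + 1) R"
    using asymptotic_inverse_in_cone[OF assms less_imp_le[OF R(1)]] by metis
  show ?thesis
  proof (rule that[OF B(1)])
    fix \<beta> assume \<beta>: "B \<le> \<beta>"
    have sub: "z \<in> truncated_cone \<alpha> B" if "z \<in> truncated_cone \<alpha> \<beta>" for z
      using that \<beta> by (auto simp: truncated_cone_def)
    have "truncated_cone \<alpha> \<beta> \<subseteq> F_transform M ` truncated_cone (2 * \<alpha> + 1) R"
      using B(2,3) sub by (metis image_eqI subsetI)
    moreover have "\<phi> z = inv_into (truncated_cone (2 * \<alpha> + 1) R) (F_transform M) z - z"
      if "z \<in> truncated_cone \<alpha> \<beta>" for z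
      using inv_into_f_eq[OF R(2) B(3) B(2)] sub[OF that] by simp
    moreover have "0 < 2 * \<alpha> + 1" "0 < \<beta>" using \<alpha> B(1) \<beta> by auto
    ultimately show "voiculescu_transform_on M \<phi> \<alpha> \<beta>"
      unfolding voiculescu_transform_on_def using \<alpha> R by blast
  qed
qed

text \<open>Solutions of F w = z are the fixed points of \<open>T\<close>, which sends w to z - (F w
  - w). On the ball of radius r |z| around z one has |w| \<le> 2 |z|, so the ratio
  \<open>r / 2\<close> makes the ball invariant.\<close>

lemma asymptotic_inverse_exists:
  assumes \<alpha>: "0 < \<alpha>"
  obtains \<phi> where "asymptotic_inverse M \<phi> \<alpha>"
proof -
  define r where "r = cone_radius \<alpha>"
  have r: "0 < r" "r < 1/4"
    using cone_radius_pos[OF \<alpha>] cone_radius_less[OF \<alpha>] by (auto simp: r_def)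
  obtain R where R: "0 < R"
    "\<And>w. w \<in> truncated_cone (2 * \<alpha> + 1) R \<Longrightarrow> cmod (F_transform M w - w) \<le> r / 2 * cmod w"
    "\<And>w v. w \<in> truncated_cone (2 * \<alpha> + 1) R \<Longrightarrow> v \<in> truncated_cone (2 * \<alpha> + 1) R \<Longrightarrow>
       cmod ((F_transform M w - w) - (F_transform M v - v)) \<le> r / 2 * cmod (w - v)"
    using F_transform_cone_asymptotics[of "2 * \<alpha> + 1" "r / 2"] \<alpha> r by (metis add_pos_pos half_gt_zero mult_pos_pos zero_less_numeral zero_less_one)
  have "\<exists>p. F_transform M (z + p) = z \<and> cmod p \<le> r * cmod z" if z: "z \<in> truncated_cone \<alpha> (2 * R)" for z
  proof -
    define S where "S = cball z (r * cmod z)"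
    have S: "w \<in> truncated_cone (2 * \<alpha> + 1) R" "cmod w \<le> 2 * cmod z" if "w \<in> S" for w
    proof -
      have w: "cmod (w - z) \<le> r * cmod z" using that by (simp add: S_def dist_norm norm_minus_commute)
      then show "w \<in> truncated_cone (2 * \<alpha> + 1) R"
        using truncated_cone_perturb[OF \<alpha> _ z] R(1) by (simp add: r_def)
      have "r * cmod z \<le> 1/4 * cmod z" using r by (intro mult_right_mono) auto
      then show "cmod w \<le> 2 * cmod z" using w norm_triangle_ineq2[of w z] norm_ge_zero[of z] by linarith
    qed
    define T where "T = (\<lambda>w. z - (F_transform M w - w))"
    have "\<exists>!w\<in>S. T w = w"
    proof (rule Banach_fix[OF compact_imp_complete])
      show "compact S" by (simp add: S_def)
      have "z \<in> S" using r by (simp add: S_def)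
      then show "S \<noteq> {}" by blast
      show "0 \<le> r / 2" "r / 2 < 1" using r by auto
      show "T ` S \<subseteq> S"
      proof (rule image_subsetI)
        fix w assume w: "w \<in> S"
        have "cmod (F_transform M w - w) \<le> r / 2 * (2 * cmod z)"
          using r by (intro order_trans[OF R(2)[OF S(1)[OF w]] mult_left_mono[OF S(2)[OF w]]]) auto
        then show "T w \<in> S" by (simp add: T_def S_def dist_norm)
      qed
      show "dist (T x) (T y) \<le> r / 2 * dist x y" if "x \<in> S" "y \<in> S" for x y
        using R(3)[OF S(1)[OF that(1)] S(1)[OF that(2)]] by (simp add: T_def dist_norm norm_minus_commute algebra_simps)
    qed
    then obtain w where w: "w \<in> S" "T w = w" by blast
    then have "F_transform M (z + (w - z)) = z" "cmod (w - z) \<le> r * cmod z"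
      by (auto simp: T_def S_def dist_norm norm_minus_commute)
    then show ?thesis by blast
  qed
  then obtain \<phi> where "\<And>z. z \<in> truncated_cone \<alpha> (2 * R) \<Longrightarrow>
      F_transform M (z + \<phi> z) = z \<and> cmod (\<phi> z) \<le> r * cmod z"
    by metis
  then have "asymptotic_inverse M \<phi> \<alpha>"
    using \<alpha> R(1) unfolding asymptotic_inverse_def r_def by (auto intro!: exI[of _ "2 * R"])
  then show ?thesis using that by blast
qed

lemma asymptotic_inverse_unique:
  assumes "asymptotic_inverse M \<phi> \<alpha>" "asymptotic_inverse M \<psi> \<alpha>"
  obtains B where "0 < B" "\<And>z. z \<in> truncated_cone \<alpha> B \<Longrightarrow> \<phi> z = \<psi> z"
proof -
  have \<alpha>: "0 < \<alpha>" using assms by (simp add: asymptotic_inverse_def)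
  obtain R where R: "0 < R" "inj_on (F_transform M) (truncated_cone (2 * \<alpha> + 1) R)"
    using F_transform_inj_on_cone[of "2 * \<alpha> + 1"] \<alpha> by auto
  obtain B where B: "0 < B"
    "\<And>z. z \<in> truncated_cone \<alpha> B \<Longrightarrow> F_transform M (z + \<phi> z) = z"
    "\<And>z. z \<in> truncated_cone \<alpha> B \<Longrightarrow> z + \<phi> z \<in> truncated_cone (2 * \<alpha> + 1) R"
    using asymptotic_inverse_in_cone[OF assms(1) less_imp_le[OF R(1)]] by metis
  obtain C where C: "0 < C"
    "\<And>z. z \<in> truncated_cone \<alpha> C \<Longrightarrow> F_transform M (z + \<psi> z) = z"
    "\<And>z. z \<in> truncated_cone \<alpha> C \<Longrightarrow> z + \<psi> z \<in> truncated_cone (2 * \<alpha> + 1) R"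
    using asymptotic_inverse_in_cone[OF assms(2) less_imp_le[OF R(1)]] by metis
  show ?thesis
  proof (rule that[of "max B C"])
    fix z assume "z \<in> truncated_cone \<alpha> (max B C)"
    then have "z \<in> truncated_cone \<alpha> B" "z \<in> truncated_cone \<alpha> C" by (auto simp: truncated_cone_def)
    then have "z + \<phi> z = z + \<psi> z"
      using B(2,3) C(2,3) R(2) by (metis inj_onD)
    then show "\<phi> z = \<psi> z" by simp
  qed (use B in auto)
qed

text \<open>F moves the cone of aperture \<alpha> / 2 into that of aperture \<alpha>, where \<phi>
  is controlled. Then u and F u + \<phi> (F u) have the same image under F and lie in a common cone
  of injectivity, so they agree.\<close>

lemma asymptotic_inverse_left_inverse:
  assumes "asymptotic_inverse M \<phi> \<alpha>" "0 \<le> C"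
  obtains B where "0 < B" "\<And>u. u \<in> truncated_cone (\<alpha> / 2) B \<Longrightarrow>
    F_transform M u \<in> truncated_cone \<alpha> C \<and> F_transform M u + \<phi> (F_transform M u) = u"
proof -
  have \<alpha>: "0 < \<alpha>" using assms by (simp add: asymptotic_inverse_def)
  obtain R where R: "0 < R" "inj_on (F_transform M) (truncated_cone (2 * \<alpha> + 1) R)"
    using F_transform_inj_on_cone[of "2 * \<alpha> + 1"] \<alpha> by auto
  obtain B where B: "0 < B" "2 * R \<le> B"
    "\<And>z. z \<in> truncated_cone \<alpha> B \<Longrightarrow> F_transform M (z + \<phi> z) = z"
    "\<And>z. z \<in> truncated_cone \<alpha> B \<Longrightarrow> z + \<phi> z \<in> truncated_cone (2 * \<alpha> + 1) R"
    using asymptotic_inverse_in_cone[OF assms(1) less_imp_le[OF R(1)]] by metis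
  \<comment> \<open>Makes the horizontal displacement at most \<alpha> / 4 times
    \<open>Im u\<close>, which fits into the gap between the apertures \<alpha> / 2 and
    \<alpha>.\<close>
  define \<epsilon> where "\<epsilon> = \<alpha> / (4 * (1 + \<alpha>))"
  have \<epsilon>: "0 < \<epsilon>" "\<epsilon> * (1 + \<alpha>) = \<alpha> / 4" using \<alpha> by (auto simp: \<epsilon>_def field_simps)
  obtain R' where R': "0 < R'"
    "\<And>w. w \<in> truncated_cone \<alpha> R' \<Longrightarrow> cmod (F_transform M w - w) \<le> \<epsilon> * cmod w"
    using F_transform_cone_asymptotics[OF \<alpha> \<epsilon>(1)] by metis
  show ?thesis
  proof (rule that[of "max (max B C) R'"])
    fix u assume u: "u \<in> truncated_cone (\<alpha> / 2) (max (max B C) R')"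
    then have Im: "B < Im u" "C < Im u" "R' < Im u" "\<bar>Re u\<bar> < \<alpha> / 2 * Im u"
      by (auto simp: truncated_cone_def)
    then have Im0: "0 < Im u" using B by linarith
    have "\<alpha> / 2 * Im u < \<alpha> * Im u" using \<alpha> Im0 by simp
    then have u': "u \<in> truncated_cone \<alpha> R'" and u'': "u \<in> truncated_cone \<alpha> R"
      using Im B R by (auto simp: truncated_cone_def)
    define z where "z = F_transform M u"
    have "cmod (z - u) \<le> \<epsilon> * ((1 + \<alpha>) * Im u)"
      using R'(2)[OF u'] truncated_cone_norm_le[OF u'] R'(1) \<epsilon>(1)
      by (auto simp: z_def intro: order_trans mult_left_mono)
    also have "\<dots> = \<alpha> / 4 * Im u" by (simp only: \<epsilon>(2) mult.assoc[symmetric])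
    finally have "\<bar>Re z - Re u\<bar> \<le> \<alpha> / 4 * Im u" using abs_Re_le_cmod[of "z - u"] by simp
    then have "\<bar>Re z\<bar> < \<alpha> * Im u" using Im \<alpha> Im0 by (simp add: abs_if split: if_splits)
    moreover have "Im u \<le> Im z" using Im_F_transform_ge[OF Im0] by (simp add: z_def)
    moreover have "\<alpha> * Im u \<le> \<alpha> * Im z" using \<open>Im u \<le> Im z\<close> \<alpha> by simp
    ultimately have z: "z \<in> truncated_cone \<alpha> B" "z \<in> truncated_cone \<alpha> C"
      using Im by (auto simp: truncated_cone_def)
    have "u \<in> truncated_cone (2 * \<alpha> + 1) R"
      using u'' truncated_cone_mono[of \<alpha> "2 * \<alpha> + 1" R R] \<alpha> R by auto
    moreover have "F_transform M (z + \<phi> z) = F_transform M u" using B(3)[OF z(1)] by (simp add: z_def)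
    ultimately have "z + \<phi> z = u" using B(4)[OF z(1)] R(2) by (meson inj_onD)
    then show "F_transform M u \<in> truncated_cone \<alpha> C \<and> F_transform M u + \<phi> (F_transform M u) = u"
      using z by (simp add: z_def)
  qed (use B in auto)
qed

lemma global_left_inverse:
  assumes "asymptotic_inverse M \<phi> \<alpha>" "\<phi> holomorphic_on upper_half_plane" "0 < Im u"
  shows "F_transform M u + \<phi> (F_transform M u) = u"
proof -
  have \<alpha>: "0 < \<alpha>" using assms by (simp add: asymptotic_inverse_def)
  obtain B where B: "0 < B" "\<And>u. u \<in> truncated_cone (\<alpha> / 2) B \<Longrightarrow>
      F_transform M u + \<phi> (F_transform M u) = u"
    using asymptotic_inverse_left_inverse[OF assms(1) order_refl] by metis
  show ?thesis
  proof (rule upper_half_plane_identity[where S = "truncated_cone (\<alpha> / 2) B"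
        and f = "\<lambda>u. F_transform M u + \<phi> (F_transform M u)" and g = "\<lambda>u. u"])
    have "(\<phi> \<circ> F_transform M) holomorphic_on upper_half_plane"
      by (rule holomorphic_on_compose_gen[OF F_transform_holomorphic assms(2)])
        (auto intro: Im_F_transform_pos)
    then show "(\<lambda>u. F_transform M u + \<phi> (F_transform M u)) holomorphic_on upper_half_plane"
      by (intro holomorphic_intros F_transform_holomorphic) (simp add: o_def)
    show "truncated_cone (\<alpha> / 2) B \<noteq> {}" using \<alpha> by (intro truncated_cone_not_empty) auto
    show "truncated_cone (\<alpha> / 2) B \<subseteq> upper_half_plane"
      using B(1) truncated_cone_upper by force
  qed (use B assms in \<open>auto intro: open_truncated_cone holomorphic_intros\<close>)
qed

end

text \<open>In a cone u = f + \<phi> f with f = \<open>F_transform \<mu> u\<close>. Applying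
  \<open>F_transform \<nu>\<close> to this equation returns f, since \<phi> also belongs to
  \<nu>.\<close>

lemma F_transform_eqI:
  assumes "real_distribution \<mu>" "real_distribution \<nu>"
    and "asymptotic_inverse \<mu> \<phi> \<alpha>" "asymptotic_inverse \<nu> \<phi> \<alpha>" "0 < Im z"
  shows "F_transform \<mu> z = F_transform \<nu> z"
proof -
  interpret \<mu>: real_distribution \<mu> by fact
  interpret \<nu>: real_distribution \<nu> by fact
  have \<alpha>: "0 < \<alpha>" using assms by (simp add: asymptotic_inverse_def)
  obtain C where C: "0 < C" "\<And>z. z \<in> truncated_cone \<alpha> C \<Longrightarrow> F_transform \<nu> (z + \<phi> z) = z"
    using assms(4) by (auto simp: asymptotic_inverse_def)
  obtain B where B: "0 < B" "\<And>u. u \<in> truncated_cone (\<alpha> / 2) B \<Longrightarrow>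
      F_transform \<mu> u \<in> truncated_cone \<alpha> C \<and> F_transform \<mu> u + \<phi> (F_transform \<mu> u) = u"
    using \<mu>.asymptotic_inverse_left_inverse[OF assms(3), of C] C(1) by (metis less_imp_le)
  show ?thesis
  proof (rule upper_half_plane_identity[where S = "truncated_cone (\<alpha> / 2) B"
        and f = "F_transform \<mu>" and g = "F_transform \<nu>"])
    show "truncated_cone (\<alpha> / 2) B \<noteq> {}" using \<alpha> by (intro truncated_cone_not_empty) auto
    show "truncated_cone (\<alpha> / 2) B \<subseteq> upper_half_plane"
      using B(1) truncated_cone_upper by force
    show "F_transform \<mu> u = F_transform \<nu> u" if "u \<in> truncated_cone (\<alpha> / 2) B" for u
      using B(2)[OF that] C(2) by metis
  qed (use assms in \<open>auto intro: open_truncated_cone \<mu>.F_transform_holomorphic \<nu>.F_transform_holomorphic\<close>)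
qed

section \<open>Representation of Cauchy transforms\<close>

definition poisson_kernel :: "real \<Rightarrow> real \<Rightarrow> real" where
  "poisson_kernel y x = y / (x\<^sup>2 + y\<^sup>2)"

lemma measurable_poisson_kernel [measurable]: "poisson_kernel y \<in> borel_measurable borel"
  unfolding poisson_kernel_def[abs_def] by measurable

lemma poisson_kernel_nonneg: "0 \<le> y \<Longrightarrow> 0 \<le> poisson_kernel y x"
  by (simp add: poisson_kernel_def)

lemma poisson_kernel_diff: "poisson_kernel (Im z) (x - Re z) = Im z * (1 / (cmod (z - complex_of_real x))\<^sup>2)"
  by (simp add: poisson_kernel_def cmod_power2 power2_commute)

lemma has_bochner_integral_poisson_kernel:
  assumes "0 < y"
  shows "has_bochner_integral lborel (poisson_kernel y) pi"
proof -
  have "has_bochner_integral lborel (\<lambda>x::real. inverse (1 + x\<^sup>2)) pi"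
    using integrable_inverse_1_plus_square LBINT_inverse_1_plus_square
    by (simp add: has_bochner_integral_iff interval_lebesgue_integral_def einterval_def
        set_lebesgue_integral_def set_integrable_def)
  then have "has_bochner_integral lborel (\<lambda>x. inverse (1 + (0 + 1 / y * x)\<^sup>2)) (pi /\<^sub>R \<bar>1 / y\<bar>)"
    using assms by (subst (asm) lborel_has_bochner_integral_real_affine_iff[of "1 / y" _ _ 0]) auto
  then have "has_bochner_integral lborel (\<lambda>x. 1 / y * inverse (1 + (0 + 1 / y * x)\<^sup>2)) (1 / y * (pi /\<^sub>R \<bar>1 / y\<bar>))"
    by (rule has_bochner_integral_mult_right)
  moreover have "1 / y * inverse (1 + (0 + 1 / y * x)\<^sup>2) = poisson_kernel y x" for x
    using assms by (simp add: poisson_kernel_def field_simps power2_eq_square)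
  ultimately show ?thesis using assms by simp
qed

text \<open>With a = i y the kernel is y / ((x - a) (x + a)) on the real line. Its product with g -
  g a is y times the derivative of a primitive P, and the increment of P from -R to R is estimated
  along the upper half-circle, where it is of order 1 / R. Hence g and the constant g a have the
  same Poisson integral.\<close>

lemma poisson_formula_imaginary_axis:
  assumes holo: "g holomorphic_on {z. - \<delta> < Im z}" and \<delta>: "0 < \<delta>" and y: "0 < y"
    and bound: "\<And>z. - \<delta> < Im z \<Longrightarrow> cmod (g z) \<le> C"
  shows "has_bochner_integral lborel (\<lambda>x. complex_of_real (poisson_kernel y x) * g (complex_of_real x))
    (complex_of_real pi * g (\<i> * complex_of_real y))"
proof -
  \<comment> \<open>Stays strictly above -i y, so that z + a has no zero, but still contains the
    closed upper half-plane.\<close>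
  define S where "S = {z. - min \<delta> y < Im z}"
  have S: "open S" "convex S" unfolding S_def
    by (rule open_halfspace_Im_gt, rule convex_halfspace_Im_gt)
  define a where "a = \<i> * complex_of_real y"
  have aS: "a \<in> S" using \<delta> y by (simp add: S_def a_def)
  have C: "0 \<le> C" using order_trans[OF norm_ge_zero bound[of 0]] \<delta> by simp
  have holS: "g holomorphic_on S"
    using holo by (rule holomorphic_on_subset) (auto simp: S_def)
  \<comment> \<open>Subtracting \<open>g a\<close> removes the singularity, so that a primitive exists and no winding number is needed.\<close>
  define Q where "Q = (\<lambda>z. (if z = a then deriv g a else (g z - g a) / (z - a)) / (z + a))"
  have "Q holomorphic_on S"
    unfolding Q_def
    by (intro holomorphic_on_divide pole_lemma_open holS S holomorphic_intros)
      (use y in \<open>auto simp: S_def a_def complex_eq_iff\<close>)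
  then obtain P where P: "\<And>z. z \<in> S \<Longrightarrow> (P has_field_derivative Q z) (at z within S)"
    using holomorphic_convex_primitive'[OF S(2,1)] by blast
  have Q_real: "Q (complex_of_real x) = (g x - g a) / complex_of_real (x\<^sup>2 + y\<^sup>2)" for x
  proof -
    have "complex_of_real x \<noteq> a" using y by (auto simp: a_def complex_eq_iff)
    moreover have "(complex_of_real x - a) * (complex_of_real x + a) = complex_of_real (x\<^sup>2 + y\<^sup>2)"
      by (simp add: a_def algebra_simps power2_eq_square)
    ultimately show ?thesis by (simp add: Q_def)
  qed
  have int_pk: "has_bochner_integral lborel (\<lambda>x. complex_of_real (poisson_kernel y x)) (complex_of_real pi)"
    by (intro has_bochner_integral_of_real has_bochner_integral_poisson_kernel y)
  have meas_g: "(\<lambda>x. g (complex_of_real x)) \<in> borel_measurable borel"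
    by (intro borel_measurable_continuous_onI continuous_on_compose2[OF holomorphic_on_imp_continuous_on[OF holo]]
        continuous_intros) (use \<delta> in auto)
  have int_g: "integrable lborel (\<lambda>x. complex_of_real (poisson_kernel y x) * g (complex_of_real x))"
  proof (rule Bochner_Integration.integrable_bound)
    show "integrable lborel (\<lambda>x. poisson_kernel y x * C)"
      using has_bochner_integral_poisson_kernel[OF y] by (auto simp: has_bochner_integral_iff)
    show "(\<lambda>x. complex_of_real (poisson_kernel y x) * g (complex_of_real x)) \<in> borel_measurable lborel"
      using meas_g by measurable
    show "AE x in lborel. norm (complex_of_real (poisson_kernel y x) * g (complex_of_real x))
        \<le> norm (poisson_kernel y x * C)"
      using bound \<delta> C y by (intro AE_I2) (auto simp: norm_mult abs_mult intro!: mult_left_mono)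
  qed
  define q where "q = (\<lambda>x. complex_of_real (poisson_kernel y x) * g (complex_of_real x)
    - complex_of_real (poisson_kernel y x) * g a)"
  have int_q: "integrable lborel q"
    unfolding q_def using int_pk by (intro Bochner_Integration.integrable_diff int_g integrable_mult_left)
      (auto simp: has_bochner_integral_iff)
  have q_Q: "q x = complex_of_real y * Q (complex_of_real x)" for x
    by (simp add: q_def Q_real poisson_kernel_def algebra_simps diff_divide_distrib)
  have FTC: "(\<integral>x. indicator {-R..R} x *\<^sub>R q x \<partial>lborel) =
      complex_of_real y * P (complex_of_real R) - complex_of_real y * P (complex_of_real (-R))" if R: "0 \<le> R" for R
  proof (rule integral_FTC_Icc)
    show "((\<lambda>x. complex_of_real y * P (complex_of_real x)) has_vector_derivative q x) (at x within {-R..R})" for x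
    proof -
      have "complex_of_real x \<in> S" using \<delta> y by (simp add: S_def)
      then have "(P has_field_derivative Q x) (at (complex_of_real x))"
        using P[OF \<open>complex_of_real x \<in> S\<close>] at_within_open[OF \<open>complex_of_real x \<in> S\<close> S(1)] by simp
      then have "((\<lambda>x. complex_of_real y * P (complex_of_real x)) has_vector_derivative q x) (at x)"
        unfolding q_Q by (intro has_vector_derivative_mult_right has_vector_derivative_real_field)
      then show ?thesis by (rule has_vector_derivative_at_within)
    qed
    show "continuous_on {-R..R} q"
      unfolding q_def poisson_kernel_def
      by (intro continuous_intros continuous_on_compose2[OF holomorphic_on_imp_continuous_on[OF holo]])
        (use \<delta> y in \<open>auto simp: add_nonneg_eq_0_iff\<close>)
  qed (use R in auto)
  have arc: "cmod (P (complex_of_real R) - P (complex_of_real (-R))) \<le> 2 * C / (R\<^sup>2 - y\<^sup>2) * R * pi"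
    if R: "y < R" for R
  proof -
    let ?c = "part_circlepath 0 R 0 pi"
    have im: "Im z \<ge> 0" "cmod z = R" if "z \<in> path_image ?c" for z
    proof -
      have "0 \<le> R" using R y by simp
      with that obtain x where x: "0 \<le> x" "x \<le> pi" "z = complex_of_real R * cis x"
        unfolding path_image_part_circlepath'[of 0 R 0 pi] by (auto simp: closed_segment_eq_real_ivl)
      then show "Im z \<ge> 0" "cmod z = R"
        using R y sin_ge_zero[of x] by (auto simp: norm_mult)
    qed
    have "(Q has_contour_integral (P (pathfinish ?c) - P (pathstart ?c))) ?c"
      by (rule contour_integral_primitive[OF P]) (use im \<delta> y in \<open>force simp: S_def\<close>)+
    then have "cmod (P (pathfinish ?c) - P (pathstart ?c)) \<le> 2 * C / (R\<^sup>2 - y\<^sup>2) * R * (pi - 0)"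
    proof (rule has_contour_integral_bound_part_circlepath_strong[where k = "{}"])
      have "y\<^sup>2 < R\<^sup>2" using R y by (intro power_strict_mono) auto
      then show "0 \<le> 2 * C / (R\<^sup>2 - y\<^sup>2)" using C by simp
      fix z assume "z \<in> path_image ?c - {}"
      then have z: "Im z \<ge> 0" "cmod z = R" using im by auto
      have za: "z \<noteq> a" using z R y by (auto simp: a_def norm_mult)
      have "cmod (g z - g a) \<le> 2 * C"
        using bound[of z] bound[of a] z \<delta> y norm_triangle_ineq4[of "g z" "g a"] by (simp add: a_def)
      moreover have "R\<^sup>2 - y\<^sup>2 \<le> cmod ((z - a) * (z + a))"
      proof -
        have "(z - a) * (z + a) = z\<^sup>2 - (- (complex_of_real y)\<^sup>2)"
          by (simp add: a_def algebra_simps power2_eq_square)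
        moreover have "cmod (z\<^sup>2) - cmod (- (complex_of_real y)\<^sup>2) \<le> cmod (z\<^sup>2 - (- (complex_of_real y)\<^sup>2))"
          by (rule norm_triangle_ineq2)
        ultimately show ?thesis using z y by (simp add: norm_power)
      qed
      ultimately have "cmod (g z - g a) / cmod ((z - a) * (z + a)) \<le> 2 * C / (R\<^sup>2 - y\<^sup>2)"
        using \<open>y\<^sup>2 < R\<^sup>2\<close> C by (intro frac_le) auto
      then show "cmod (Q z) \<le> 2 * C / (R\<^sup>2 - y\<^sup>2)"
        using za by (simp add: Q_def norm_divide norm_mult)
    qed (use R y in auto)
    then show ?thesis
      by (simp add: norm_minus_commute exp_pi_i')
  qed
  have "(\<lambda>n. \<integral>x. indicator {- real n..real n} x *\<^sub>R q x \<partial>lborel) \<longlonglongrightarrow> integral\<^sup>L lborel q"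
  proof (rule integral_dominated_convergence[where w = "\<lambda>x. norm (q x)"])
    show "AE x in lborel. (\<lambda>n. indicator {- real n..real n} x *\<^sub>R q x) \<longlonglongrightarrow> q x"
    proof (rule AE_I2)
      fix x
      obtain N where N: "\<bar>x\<bar> \<le> real N" using real_arch_simple by blast
      have "\<forall>\<^sub>F n in sequentially. q x = indicator {- real n..real n} x *\<^sub>R q x"
        using eventually_ge_at_top[of N] by eventually_elim (use N in \<open>auto simp: indicator_def\<close>)
      then show "(\<lambda>n. indicator {- real n..real n} x *\<^sub>R q x) \<longlonglongrightarrow> q x"
        by (rule Lim_transform_eventually[OF tendsto_const])
    qed
  qed (use int_q in \<open>auto simp: indicator_def\<close>)
  moreover have "(\<lambda>n. \<integral>x. indicator {- real n..real n} x *\<^sub>R q x \<partial>lborel) \<longlonglongrightarrow> 0"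
  proof (rule Lim_null_comparison)
    have "\<forall>\<^sub>F n in sequentially. y < real n" by real_asymp
    then show "\<forall>\<^sub>F n in sequentially. norm (\<integral>x. indicator {- real n..real n} x *\<^sub>R q x \<partial>lborel)
        \<le> y * (2 * C / ((real n)\<^sup>2 - y\<^sup>2) * real n * pi)"
    proof eventually_elim
      case (elim n)
      have "norm (\<integral>x. indicator {- real n..real n} x *\<^sub>R q x \<partial>lborel)
        = y * cmod (P (complex_of_real (real n)) - P (complex_of_real (- real n)))"
        unfolding FTC[OF of_nat_0_le_iff] right_diff_distrib[symmetric] norm_mult using y by simp
      then show ?case using mult_left_mono[OF arc[OF elim], of y] y by simp
    qed
    show "(\<lambda>n. y * (2 * C / ((real n)\<^sup>2 - y\<^sup>2) * real n * pi)) \<longlonglongrightarrow> 0"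
      by real_asymp
  qed
  ultimately have "integral\<^sup>L lborel q = 0" by (rule LIMSEQ_unique)
  then have "(\<integral>x. complex_of_real (poisson_kernel y x) * g (complex_of_real x) \<partial>lborel)
      = complex_of_real pi * g a"
    unfolding q_def using int_g int_pk
    by (simp add: has_bochner_integral_iff)
  then show ?thesis using int_g by (simp add: has_bochner_integral_iff a_def)
qed

lemma poisson_formula:
  assumes holo: "g holomorphic_on {z. - \<delta> < Im z}" and \<delta>: "0 < \<delta>" and z: "0 < Im z"
    and bound: "\<And>z. - \<delta> < Im z \<Longrightarrow> cmod (g z) \<le> C"
  shows "has_bochner_integral lborel (\<lambda>x. complex_of_real (poisson_kernel (Im z) (x - Re z)) * g (complex_of_real x))
    (complex_of_real pi * g z)"
proof -
  define t where "t = Re z"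
  have "(g \<circ> (\<lambda>w. w + complex_of_real t)) holomorphic_on {z. - \<delta> < Im z}"
    by (rule holomorphic_on_compose_gen[OF _ holo]) (auto intro!: holomorphic_intros)
  then have "has_bochner_integral lborel (\<lambda>x. complex_of_real (poisson_kernel (Im z) x) * g (complex_of_real x + t))
    (complex_of_real pi * g (\<i> * complex_of_real (Im z) + t))"
    using poisson_formula_imaginary_axis[of "g \<circ> (\<lambda>w. w + complex_of_real t)" \<delta> "Im z" C] \<delta> z bound
    by (simp add: o_def)
  then have "has_bochner_integral lborel (\<lambda>x. complex_of_real (poisson_kernel (Im z) (- t + 1 * x)) * g (complex_of_real (- t + 1 * x) + t))
    ((complex_of_real pi * g (\<i> * complex_of_real (Im z) + t)) /\<^sub>R \<bar>1\<bar>)"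
    by (subst (asm) lborel_has_bochner_integral_real_affine_iff[of 1 _ _ "- t"]) auto
  moreover have "\<i> * complex_of_real (Im z) + t = z" by (simp add: t_def complex_eq_iff)
  ultimately show ?thesis by (simp add: t_def)
qed

section \<open>Recognising Cauchy transforms of probability measures\<close>

lemma holomorphic_Im_zero_imp_constant:
  assumes "f holomorphic_on S" "open S" "connected S" "\<And>z. z \<in> S \<Longrightarrow> Im (f z) = 0"
  shows "f constant_on S"
proof (rule ccontr)
  assume nc: "\<not> f constant_on S"
  then obtain z where z: "z \<in> S" by (auto simp: constant_on_def)
  have "open (f ` S)" using open_mapping_thm[OF assms(1-3) assms(2) order_refl nc] .
  then obtain e where e: "0 < e" "ball (f z) e \<subseteq> f ` S" using z by (meson imageI open_contains_ball)
  have "f z + \<i> * complex_of_real (e / 2) \<in> ball (f z) e" using e by (simp add: dist_norm norm_mult)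
  then obtain w where w: "w \<in> S" "f w = f z + \<i> * complex_of_real (e / 2)" using e by (metis imageE subsetD)
  then have "Im (f w) = Im (f z) + e / 2" by simp
  then show False using assms(4)[OF w(1)] assms(4)[OF z] e by simp
qed

lemma norm_cauchy_transform_le:
  assumes "real_distribution \<mu>" "0 < Im z"
  shows "cmod (cauchy_transform \<mu> z) \<le> 1 / Im z"
proof -
  interpret real_distribution \<mu> by fact
  have "Im z \<le> cmod (F_transform \<mu> z)"
    using Im_F_transform_ge[OF assms(2)] abs_Im_le_cmod[of "F_transform \<mu> z"] by linarith
  then show ?thesis
    using assms(2) by (simp add: cauchy_transform_eq_inverse_F norm_divide frac_le)
qed

text \<open>The difference of the two functions is constant, by the open mapping theorem, and the
  decay along the imaginary axis makes the constant 0.\<close>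

lemma cauchy_transform_eqI_Im:
  assumes \<rho>: "real_distribution \<rho>" and holo: "G holomorphic_on upper_half_plane"
    and bound: "\<And>z. 0 < Im z \<Longrightarrow> cmod (G z) \<le> 1 / Im z"
    and Im: "\<And>z. 0 < Im z \<Longrightarrow> Im (G z) = Im (cauchy_transform \<rho> z)" and z: "0 < Im z"
  shows "G z = cauchy_transform \<rho> z"
proof -
  interpret real_distribution \<rho> by fact
  define D where "D = (\<lambda>z. G z - cauchy_transform \<rho> z)"
  have "D holomorphic_on upper_half_plane"
    unfolding D_def by (intro holomorphic_intros holo holomorphic_cauchy_transform finite_borel_measure_M)
  then have "D constant_on upper_half_plane"
    by (rule holomorphic_Im_zero_imp_constant) (auto simp: D_def Im)
  then obtain c where c: "\<And>z. 0 < Im z \<Longrightarrow> D z = c" by (auto simp: constant_on_def)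
  have "cmod c \<le> 2 / y" if "0 < y" for y
  proof -
    have "cmod c \<le> cmod (G (\<i> * complex_of_real y)) + cmod (cauchy_transform \<rho> (\<i> * complex_of_real y))"
      using c[of "\<i> * complex_of_real y"] that
        norm_triangle_ineq4[of "G (\<i> * complex_of_real y)" "cauchy_transform \<rho> (\<i> * complex_of_real y)"]
      by (simp add: D_def)
    then show ?thesis
      using bound[of "\<i> * complex_of_real y"] norm_cauchy_transform_le[OF \<rho>, of "\<i> * complex_of_real y"] that by simp
  qed
  then have "\<And>n. cmod c \<le> 2 / real (Suc n)" by simp
  moreover have "(\<lambda>n. 2 / real (Suc n)) \<longlonglongrightarrow> 0" by real_asymp
  ultimately have "cmod c \<le> 0" by (meson LIMSEQ_le_const)
  then show ?thesis using c[OF z] by (simp add: D_def)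
qed

lemma weak_conv_poisson_mass:
  assumes "\<And>n. real_distribution (\<mu> n)" "real_distribution \<nu>" "weak_conv_m \<mu> \<nu>" "0 < Im z"
  shows "(\<lambda>n. poisson_mass (\<mu> n) z) \<longlonglongrightarrow> poisson_mass \<nu> z"
  unfolding kernel_norm_def
proof (rule weak_conv_imp_integral_bdd_continuous_conv[OF assms(1-3)])
  show "isCont (\<lambda>s. 1 / (cmod (z - complex_of_real s))\<^sup>2) x" for x
    using diff_real_nonzero[OF assms(4), of x] by (intro continuous_intros) auto
  show "norm (1 / (cmod (z - complex_of_real x))\<^sup>2) \<le> 2 + (1 + 2 * (Re z)\<^sup>2) / (Im z)\<^sup>2" for x
    using weight_le[OF assms(4), of 1 x] by simp
qed

lemma weak_conv_cauchy_transform: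
  assumes "\<And>n. real_distribution (\<mu> n)" "real_distribution \<nu>" "weak_conv_m \<mu> \<nu>" "0 < Im z"
  shows "(\<lambda>n. cauchy_transform (\<mu> n) z) \<longlonglongrightarrow> cauchy_transform \<nu> z"
  unfolding cauchy_transform_def
proof (rule weak_conv_imp_integral_bdd_continuous_conv[OF assms(1-3)])
  show "isCont (\<lambda>s. 1 / (z - complex_of_real s)) x" for x
    using diff_real_nonzero[OF assms(4), of x] by (intro continuous_intros) auto
  show "norm (1 / (z - complex_of_real x)) \<le> 1 / Im z" for x
    using norm_diff_real_ge_Im[of z x] assms(4) by (simp add: norm_divide frac_le)
qed

text \<open>An analytic characterisation of Cauchy transforms of probability measures. The condition
  \<open>lim\<close> fixes the total mass at 1; it also prevents mass from escaping in the
  approximation below.\<close>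

locale pick_reciprocal =
  fixes G :: "complex \<Rightarrow> complex"
  assumes holo: "G holomorphic_on upper_half_plane"
    and bound: "0 < Im z \<Longrightarrow> cmod (G z) \<le> 1 / Im z"
    and Im_nonpos: "0 < Im z \<Longrightarrow> Im (G z) \<le> 0"
    and lim: "((\<lambda>y. y * Im (G (\<i> * complex_of_real y))) \<longlongrightarrow> - 1) at_top"
begin

text \<open>In hindsight this is the convolution of the representing measure with the Cauchy
  distribution of scale \<open>e\<close>, so it should converge to that measure as \<open>e\<close>
  tends to 0.\<close>

definition smoothed :: "real \<Rightarrow> real measure" where
  "smoothed e = density lborel (\<lambda>x. ennreal (- Im (G (complex_of_real x + \<i> * complex_of_real e)) / pi))"

lemma shifted_holomorphic: "(\<lambda>z. G (z + \<i> * complex_of_real e)) holomorphic_on {z. - e < Im z}"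
proof -
  have "(G \<circ> (\<lambda>z. z + \<i> * complex_of_real e)) holomorphic_on {z. - e < Im z}"
    by (rule holomorphic_on_compose_gen[OF _ holo]) (auto intro!: holomorphic_intros)
  then show ?thesis by (simp add: o_def)
qed

lemma shifted_measurable [measurable]:
  assumes "0 < e"
  shows "(\<lambda>x. Im (G (complex_of_real x + \<i> * complex_of_real e))) \<in> borel_measurable borel"
proof (intro borel_measurable_continuous_onI continuous_intros)
  show "continuous_on UNIV (\<lambda>x. G (complex_of_real x + \<i> * complex_of_real e))"
    by (rule continuous_on_compose2[OF holomorphic_on_imp_continuous_on[OF shifted_holomorphic]])
      (use assms in \<open>auto intro: continuous_intros\<close>)
qed

text \<open>After a shift by i e the function is bounded by 2 / e on a half-plane that extends below
  the real axis, as the Poisson formula demands.\<close>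

lemma shifted_poisson:
  assumes e: "0 < e" and z: "0 < Im z"
  shows "has_bochner_integral lborel
    (\<lambda>x. poisson_kernel (Im z) (x - Re z) * (- Im (G (complex_of_real x + \<i> * complex_of_real e)) / pi))
    (- Im (G (z + \<i> * complex_of_real e)))"
proof -
  have "has_bochner_integral lborel
    (\<lambda>x. complex_of_real (poisson_kernel (Im z) (x - Re z)) * G (complex_of_real x + \<i> * complex_of_real e))
    (complex_of_real pi * G (z + \<i> * complex_of_real e))"
  proof (rule poisson_formula[where \<delta> = "e / 2" and C = "2 / e" and g = "\<lambda>z. G (z + \<i> * complex_of_real e)"])
    show "(\<lambda>z. G (z + \<i> * complex_of_real e)) holomorphic_on {z. - (e / 2) < Im z}"
      using shifted_holomorphic by (rule holomorphic_on_subset) (use e in auto)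
    fix w assume w: "- (e / 2) < Im w"
    then have "cmod (G (w + \<i> * complex_of_real e)) \<le> 1 / (Im w + e)"
      using bound[of "w + \<i> * complex_of_real e"] e by simp
    also have "\<dots> \<le> 1 / (e / 2)" using w e by (intro divide_left_mono) auto
    finally show "cmod (G (w + \<i> * complex_of_real e)) \<le> 2 / e" by simp
  qed (use e z in auto)
  then have "has_bochner_integral lborel
    (\<lambda>x. Im (complex_of_real (poisson_kernel (Im z) (x - Re z)) * G (complex_of_real x + \<i> * complex_of_real e)))
    (Im (complex_of_real pi * G (z + \<i> * complex_of_real e)))"
    by (rule has_bochner_integral_Im)
  from has_bochner_integral_mult_right[OF this, of "- 1 / pi"] show ?thesis
    by simp
qed

lemma smoothed_density_nonneg:
  "0 < e \<Longrightarrow> 0 \<le> - Im (G (complex_of_real x + \<i> * complex_of_real e)) / pi"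
  using Im_nonpos[of "complex_of_real x + \<i> * complex_of_real e"] by (intro divide_nonneg_pos) auto

text \<open>The Poisson kernel of height n times n is 1 / (1 + (x / n)^2), which increases to 1,
  while its integral against the density is - n Im G (i (n + e)), which tends to 1 by
  \<open>lim\<close>. Monotone convergence yields integrability and total mass together.\<close>

lemma smoothed_mass:
  assumes e: "0 < e"
  shows "has_bochner_integral lborel (\<lambda>x. - Im (G (complex_of_real x + \<i> * complex_of_real e)) / pi) 1"
proof -
  let ?p = "\<lambda>x. - Im (G (complex_of_real x + \<i> * complex_of_real e)) / pi"
  let ?f = "\<lambda>(n::nat) x. real (Suc n) * (poisson_kernel (real (Suc n)) x * ?p x)"
  note p = smoothed_density_nonneg[OF e]
  have hb: "has_bochner_integral lborel (?f n) (real (Suc n) * - Im (G (\<i> * complex_of_real (real (Suc n) + e))))" for n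
    using has_bochner_integral_mult_right[OF shifted_poisson[OF e, of "\<i> * complex_of_real (real (Suc n))"], of "real (Suc n)"]
    by (simp add: algebra_simps)
  have scaled: "real (Suc n) * poisson_kernel (real (Suc n)) x = 1 / (1 + (x / real (Suc n))\<^sup>2)" for n x
    by (simp add: poisson_kernel_def divide_simps add_nonneg_eq_0_iff) (simp add: power2_eq_square algebra_simps)
  have f_eq: "?f n x = 1 / (1 + (x / real (Suc n))\<^sup>2) * ?p x" for n x
    by (simp only: scaled mult.assoc[symmetric])
  have "integrable lborel (?f i)" for i using hb[of i] by (simp add: has_bochner_integral_iff)
  moreover have "AE x in lborel. mono (\<lambda>n. ?f n x)"
    proof (intro AE_I2 monoI)
      fix x and m n :: nat assume "m \<le> n"
      then have "\<bar>x\<bar> / real (Suc n) \<le> \<bar>x\<bar> / real (Suc m)" by (intro divide_left_mono) auto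
      then have "(\<bar>x\<bar> / real (Suc n))\<^sup>2 \<le> (\<bar>x\<bar> / real (Suc m))\<^sup>2" by (intro power_mono) auto
      then have "1 / (1 + (x / real (Suc m))\<^sup>2) \<le> 1 / (1 + (x / real (Suc n))\<^sup>2)"
        by (intro divide_left_mono mult_pos_pos) (auto simp: power_divide intro: add_pos_nonneg)
      then show "?f m x \<le> ?f n x"
        unfolding f_eq by (rule mult_right_mono[OF _ p])
    qed
  moreover have "AE x in lborel. 0 \<le> ?f i x" for i
      by (intro AE_I2 mult_nonneg_nonneg poisson_kernel_nonneg p) auto
  moreover have "AE x in lborel. (\<lambda>i. ?f i x) \<longlonglongrightarrow> ?p x"
    proof (rule AE_I2)
      fix x
      have "(\<lambda>i. x / real (Suc i)) \<longlonglongrightarrow> 0" by real_asymp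
      then have "(\<lambda>i. 1 / (1 + (x / real (Suc i))\<^sup>2)) \<longlonglongrightarrow> 1 / (1 + 0\<^sup>2)"
        by (intro tendsto_intros) auto
      then have "(\<lambda>i. 1 / (1 + (x / real (Suc i))\<^sup>2)) \<longlonglongrightarrow> 1" by simp
      from tendsto_mult_right[OF this, of "?p x"] show "(\<lambda>i. ?f i x) \<longlonglongrightarrow> ?p x" unfolding f_eq by simp
    qed
  moreover have "(\<lambda>i. integral\<^sup>L lborel (?f i)) \<longlonglongrightarrow> 1"
    proof -
      have "filterlim (\<lambda>n. real (Suc n) + e) at_top sequentially" by real_asymp
      from filterlim_compose[OF lim this]
      have "(\<lambda>n. real (Suc n) / (real (Suc n) + e) *
          ((real (Suc n) + e) * Im (G (\<i> * complex_of_real (real (Suc n) + e))))) \<longlonglongrightarrow> 1 * - 1"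
        by (intro tendsto_mult) real_asymp
      moreover have "real (Suc n) / (real (Suc n) + e) * ((real (Suc n) + e) * c) = real (Suc n) * c" for n c
        using e by (simp add: field_simps)
      ultimately have "(\<lambda>n. real (Suc n) * Im (G (\<i> * complex_of_real (real (Suc n) + e)))) \<longlonglongrightarrow> 1 * - 1"
        by (simp only:)
      from tendsto_minus[OF this]
      have "(\<lambda>n. real (Suc n) * - Im (G (\<i> * complex_of_real (real (Suc n) + e)))) \<longlonglongrightarrow> 1" by simp
      then show ?thesis by (simp only: has_bochner_integral_integral_eq[OF hb])
    qed
  moreover have "?p \<in> borel_measurable lborel" using e by measurable
  ultimately have "integrable lborel ?p" "integral\<^sup>L lborel ?p = 1"
    by (rule integral_monotone_convergence_nonneg)+
  then show ?thesis by (simp add: has_bochner_integral_iff)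
qed

lemma smoothed_distribution:
  assumes e: "0 < e"
  shows "real_distribution (smoothed e)"
  unfolding real_distribution_def real_distribution_axioms_def
proof (intro conjI prob_spaceI)
  note p = smoothed_density_nonneg[OF e]
  have "emeasure (smoothed e) UNIV = (\<integral>\<^sup>+x. ennreal (- Im (G (complex_of_real x + \<i> * complex_of_real e)) / pi) \<partial>lborel)"
    unfolding smoothed_def using e by (subst emeasure_density) auto
  also have "\<dots> = 1"
    using smoothed_mass[OF e] p by (subst nn_integral_eq_integral) (auto simp: has_bochner_integral_iff)
  finally show "emeasure (smoothed e) (space (smoothed e)) = 1" by (simp add: smoothed_def)
qed (simp add: smoothed_def)

lemma poisson_mass_smoothed:
  assumes e: "0 < e" and z: "0 < Im z"
  shows "Im z * poisson_mass (smoothed e) z = - Im (G (z + \<i> * complex_of_real e))"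
proof -
  note p = smoothed_density_nonneg[OF e]
  have "Im z * poisson_mass (smoothed e) z =
    (\<integral>x. poisson_kernel (Im z) (x - Re z) \<partial>smoothed e)"
    unfolding poisson_kernel_diff kernel_norm_def by (rule integral_mult_right_zero[symmetric])
  also have "\<dots> = (\<integral>x. (- Im (G (complex_of_real x + \<i> * complex_of_real e)) / pi) * poisson_kernel (Im z) (x - Re z) \<partial>lborel)"
    unfolding smoothed_def using e p by (subst integral_density) auto
  also have "\<dots> = - Im (G (z + \<i> * complex_of_real e))"
    using shifted_poisson[OF e z] by (simp add: has_bochner_integral_iff mult.commute)
  finally show ?thesis .
qed

text \<open>Outside the interval 1 \<le> 2 s^2 / (s^2 + N^2), and the right-hand side is 2 minus a
  multiple of a Poisson kernel, so its integral is known from G. The parameter \<open>e\<close>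
  enters only through the height N + e, which makes the bound suitable for tightness.\<close>

lemma smoothed_tail:
  assumes e: "0 < e" and N: "0 < N"
  shows "1 - 2 * (1 + N * Im (G (\<i> * complex_of_real (N + e)))) \<le> measure (smoothed e) {-N<..N}"
proof -
  interpret real_distribution "smoothed e" by (rule smoothed_distribution[OF e])
  let ?z = "\<i> * complex_of_real N"
  have int: "integrable (smoothed e) (\<lambda>s. 1 / (cmod (?z - complex_of_real s))\<^sup>2)"
    using weighted_measure.integrable_kernel_norm[OF kernel_weight, of ?z] N by simp
  have "1 - measure (smoothed e) {-N<..N} = measure (smoothed e) (UNIV - {-N<..N})"
    using prob_compl[of "{-N<..N}"] by simp
  also have "\<dots> = (\<integral>s. indicator (UNIV - {-N<..N}) s \<partial>smoothed e)" by simp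
  also have "\<dots> \<le> (\<integral>s. 2 - 2 * N\<^sup>2 * (1 / (cmod (?z - complex_of_real s))\<^sup>2) \<partial>smoothed e)"
  proof (intro integral_mono Bochner_Integration.integrable_diff integrable_const integrable_mult_right int)
    show "integrable (smoothed e) (indicator (UNIV - {-N<..N}) :: real \<Rightarrow> real)"
      by (rule integrable_const_bound[where B=1]) (auto simp: indicator_def)
    fix s
    have c: "(cmod (?z - complex_of_real s))\<^sup>2 = s\<^sup>2 + N\<^sup>2" "0 < s\<^sup>2 + N\<^sup>2"
      using N by (auto simp: cmod_power2 intro: add_nonneg_pos)
    have "2 - 2 * p * (1 / (q + p)) = 2 * q / (q + p)" if "0 < q + p" for p q :: real
      using that by (simp add: field_simps)
    from this[OF c(2)] have "2 - 2 * N\<^sup>2 * (1 / (s\<^sup>2 + N\<^sup>2)) = 2 * s\<^sup>2 / (s\<^sup>2 + N\<^sup>2)" .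
    moreover have "1 \<le> 2 * s\<^sup>2 / (s\<^sup>2 + N\<^sup>2)" if "s \<notin> {-N<..N}"
    proof -
      have "N\<^sup>2 \<le> \<bar>s\<bar>\<^sup>2" using that N by (intro power_mono) auto
      then show ?thesis using c by (simp add: field_simps)
    qed
    moreover have "0 \<le> 2 * s\<^sup>2 / (s\<^sup>2 + N\<^sup>2)" by simp
    ultimately show "indicator (UNIV - {-N<..N}) s \<le> 2 - 2 * N\<^sup>2 * (1 / (cmod (?z - complex_of_real s))\<^sup>2)"
      unfolding c by (simp add: indicator_def)
  qed
  also have "\<dots> = 2 - 2 * N\<^sup>2 * poisson_mass (smoothed e) ?z"
    unfolding kernel_norm_def
    by (simp only: Bochner_Integration.integral_diff integrable_const integrable_mult_right[OF int]
        integral_mult_right_zero lebesgue_integral_const prob_space scaleR_one)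
  also have "\<dots> = 2 * (1 + N * Im (G (\<i> * complex_of_real (N + e))))"
  proof -
    have "N * (N * poisson_mass (smoothed e) ?z) = N * - Im (G (\<i> * complex_of_real (N + e)))"
      using poisson_mass_smoothed[OF e, of ?z] N by (simp add: distrib_left)
    then show ?thesis by (simp add: power2_eq_square mult.assoc)
  qed
  finally show ?thesis by linarith
qed

text \<open>Tightness yields a weak limit along a subsequence of the smoothed measures. Poisson
  integrals pass to the limit and identify the imaginary part of the Cauchy transform;
  \<open>cauchy_transform_eqI_Im\<close> supplies the rest.\<close>

theorem cauchy_transform_representation:
  obtains \<rho> where "real_distribution \<rho>" "\<And>z. 0 < Im z \<Longrightarrow> G z = cauchy_transform \<rho> z"
proof -
  define e where "e = (\<lambda>n. 1 / real (Suc n))"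
  have e: "0 < e n" "e n \<le> 1" for n by (auto simp: e_def)
  have e0: "e \<longlonglongrightarrow> 0" unfolding e_def by real_asymp
  have "tight (smoothed \<circ> e)"
    unfolding tight_def
  proof (intro conjI allI impI)
    show "real_distribution ((smoothed \<circ> e) n)" for n using smoothed_distribution[OF e(1)] by simp
    fix \<epsilon> :: real assume \<epsilon>: "0 < \<epsilon>"
    define \<eta> where "\<eta> = min 1 (\<epsilon> / 8)"
    have \<eta>: "0 < \<eta>" "\<eta> \<le> 1" "8 * \<eta> \<le> \<epsilon>" using \<epsilon> by (auto simp: \<eta>_def)
    have "\<forall>\<^sub>F y in at_top. y * Im (G (\<i> * complex_of_real y)) < - 1 + \<eta>"
      by (rule order_tendstoD(2)[OF lim]) (use \<eta> in simp)
    then obtain Y where Y: "\<And>y. Y \<le> y \<Longrightarrow> y * Im (G (\<i> * complex_of_real y)) < - 1 + \<eta>"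
      by (auto simp: eventually_at_top_linorder)
    \<comment> \<open>The entry \<open>1 / \<eta>\<close> absorbs the shift: replacing the factor N
      + e by N costs at most \<eta>, since e \<le> 1 and |Im G| \<le> 1 / N at this height.\<close>
    define N where "N = max 1 (max Y (1 / \<eta>))"
    have N: "1 \<le> N" "Y \<le> N" "1 / \<eta> \<le> N" by (auto simp: N_def)
    show "\<exists>a b. a < b \<and> (\<forall>n. 1 - \<epsilon> < measure ((smoothed \<circ> e) n) {a<..b})"
    proof (intro exI conjI allI)
      show "-N < N" using N by simp
      fix n
      let ?I = "Im (G (\<i> * complex_of_real (N + e n)))"
      have 1: "(N + e n) * ?I < - 1 + \<eta>" using Y[of "N + e n"] N e(1)[of n] by simp
      have "?I \<le> 0" using Im_nonpos[of "\<i> * complex_of_real (N + e n)"] N e(1)[of n] by simp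
      have "1 / (N + e n) \<le> \<eta>"
      proof -
        have "1 \<le> N * \<eta>" using N \<eta> by (simp add: field_simps)
        then show ?thesis using N e(1)[of n] \<eta> by (simp add: field_simps add_increasing2)
      qed
      moreover have "- ?I \<le> 1 / (N + e n)"
        using bound[of "\<i> * complex_of_real (N + e n)"] N e(1)[of n] abs_Im_le_cmod[of "G (\<i> * complex_of_real (N + e n))"] by simp
      ultimately have "- ?I \<le> \<eta>" by linarith
      moreover have "e n * - ?I \<le> 1 * - ?I" using e(2)[of n] \<open>?I \<le> 0\<close> by (intro mult_right_mono) auto
      ultimately have "N * ?I < - 1 + 2 * \<eta>" using 1 by (simp add: algebra_simps)
      then have "1 - \<epsilon> < 1 - 2 * (1 + N * ?I)" using \<eta> by simp
      then show "1 - \<epsilon> < measure ((smoothed \<circ> e) n) {-N<..N}"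
        using smoothed_tail[OF e(1)[of n], of N] N by simp
    qed
  qed
  then obtain r \<rho> where r: "strict_mono r" "real_distribution \<rho>" "weak_conv_m (smoothed \<circ> e \<circ> id \<circ> r) \<rho>"
    using tight_imp_convergent_subsubsequence[OF _ strict_mono_id] by blast
  have er: "(\<lambda>n. e (r n)) \<longlonglongrightarrow> 0" using LIMSEQ_subseq_LIMSEQ[OF e0 r(1)] by (simp add: o_def)
  show ?thesis
  proof (rule that[OF r(2)])
    fix z assume z: "0 < Im z"
    show "G z = cauchy_transform \<rho> z"
    proof (rule cauchy_transform_eqI_Im[OF r(2) holo bound _ z])
      fix w assume w: "0 < Im w"
      have "(\<lambda>n. poisson_mass ((smoothed \<circ> e \<circ> id \<circ> r) n) w) \<longlonglongrightarrow> poisson_mass \<rho> w"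
        using smoothed_distribution e by (intro weak_conv_poisson_mass r w) simp
      then have "(\<lambda>n. Im w * poisson_mass (smoothed (e (r n))) w) \<longlonglongrightarrow> Im w * poisson_mass \<rho> w"
        by (intro tendsto_mult_left) simp
      then have "(\<lambda>n. - Im (G (w + \<i> * complex_of_real (e (r n))))) \<longlonglongrightarrow> Im w * poisson_mass \<rho> w"
        by (simp add: poisson_mass_smoothed[OF e(1) w])
      moreover have "(\<lambda>n. - Im (G (w + \<i> * complex_of_real (e (r n))))) \<longlonglongrightarrow> - Im (G w)"
      proof (intro tendsto_intros isCont_tendsto_compose[where g = G])
        show "isCont G w" using holomorphic_on_imp_continuous_on[OF holo] w open_upper_half_plane
          by (simp add: continuous_on_eq_continuous_at)
        show "(\<lambda>n. w + \<i> * complex_of_real (e (r n))) \<longlonglongrightarrow> w"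
          using tendsto_add[OF tendsto_const tendsto_mult_left[OF tendsto_of_real[OF er], of \<i>], of w] by simp
      qed
      ultimately have "- Im (G w) = Im w * poisson_mass \<rho> w" using LIMSEQ_unique by blast
      moreover have "Im (cauchy_transform \<rho> w) = - Im w * poisson_mass \<rho> w"
        using r(2) w by (intro Im_cauchy_transform real_distribution.finite_borel_measure_M)
      ultimately show "Im (G w) = Im (cauchy_transform \<rho> w)" by simp
    qed
  qed
qed

end

section \<open>Stieltjes inversion\<close>

text \<open>
  \<open>\<pi>\<close> times the indicator of \<open>{a..b}\<close> with half weight at the endpoints, the limit of
  \<open>arctan ((b - s) / e) - arctan ((a - s) / e)\<close> as \<open>e\<close> tends to \<open>0\<close>.
\<close>

definition endpoint_weight :: "real \<Rightarrow> real \<Rightarrow> real \<Rightarrow> real" where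
  "endpoint_weight a b s = pi / 2 * (sgn (b - s) - sgn (a - s))"

lemma endpoint_weight_le: "endpoint_weight a b s \<le> pi"
  by (auto simp: endpoint_weight_def sgn_if)

lemma measurable_endpoint_weight [measurable]: "endpoint_weight a b \<in> borel_measurable borel"
  unfolding endpoint_weight_def[abs_def] by measurable

lemma arctan_scaled_limit: "(\<lambda>n. arctan (c * real (Suc n))) \<longlonglongrightarrow> pi / 2 * sgn c"
proof -
  consider "c > 0" | "c = 0" | "c < 0" by linarith
  then show ?thesis
  proof cases
    case 1
    then have "filterlim (\<lambda>n. c * real (Suc n)) at_top sequentially" by real_asymp
    from filterlim_compose[OF tendsto_arctan_at_top this] 1 show ?thesis by simp
  next
    case 3
    then have "filterlim (\<lambda>n. c * real (Suc n)) at_bot sequentially" by real_asymp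
    from filterlim_compose[OF tendsto_arctan_at_bot this] 3 show ?thesis by simp
  qed simp
qed

context real_distribution
begin

lemma ennreal_Im_cauchy_transform:
  assumes "0 < e"
  shows "ennreal (- Im (cauchy_transform M (complex_of_real x + \<i> * complex_of_real e))) =
    (\<integral>\<^sup>+s. ennreal (poisson_kernel e (s - x)) \<partial>M)"
proof -
  let ?z = "complex_of_real x + \<i> * complex_of_real e"
  have int: "integrable M (\<lambda>s. e * (1 / (cmod (?z - complex_of_real s))\<^sup>2))"
    using weighted_measure.integrable_kernel_norm[OF kernel_weight, of ?z] assms
    by (intro integrable_mult_right) simp
  have eq: "poisson_kernel e (s - x) = e * (1 / (cmod (?z - complex_of_real s))\<^sup>2)" for s
    using poisson_kernel_diff[of ?z s] by simp
  have "- Im (cauchy_transform M ?z) = e * poisson_mass M ?z"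
    using Im_cauchy_transform[OF finite_borel_measure_M, of ?z] assms by simp
  also have "\<dots> = (\<integral>s. e * (1 / (cmod (?z - complex_of_real s))\<^sup>2) \<partial>M)"
    unfolding kernel_norm_def by (rule integral_mult_right_zero[symmetric])
  finally show ?thesis
    unfolding eq using int assms by (subst nn_integral_eq_integral) auto
qed

text \<open>Tonelli's theorem, with arctan as antiderivative of the Poisson kernel.\<close>

lemma integral_Im_cauchy_transform:
  assumes e: "0 < e" and ab: "a \<le> b"
  shows "(\<integral>\<^sup>+x. ennreal (- Im (cauchy_transform M (complex_of_real x + \<i> * complex_of_real e))) * indicator {a..b} x \<partial>lborel)
    = (\<integral>\<^sup>+s. ennreal (arctan ((b - s) / e) - arctan ((a - s) / e)) \<partial>M)"
proof -
  interpret P: pair_sigma_finite lborel M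
    by (intro pair_sigma_finite.intro sigma_finite_lborel) unfold_locales
  have "(\<integral>\<^sup>+x. ennreal (- Im (cauchy_transform M (complex_of_real x + \<i> * complex_of_real e))) * indicator {a..b} x \<partial>lborel)
    = (\<integral>\<^sup>+x. (\<integral>\<^sup>+s. ennreal (poisson_kernel e (s - x)) * indicator {a..b} x \<partial>M) \<partial>lborel)"
    unfolding ennreal_Im_cauchy_transform[OF e] by (subst nn_integral_multc) auto
  also have "\<dots> = (\<integral>\<^sup>+s. (\<integral>\<^sup>+x. ennreal (poisson_kernel e (s - x)) * indicator {a..b} x \<partial>lborel) \<partial>M)"
    by (rule P.Fubini'[symmetric]) (unfold split_beta', measurable)
  also have "\<dots> = (\<integral>\<^sup>+s. ennreal (arctan ((b - s) / e) - arctan ((a - s) / e)) \<partial>M)"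
  proof (rule nn_integral_cong)
    fix s
    show "(\<integral>\<^sup>+x. ennreal (poisson_kernel e (s - x)) * indicator {a..b} x \<partial>lborel)
      = ennreal (arctan ((b - s) / e) - arctan ((a - s) / e))"
    proof (rule nn_integral_FTC_Icc)
      show "DERIV (\<lambda>x. arctan ((x - s) / e)) x :> poisson_kernel e (s - x)" for x
      proof -
        have pos: "0 < e * e + (s - x) * (s - x)" using e by (intro add_pos_nonneg) auto
        have "1 / e / (1 + ((x - s) / e)\<^sup>2) = poisson_kernel e (s - x)"
          using e pos by (simp add: poisson_kernel_def divide_simps power2_eq_square) (simp add: algebra_simps)
        moreover have "DERIV (\<lambda>x. arctan ((x - s) / e)) x :> 1 / e / (1 + ((x - s) / e)\<^sup>2)"
          using e by (auto intro!: derivative_eq_intros simp: divide_inverse mult.commute)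
        ultimately show ?thesis by simp
      qed
    qed (use e ab in \<open>auto intro: poisson_kernel_nonneg\<close>)
  qed
  finally show ?thesis .
qed

lemma stieltjes_limit:
  assumes ab: "a \<le> b"
  shows "(\<lambda>n. \<integral>\<^sup>+x. ennreal (- Im (cauchy_transform M (complex_of_real x + \<i> * complex_of_real (1 / real (Suc n))))) * indicator {a..b} x \<partial>lborel)
    \<longlonglongrightarrow> (\<integral>\<^sup>+s. ennreal (endpoint_weight a b s) \<partial>M)"
proof -
  have "(\<lambda>n. \<integral>\<^sup>+s. ennreal (arctan ((b - s) * real (Suc n)) - arctan ((a - s) * real (Suc n))) \<partial>M)
    \<longlonglongrightarrow> (\<integral>\<^sup>+s. ennreal (endpoint_weight a b s) \<partial>M)"
  proof (rule nn_integral_dominated_convergence[where w = "\<lambda>_. ennreal pi"])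
    show "AE x in M. ennreal (arctan ((b - x) * real (Suc j)) - arctan ((a - x) * real (Suc j))) \<le> ennreal pi" for j
    proof (intro AE_I2 ennreal_leI)
      fix x
      show "arctan ((b - x) * real (Suc j)) - arctan ((a - x) * real (Suc j)) \<le> pi"
        using arctan_bounded[of "(b - x) * real (Suc j)"] arctan_bounded[of "(a - x) * real (Suc j)"] by linarith
    qed
    show "AE x in M. (\<lambda>i. ennreal (arctan ((b - x) * real (Suc i)) - arctan ((a - x) * real (Suc i))))
        \<longlonglongrightarrow> ennreal (endpoint_weight a b x)"
      unfolding endpoint_weight_def right_diff_distrib
      by (intro AE_I2 tendsto_ennrealI tendsto_diff arctan_scaled_limit[THEN tendsto_cong[THEN iffD1, rotated]])
        (auto simp: algebra_simps)
  qed (use emeasure_space_1 in auto)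
  moreover have "0 < 1 / real (Suc n)" for n by simp
  ultimately show ?thesis
    unfolding integral_Im_cauchy_transform[OF \<open>\<And>n. 0 < 1 / real (Suc n)\<close> ab] by simp
qed

text \<open>The intervals exhaust the open ray from inside. Every point is eventually interior or
  exterior to them, so the half weights disappear in the limit, even if \<open>M\<close> has an atom
  at \<open>x\<close>.\<close>

lemma endpoint_weight_limit:
  "(\<lambda>n. \<integral>\<^sup>+s. ennreal (endpoint_weight (x + 1 / real (Suc n)) (x + 1 + real (Suc n)) s) \<partial>M)
    \<longlonglongrightarrow> ennreal pi * emeasure M {x<..}"
proof -
  have "(\<lambda>n. \<integral>\<^sup>+s. ennreal (endpoint_weight (x + 1 / real (Suc n)) (x + 1 + real (Suc n)) s) \<partial>M)
    \<longlonglongrightarrow> (\<integral>\<^sup>+s. ennreal (pi * indicator {x<..} s) \<partial>M)"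
  proof (rule nn_integral_dominated_convergence[where w = "\<lambda>_. ennreal pi"])
    show "AE s in M. (\<lambda>n. ennreal (endpoint_weight (x + 1 / real (Suc n)) (x + 1 + real (Suc n)) s))
        \<longlonglongrightarrow> ennreal (pi * indicator {x<..} s)"
    proof (intro AE_I2 tendsto_ennrealI)
      fix s
      have 1: "\<forall>\<^sub>F n in sequentially. s < x + 1 + real (Suc n)" by real_asymp
      have 2: "\<forall>\<^sub>F n in sequentially. s > x \<longrightarrow> x + 1 / real (Suc n) < s"
      proof (cases "s > x")
        case True
        have "(\<lambda>n. x + 1 / real (Suc n)) \<longlonglongrightarrow> x" by real_asymp
        then have "\<forall>\<^sub>F n in sequentially. x + 1 / real (Suc n) < s" using True by (rule order_tendstoD)
        then show ?thesis by eventually_elim simp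
      qed simp
      have "\<forall>\<^sub>F n in sequentially. pi * indicator {x<..} s = endpoint_weight (x + 1 / real (Suc n)) (x + 1 + real (Suc n)) s"
        using 1 2
      proof eventually_elim
        case (elim n)
        have "0 < 1 / real (Suc n)" by simp
        moreover from this have "s < x + 1 / real (Suc n)" if "\<not> x < s" using that by linarith
        ultimately show ?case using elim
          by (cases "x < s") (auto simp: endpoint_weight_def sgn_if simp del: of_nat_Suc)
      qed
      then show "(\<lambda>n. endpoint_weight (x + 1 / real (Suc n)) (x + 1 + real (Suc n)) s) \<longlonglongrightarrow> pi * indicator {x<..} s"
        by (rule Lim_transform_eventually[OF tendsto_const])
    qed
  qed (use emeasure_space_1 in \<open>auto intro!: AE_I2 ennreal_leI endpoint_weight_le\<close>)
  also have "(\<integral>\<^sup>+s. ennreal (pi * indicator {x<..} s) \<partial>M) = (\<integral>\<^sup>+s. ennreal pi * indicator {x<..} s \<partial>M)"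
    by (intro nn_integral_cong) (auto simp: indicator_def)
  also have "\<dots> = ennreal pi * emeasure M {x<..}"
    by (subst nn_integral_cmult_indicator) auto
  finally show ?thesis .
qed

theorem eq_densityI:
  fixes f :: "real \<Rightarrow> real"
  assumes f [measurable]: "f \<in> borel_measurable borel"
    and lim: "\<And>a b. a \<le> b \<Longrightarrow> (\<lambda>n. \<integral>\<^sup>+x. ennreal (- Im (cauchy_transform M (complex_of_real x + \<i> * complex_of_real (1 / real (Suc n))))) * indicator {a..b} x \<partial>lborel)
      \<longlonglongrightarrow> (\<integral>\<^sup>+x. ennreal pi * ennreal (f x) * indicator {a..b} x \<partial>lborel)"
  shows "M = density lborel (\<lambda>x. ennreal (f x))"
proof (rule measure_eqI_lessThan)
  fix x
  let ?I = "\<lambda>n. {x + 1 / real (Suc n)..x + 1 + real (Suc n)}"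
  have le: "x + 1 / real (Suc n) \<le> x + 1 + real (Suc n)" for n
    by (simp add: divide_le_eq) (simp add: field_simps)
  have "(\<integral>\<^sup>+s. ennreal (endpoint_weight (x + 1 / real (Suc n)) (x + 1 + real (Suc n)) s) \<partial>M)
      = (\<integral>\<^sup>+x. ennreal pi * ennreal (f x) * indicator (?I n) x \<partial>lborel)" for n
    by (rule LIMSEQ_unique[OF stieltjes_limit[OF le] lim[OF le]])
  then have 1: "(\<lambda>n. \<integral>\<^sup>+x. ennreal pi * ennreal (f x) * indicator (?I n) x \<partial>lborel)
      \<longlonglongrightarrow> ennreal pi * emeasure M {x<..}"
    using endpoint_weight_limit[of x] by simp
  have inc: "incseq ?I"
  proof (rule incseq_SucI)
    fix n
    have "1 / real (Suc (Suc n)) \<le> 1 / real (Suc n)" by (intro divide_left_mono) auto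
    then show "?I n \<subseteq> ?I (Suc n)" by auto
  qed
  have U: "(\<Union>n. ?I n) = {x<..}"
  proof (intro equalityI subsetI)
    fix s assume "s \<in> {x<..}"
    then have s: "x < s" by simp
    have "(\<lambda>n. x + 1 / real (Suc n)) \<longlonglongrightarrow> x" by real_asymp
    then have "\<forall>\<^sub>F n in sequentially. x + 1 / real (Suc n) < s" using s by (rule order_tendstoD)
    moreover have "\<forall>\<^sub>F n in sequentially. s < x + 1 + real (Suc n)" by real_asymp
    ultimately have "\<forall>\<^sub>F n in sequentially. s \<in> ?I n" by eventually_elim simp
    then show "s \<in> (\<Union>n. ?I n)" by (auto simp: eventually_sequentially simp del: of_nat_Suc)
  next
    fix s assume "s \<in> (\<Union>n. ?I n)"
    then obtain n where "x + 1 / real (Suc n) \<le> s" by auto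
    moreover have "0 < 1 / real (Suc n)" by simp
    ultimately have "x < s" by linarith
    then show "s \<in> {x<..}" by simp
  qed
  let ?D = "density lborel (\<lambda>x. ennreal pi * ennreal (f x))"
  have eD: "emeasure ?D A = (\<integral>\<^sup>+x. ennreal pi * ennreal (f x) * indicator A x \<partial>lborel)" if "A \<in> sets borel" for A
    using that by (subst emeasure_density) auto
  have "(\<lambda>n. emeasure ?D (?I n)) \<longlonglongrightarrow> emeasure ?D (\<Union>n. ?I n)"
    by (rule Lim_emeasure_incseq[OF _ inc]) auto
  then have "(\<lambda>n. \<integral>\<^sup>+x. ennreal pi * ennreal (f x) * indicator (?I n) x \<partial>lborel)
      \<longlonglongrightarrow> (\<integral>\<^sup>+y. ennreal pi * ennreal (f y) * indicator {x<..} y \<partial>lborel)"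
  proof -
    have "emeasure ?D (?I n) = (\<integral>\<^sup>+x. ennreal pi * ennreal (f x) * indicator (?I n) x \<partial>lborel)" for n
      by (rule eD) simp
    moreover have "emeasure ?D {x<..} = (\<integral>\<^sup>+y. ennreal pi * ennreal (f y) * indicator {x<..} y \<partial>lborel)"
      by (rule eD) simp
    ultimately show ?thesis using \<open>(\<lambda>n. emeasure ?D (?I n)) \<longlonglongrightarrow> emeasure ?D (\<Union>n. ?I n)\<close>
      unfolding U by (simp only:)
  qed
  then have "ennreal pi * emeasure M {x<..} = (\<integral>\<^sup>+y. ennreal pi * ennreal (f y) * indicator {x<..} y \<partial>lborel)"
    using 1 LIMSEQ_unique by blast
  also have "\<dots> = ennreal pi * (\<integral>\<^sup>+y. ennreal (f y) * indicator {x<..} y \<partial>lborel)"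
    unfolding mult.assoc by (subst nn_integral_cmult) auto
  finally have "emeasure M {x<..} = (\<integral>\<^sup>+y. ennreal (f y) * indicator {x<..} y \<partial>lborel)"
    by (simp add: ennreal_mult_cancel_left)
  then show "emeasure M {x<..} = emeasure (density lborel (\<lambda>x. ennreal (f x))) {x<..}"
    by (subst emeasure_density) auto
  show "emeasure M {x<..} < \<infinity>" using emeasure_finite[of "{x<..}"] by (simp add: less_top[symmetric])
qed auto

text \<open>H is bounded on the compact rectangle over [a, b] of height 1, which contains all the
  shifted segments, so dominated convergence gives the limit required by
  \<open>eq_densityI\<close>.\<close>

theorem eq_density_boundary_values:
  assumes H: "continuous_on {z. 0 \<le> Im z} H" "\<And>z. 0 < Im z \<Longrightarrow> H z = cauchy_transform M z"
  shows "M = density lborel (\<lambda>x. ennreal (- Im (H (complex_of_real x)) / pi))"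
proof (rule eq_densityI)
  have contH: "continuous_on UNIV (\<lambda>x. Im (H (complex_of_real x)))"
    by (intro continuous_intros continuous_on_compose2[OF H(1)]) auto
  then show "(\<lambda>x. - Im (H (complex_of_real x)) / pi) \<in> borel_measurable borel"
    by (intro borel_measurable_continuous_onI continuous_on_divide continuous_on_minus continuous_on_const) auto
  fix a b :: real assume ab: "a \<le> b"
  define K where "K = cbox (Complex a 0) (Complex b 1)"
  have "compact (H ` K)"
    by (intro compact_continuous_image continuous_on_subset[OF H(1)])
      (auto simp: K_def in_cbox_complex_iff)
  then obtain B where B: "\<And>z. z \<in> K \<Longrightarrow> cmod (H z) \<le> B"
    by (meson bounded_iff compact_imp_bounded imageI)
  let ?z = "\<lambda>n x. complex_of_real x + \<i> * complex_of_real (1 / real (Suc n))"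
  have cont: "continuous_on UNIV (\<lambda>x. Im (H (?z n x)))" for n
    by (intro continuous_intros continuous_on_compose2[OF H(1)]) auto
  have eq: "cauchy_transform M (?z n x) = H (?z n x)" for n x
    by (subst H(2)) auto
  have lim: "(\<lambda>n. - Im (H (?z n x))) \<longlonglongrightarrow> - Im (H (complex_of_real x))" for x
  proof (intro tendsto_intros)
    have "(\<lambda>n. ?z n x) \<longlonglongrightarrow> complex_of_real x + \<i> * complex_of_real 0"
      by (intro tendsto_intros) real_asymp
    then show "(\<lambda>n. H (?z n x)) \<longlonglongrightarrow> H (complex_of_real x)"
      by (intro continuous_on_tendsto_compose[OF H(1)]) auto
  qed
  show "(\<lambda>n. \<integral>\<^sup>+x. ennreal (- Im (cauchy_transform M (?z n x))) * indicator {a..b} x \<partial>lborel)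
      \<longlonglongrightarrow> (\<integral>\<^sup>+x. ennreal pi * ennreal (- Im (H (complex_of_real x)) / pi) * indicator {a..b} x \<partial>lborel)"
    unfolding eq
  proof (rule nn_integral_dominated_convergence[where w = "\<lambda>x. ennreal B * indicator {a..b} x"])
    show "(\<lambda>x. ennreal (- Im (H (?z j x))) * indicator {a..b} x) \<in> borel_measurable lborel" for j
      using borel_measurable_continuous_onI[OF cont[of j]] by measurable
    show "(\<lambda>x. ennreal pi * ennreal (- Im (H (complex_of_real x)) / pi) * indicator {a..b} x) \<in> borel_measurable lborel"
      using borel_measurable_continuous_onI[OF contH] by measurable
    show "AE x in lborel. ennreal (- Im (H (?z j x))) * indicator {a..b} x \<le> ennreal B * indicator {a..b} x" for j
    proof (rule AE_I2)
      fix x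
      show "ennreal (- Im (H (?z j x))) * indicator {a..b} x \<le> ennreal B * indicator {a..b} x"
      proof (cases "x \<in> {a..b}")
        case True
        then have "?z j x \<in> K" by (simp add: K_def in_cbox_complex_iff)
        then have "- Im (H (?z j x)) \<le> B" using B abs_Im_le_cmod[of "H (?z j x)"] by force
        then show ?thesis using True by (simp add: ennreal_leI)
      qed simp
    qed
    show "(\<integral>\<^sup>+x. ennreal B * indicator {a..b} x \<partial>lborel) < \<infinity>"
      using ab by (simp add: nn_integral_cmult_indicator ennreal_mult_less_top)
    show "AE x in lborel. (\<lambda>n. ennreal (- Im (H (?z n x))) * indicator {a..b} x)
        \<longlonglongrightarrow> ennreal pi * ennreal (- Im (H (complex_of_real x)) / pi) * indicator {a..b} x"
    proof (rule AE_I2)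
      fix x
      have "(\<lambda>n. ennreal (- Im (H (?z n x)))) \<longlonglongrightarrow> ennreal (- Im (H (complex_of_real x)))"
        by (intro tendsto_ennrealI lim)
      moreover have "ennreal pi * ennreal (- Im (H (complex_of_real x)) / pi) = ennreal (- Im (H (complex_of_real x)))"
        by (subst ennreal_mult'[symmetric]) auto
      ultimately show "(\<lambda>n. ennreal (- Im (H (?z n x))) * indicator {a..b} x)
        \<longlonglongrightarrow> ennreal pi * ennreal (- Im (H (complex_of_real x)) / pi) * indicator {a..b} x"
        by (cases "x \<in> {a..b}") auto
    qed
  qed measurable
qed

end

theorem cauchy_transform_inj:
  assumes "real_distribution \<mu>" "real_distribution \<nu>"
    and eq: "\<And>z. 0 < Im z \<Longrightarrow> cauchy_transform \<mu> z = cauchy_transform \<nu> z"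
  shows "\<mu> = \<nu>"
proof (rule measure_eqI_lessThan)
  interpret \<mu>: real_distribution \<mu> by fact
  interpret \<nu>: real_distribution \<nu> by fact
  show "sets \<mu> = sets borel" "sets \<nu> = sets borel" by simp_all
  fix x
  have le: "x + 1 / real (Suc n) \<le> x + 1 + real (Suc n)" for n
    by (simp add: divide_le_eq) (simp add: field_simps)
  have "(\<integral>\<^sup>+s. ennreal (endpoint_weight (x + 1 / real (Suc n)) (x + 1 + real (Suc n)) s) \<partial>\<mu>)
      = (\<integral>\<^sup>+s. ennreal (endpoint_weight (x + 1 / real (Suc n)) (x + 1 + real (Suc n)) s) \<partial>\<nu>)" for n
    using LIMSEQ_unique[OF \<mu>.stieltjes_limit[OF le] ] \<nu>.stieltjes_limit[OF le, of n]
    by (simp add: eq)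
  then have "ennreal pi * emeasure \<mu> {x<..} = ennreal pi * emeasure \<nu> {x<..}"
    using LIMSEQ_unique[OF \<mu>.endpoint_weight_limit[of x]] \<nu>.endpoint_weight_limit[of x] by simp
  then show "emeasure \<mu> {x<..} = emeasure \<nu> {x<..}"
    by (simp add: ennreal_mult_cancel_left)
  show "emeasure \<mu> {x<..} < \<infinity>" using \<mu>.emeasure_finite[of "{x<..}"] by (simp add: less_top[symmetric])
qed

section \<open>Existence of free convolutions\<close>

text \<open>The maps \<open>W n\<close> may fail to be locally bounded, but their reciprocals are
  bounded by 1 / Im z, so Montel's theorem is applied to these. Hurwitz's theorem keeps the limit
  free of zeros, so that it can be inverted back.\<close>

lemma upper_half_plane_self_map_limit:
  assumes holo: "\<And>n. W n holomorphic_on upper_half_plane"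
    and Im: "\<And>n z. 0 < Im z \<Longrightarrow> Im z \<le> Im (W n z)"
    and S: "S \<noteq> {}" "S \<subseteq> upper_half_plane"
    and lim: "\<And>z. z \<in> S \<Longrightarrow> (\<lambda>n. W n z) \<longlonglongrightarrow> \<omega>0 z"
  obtains \<omega> where "\<omega> holomorphic_on upper_half_plane"
    "\<forall>z. 0 < Im z \<longrightarrow> Im z \<le> Im (\<omega> z)" "\<forall>z\<in>S. \<omega> z = \<omega>0 z"
proof -
  define V where "V = (\<lambda>n z. 1 / W n z)"
  have W_nz: "W n z \<noteq> 0" if "0 < Im z" for n z
    using Im[OF that, of n] that by auto
  have V_holo: "V n holomorphic_on upper_half_plane" for n
    unfolding V_def by (intro holomorphic_intros holo) (simp add: W_nz)
  have V_le: "cmod (V n z) \<le> 1 / Im z" if "0 < Im z" for n z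
  proof -
    have "Im z \<le> cmod (W n z)" using Im[OF that, of n] abs_Im_le_cmod[of "W n z"] by linarith
    then show ?thesis using that by (simp add: V_def norm_divide frac_le)
  qed
  obtain D r where D: "D holomorphic_on upper_half_plane" "strict_mono (r :: nat \<Rightarrow> nat)"
      "\<And>z. z \<in> upper_half_plane \<Longrightarrow> (\<lambda>n. V (r n) z) \<longlonglongrightarrow> D z"
      "\<And>K. compact K \<Longrightarrow> K \<subseteq> upper_half_plane \<Longrightarrow> uniform_limit K (V \<circ> r) D sequentially"
  proof (rule Montel[OF open_upper_half_plane, of "range V" V])
    show "h holomorphic_on upper_half_plane" if "h \<in> range V" for h using that V_holo by auto
    fix K assume K: "compact K" "K \<subseteq> upper_half_plane"
    show "\<exists>B. \<forall>h\<in>range V. \<forall>z\<in>K. cmod (h z) \<le> B"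
    proof (cases "K = {}")
      case False
      have "continuous_on K Im" by (intro continuous_intros)
      from continuous_attains_inf[OF K(1) False this]
      obtain z0 where z0: "z0 \<in> K" "\<And>z. z \<in> K \<Longrightarrow> Im z0 \<le> Im z" by blast
      have "cmod (V n z) \<le> 1 / Im z0" if "z \<in> K" for n z
      proof -
        have "0 < Im z0" "0 < Im z" using z0(1) that K(2) by auto
        then have "1 / Im z \<le> 1 / Im z0" using z0(2)[OF that] by (intro frac_le) auto
        then show ?thesis using V_le[OF \<open>0 < Im z\<close>, of n] by linarith
      qed
      then show ?thesis by blast
    qed simp
  qed auto
  have D_S: "D z = 1 / \<omega>0 z" "\<omega>0 z \<noteq> 0" if "z \<in> S" for z
  proof -
    have z: "0 < Im z" using that S(2) by auto
    have "(\<lambda>n. Im (W n z)) \<longlonglongrightarrow> Im (\<omega>0 z)" by (intro tendsto_intros lim that)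
    then have "Im z \<le> Im (\<omega>0 z)" by (rule LIMSEQ_le_const) (use Im[OF z] in auto)
    then show nz: "\<omega>0 z \<noteq> 0" using z by auto
    have "(\<lambda>n. V (r n) z) \<longlonglongrightarrow> 1 / \<omega>0 z"
      unfolding V_def using LIMSEQ_subseq_LIMSEQ[OF lim[OF that] D(2)] nz
      by (intro tendsto_divide tendsto_const) (auto simp: o_def)
    then show "D z = 1 / \<omega>0 z" using D(3)[of z] z LIMSEQ_unique by auto
  qed
  \<comment> \<open>Hurwitz's theorem needs a nonconstant limit; a constant one is nonzero because
    its value on \<open>S\<close> is.\<close>
  have D_nz: "D z \<noteq> 0" if z: "0 < Im z" for z
  proof (cases "D constant_on upper_half_plane")
    case True
    obtain s where "s \<in> S" using S(1) by auto
    then have "D s \<noteq> 0" "s \<in> upper_half_plane" using D_S[of s] S(2) by auto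
    then show ?thesis using True z by (auto simp: constant_on_def)
  next
    case False
    show ?thesis
    proof (rule Hurwitz_no_zeros[where \<F> = "V \<circ> r" and S = upper_half_plane and g = D])
      show "(V \<circ> r) n z \<noteq> 0" if "z \<in> upper_half_plane" for n z
        using that W_nz by (simp add: V_def)
      show "uniform_limit K (V \<circ> r) D sequentially" if "compact K" "K \<subseteq> upper_half_plane" for K
        by (rule D(4)[OF that])
      show "(V \<circ> r) n holomorphic_on upper_half_plane" for n using V_holo by simp
    qed (use D(1) False z in auto)
  qed
  show ?thesis
  proof (intro that[of "\<lambda>z. 1 / D z"] allI ballI impI)
    show "(\<lambda>z. 1 / D z) holomorphic_on upper_half_plane"
      by (intro holomorphic_intros D(1)) (simp add: D_nz)
    show "Im z \<le> Im (1 / D z)" if z: "0 < Im z" for z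
    proof -
      have "(\<lambda>n. 1 / V (r n) z) \<longlonglongrightarrow> 1 / D z"
        using D(3)[of z] z D_nz[OF z] by (intro tendsto_divide tendsto_const) auto
      then have "(\<lambda>n. Im (W (r n) z)) \<longlonglongrightarrow> Im (1 / D z)"
        unfolding V_def by (intro tendsto_Im) simp
      then show ?thesis by (rule LIMSEQ_le_const) (use Im[OF z] in auto)
    qed
    show "1 / D z = \<omega>0 z" if "z \<in> S" for z using D_S[OF that] by simp
  qed
qed

text \<open>The smallness built into \<open>asymptotic_inverse\<close> is a fixed ratio. The detour
  through \<open>voiculescu_transform_on\<close> improves it to any ratio, at the cost of going
  further out.\<close>

lemma asymptotic_inverse_small:
  assumes "real_distribution \<mu>" "asymptotic_inverse \<mu> \<phi> \<alpha>" "0 < \<epsilon>"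
  obtains B where "0 < B" "\<And>z. z \<in> truncated_cone \<alpha> B \<Longrightarrow>
    F_transform \<mu> (z + \<phi> z) = z \<and> cmod (\<phi> z) \<le> \<epsilon> * cmod z"
proof -
  interpret real_distribution \<mu> by fact
  obtain \<beta> where "voiculescu_transform_on \<mu> \<phi> \<alpha> \<beta>"
    using asymptotic_inverse_imp_voiculescu_transform_on[OF assms(2)] by blast
  then show ?thesis by (rule voiculescu_transform_onD[OF _ assms(3)]) (rule that)
qed

section \<open>Subordination functions by fixed-point iteration\<close>

locale free_pair = mu: real_distribution \<mu> + nu: real_distribution \<nu> for \<mu> \<nu>
begin

definition h1 :: "complex \<Rightarrow> complex" where "h1 w = F_transform \<mu> w - w"
definition h2 :: "complex \<Rightarrow> complex" where "h2 w = F_transform \<nu> w - w"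
definition T :: "complex \<Rightarrow> complex \<Rightarrow> complex" where "T z w = z + h2 (z + h1 w)"

lemma Im_h: "0 < Im w \<Longrightarrow> 0 \<le> Im (h1 w)" "0 < Im w \<Longrightarrow> 0 \<le> Im (h2 w)"
  using mu.Im_F_transform_ge nu.Im_F_transform_ge by (auto simp: h1_def h2_def)

lemma h_holomorphic: "h1 holomorphic_on upper_half_plane" "h2 holomorphic_on upper_half_plane"
  unfolding h1_def h2_def
  by (intro holomorphic_intros mu.F_transform_holomorphic nu.F_transform_holomorphic)+

text \<open>Aperture 3 is 2 \<alpha> + 1 for the largest aperture \<alpha> = 1 treated later, and 7
  = 2 * 3 + 1 accommodates one further perturbation.\<close>

definition radius :: real where "radius = cone_radius 3"

lemma radius: "0 < radius" "radius < 1/4"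
  by (auto simp: radius_def cone_radius_def)

lemma cone_estimates:
  assumes "0 < \<epsilon>"
  obtains R where "0 < R"
    "\<And>w. w \<in> truncated_cone 7 R \<Longrightarrow> cmod (h1 w) \<le> \<epsilon> * cmod w \<and> cmod (h2 w) \<le> \<epsilon> * cmod w"
    "\<And>w v. w \<in> truncated_cone 7 R \<Longrightarrow> v \<in> truncated_cone 7 R \<Longrightarrow>
       cmod (h1 w - h1 v) \<le> \<epsilon> * cmod (w - v) \<and> cmod (h2 w - h2 v) \<le> \<epsilon> * cmod (w - v)"
proof -
  have 7: "(0::real) < 7" by simp
  obtain R1 where R1: "0 < R1"
    "\<And>w. w \<in> truncated_cone 7 R1 \<Longrightarrow> cmod (h1 w) \<le> \<epsilon> * cmod w"
    "\<And>w v. w \<in> truncated_cone 7 R1 \<Longrightarrow> v \<in> truncated_cone 7 R1 \<Longrightarrow> cmod (h1 w - h1 v) \<le> \<epsilon> * cmod (w - v)"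
    using mu.F_transform_cone_asymptotics[OF 7 assms] unfolding h1_def by metis
  obtain R2 where R2: "0 < R2"
    "\<And>w. w \<in> truncated_cone 7 R2 \<Longrightarrow> cmod (h2 w) \<le> \<epsilon> * cmod w"
    "\<And>w v. w \<in> truncated_cone 7 R2 \<Longrightarrow> v \<in> truncated_cone 7 R2 \<Longrightarrow> cmod (h2 w - h2 v) \<le> \<epsilon> * cmod (w - v)"
    using nu.F_transform_cone_asymptotics[OF 7 assms] unfolding h2_def by metis
  have sub: "w \<in> truncated_cone 7 R1 \<and> w \<in> truncated_cone 7 R2" if "w \<in> truncated_cone 7 (max R1 R2)" for w
    using that by (auto simp: truncated_cone_def)
  show ?thesis
    by (rule that[of "max R1 R2"]) (use R1 R2 sub in auto)
qed

lemma near_in_cone: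
  assumes "0 \<le> R" "z \<in> truncated_cone 3 (2 * R)" "cmod (w - z) \<le> radius * cmod z"
  shows "w \<in> truncated_cone 7 R" "cmod w \<le> 2 * cmod z"
proof -
  show "w \<in> truncated_cone 7 R"
    using truncated_cone_perturb[of 3 R z w] assms by (simp add: radius_def)
  have "radius * cmod z \<le> 1/4 * cmod z" using radius by (intro mult_right_mono) auto
  then show "cmod w \<le> 2 * cmod z"
    using assms(3) norm_triangle_ineq2[of w z] norm_ge_zero[of z] by linarith
qed

lemma cone_contraction:
  obtains R where "0 < R"
    "\<And>z w. z \<in> truncated_cone 3 (2 * R) \<Longrightarrow> w \<in> cball z (radius * cmod z) \<Longrightarrow>
       z + h1 w \<in> cball z (radius * cmod z) \<and> z + h2 w \<in> cball z (radius * cmod z)"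
    "\<And>z w v. z \<in> truncated_cone 3 (2 * R) \<Longrightarrow> w \<in> cball z (radius * cmod z) \<Longrightarrow>
       v \<in> cball z (radius * cmod z) \<Longrightarrow> cmod (T z w - T z v) \<le> 1/4 * cmod (w - v)"
proof -
  have r2: "0 < radius / 2" using radius by simp
  obtain R where R: "0 < R"
    "\<And>w. w \<in> truncated_cone 7 R \<Longrightarrow> cmod (h1 w) \<le> radius / 2 * cmod w \<and> cmod (h2 w) \<le> radius / 2 * cmod w"
    "\<And>w v. w \<in> truncated_cone 7 R \<Longrightarrow> v \<in> truncated_cone 7 R \<Longrightarrow>
       cmod (h1 w - h1 v) \<le> radius / 2 * cmod (w - v) \<and> cmod (h2 w - h2 v) \<le> radius / 2 * cmod (w - v)"
    using cone_estimates[OF r2] by metis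
  have mem: "w \<in> truncated_cone 7 R" "cmod w \<le> 2 * cmod z"
    if "z \<in> truncated_cone 3 (2 * R)" "w \<in> cball z (radius * cmod z)" for z w
    using near_in_cone[of R z w] that R(1) by (auto simp: dist_norm norm_minus_commute)
  have self: "z + h1 w \<in> cball z (radius * cmod z) \<and> z + h2 w \<in> cball z (radius * cmod z)"
    if "z \<in> truncated_cone 3 (2 * R)" "w \<in> cball z (radius * cmod z)" for z w
  proof -
    have "radius / 2 * cmod w \<le> radius / 2 * (2 * cmod z)"
      using mem(2)[OF that] radius by (intro mult_left_mono) auto
    then show ?thesis using R(2)[OF mem(1)[OF that]] by (simp add: dist_norm)
  qed
  show ?thesis
  proof (rule that[OF R(1) self])
    fix z w v assume z: "z \<in> truncated_cone 3 (2 * R)"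
      and w: "w \<in> cball z (radius * cmod z)" and v: "v \<in> cball z (radius * cmod z)"
    have "cmod (T z w - T z v) \<le> radius / 2 * cmod ((z + h1 w) - (z + h1 v))"
      using R(3)[OF mem(1)[OF z conjunct1[OF self[OF z w]]] mem(1)[OF z conjunct1[OF self[OF z v]]]]
      by (simp add: T_def)
    also have "\<dots> = radius / 2 * cmod (h1 w - h1 v)" by simp
    also have "\<dots> \<le> radius / 2 * (radius / 2 * cmod (w - v))"
      using R(3)[OF mem(1)[OF z w] mem(1)[OF z v]] radius by (intro mult_left_mono) auto
    also have "\<dots> \<le> 1/4 * cmod (w - v)"
    proof -
      have "radius / 2 * (radius / 2) \<le> 1/4 * 1" using radius by (intro mult_mono) auto
      from mult_right_mono[OF this, of "cmod (w - v)"] show ?thesis by (simp add: mult.assoc)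
    qed
    finally show "cmod (T z w - T z v) \<le> 1/4 * cmod (w - v)" .
  qed auto
qed

primrec W :: "nat \<Rightarrow> complex \<Rightarrow> complex" where
  "W 0 z = z"
| "W (Suc n) z = T z (W n z)"

lemma Im_W: "0 < Im z \<Longrightarrow> Im z \<le> Im (W n z)"
proof (induction n)
  case (Suc n)
  then have "0 \<le> Im (h1 (W n z))" by (intro Im_h) linarith
  then have "0 \<le> Im (h2 (z + h1 (W n z)))" using Suc.prems by (intro Im_h) simp
  then show ?case by (simp add: T_def)
qed simp

lemma holomorphic_h_compose:
  assumes "f holomorphic_on upper_half_plane" "\<And>z. 0 < Im z \<Longrightarrow> Im z \<le> Im (f z)"
  shows "(\<lambda>z. h1 (f z)) holomorphic_on upper_half_plane" "(\<lambda>z. h2 (f z)) holomorphic_on upper_half_plane"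
proof -
  have "f ` upper_half_plane \<subseteq> upper_half_plane" using assms(2) by force
  then show "(\<lambda>z. h1 (f z)) holomorphic_on upper_half_plane" "(\<lambda>z. h2 (f z)) holomorphic_on upper_half_plane"
    using holomorphic_on_compose_gen[OF assms(1) h_holomorphic(1)] holomorphic_on_compose_gen[OF assms(1) h_holomorphic(2)]
    by (auto simp: o_def)
qed

lemma W_holomorphic: "W n holomorphic_on upper_half_plane"
proof (induction n)
  case 0
  then show ?case by (simp add: holomorphic_on_ident)
next
  case (Suc n)
  have "(\<lambda>z. h1 (W n z)) holomorphic_on upper_half_plane"
    by (rule holomorphic_h_compose[OF Suc Im_W])
  then have 1: "(\<lambda>z. z + h1 (W n z)) holomorphic_on upper_half_plane"
    by (intro holomorphic_intros)
  have 2: "Im z \<le> Im (z + h1 (W n z))" if "0 < Im z" for z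
    using Im_h(1)[of "W n z"] Im_W[OF that, of n] that by simp
  have "(\<lambda>z. z + h2 (z + h1 (W n z))) holomorphic_on upper_half_plane"
    by (intro holomorphic_intros holomorphic_h_compose[OF 1 2])
  then show ?case by (simp add: T_def)
qed

text \<open>The last clause records uniqueness of the fixed point in the ball. It allows
  \<open>\<omega>1\<close> to be identified from a candidate value without a return to the
  iteration.\<close>

lemma subordination:
  obtains \<omega>1 \<omega>2 B where "\<omega>1 holomorphic_on upper_half_plane" "\<omega>2 holomorphic_on upper_half_plane"
    "\<forall>z. 0 < Im z \<longrightarrow> Im z \<le> Im (\<omega>1 z) \<and> Im z \<le> Im (\<omega>2 z)"
    "\<forall>z. 0 < Im z \<longrightarrow> \<omega>1 z = z + h2 (\<omega>2 z) \<and> \<omega>2 z = z + h1 (\<omega>1 z)"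
    "0 < B" "\<forall>z\<in>truncated_cone 3 B.
      \<omega>1 z \<in> cball z (radius * cmod z) \<and> \<omega>2 z \<in> cball z (radius * cmod z)"
    "\<forall>z\<in>truncated_cone 3 B. \<forall>w\<in>cball z (radius * cmod z). w = T z w \<longrightarrow> \<omega>1 z = w"
proof -
  obtain R where R: "0 < R"
    "\<And>z w. z \<in> truncated_cone 3 (2 * R) \<Longrightarrow> w \<in> cball z (radius * cmod z) \<Longrightarrow>
       z + h1 w \<in> cball z (radius * cmod z) \<and> z + h2 w \<in> cball z (radius * cmod z)"
    "\<And>z w v. z \<in> truncated_cone 3 (2 * R) \<Longrightarrow> w \<in> cball z (radius * cmod z) \<Longrightarrow>
       v \<in> cball z (radius * cmod z) \<Longrightarrow> cmod (T z w - T z v) \<le> 1/4 * cmod (w - v)"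
    using cone_contraction by metis
  let ?S = "\<lambda>z. cball z (radius * cmod z)"
  have TS: "T z w \<in> ?S z" if "z \<in> truncated_cone 3 (2 * R)" "w \<in> ?S z" for z w
    using R(2)[OF that] R(2)[OF that(1), of "z + h1 w"] by (simp add: T_def)
  have W_S: "W n z \<in> ?S z" if "z \<in> truncated_cone 3 (2 * R)" for n z
    by (induction n) (use TS[OF that] radius in auto)
  have fixp: "\<exists>!w\<in>?S z. T z w = w" if z: "z \<in> truncated_cone 3 (2 * R)" for z
  proof (rule Banach_fix[OF compact_imp_complete[OF compact_cball]])
    have "z \<in> ?S z" using radius by simp
    then show "?S z \<noteq> {}" by blast
    show "dist (T z x) (T z y) \<le> 1/4 * dist x y" if "x \<in> ?S z" "y \<in> ?S z" for x y
      using R(3)[OF z that] by (simp add: dist_norm)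
  qed (use TS[OF z] in auto)
  define \<omega>0 where "\<omega>0 = (\<lambda>z. THE w. w \<in> ?S z \<and> T z w = w)"
  have \<omega>0: "\<omega>0 z \<in> ?S z" "T z (\<omega>0 z) = \<omega>0 z" if "z \<in> truncated_cone 3 (2 * R)" for z
    using theI'[OF fixp[OF that]] unfolding \<omega>0_def by auto
  have \<omega>0_eq: "\<omega>0 z = w" if "z \<in> truncated_cone 3 (2 * R)" "w \<in> ?S z" "w = T z w" for z w
    using fixp[OF that(1)] \<omega>0[OF that(1)] that by metis
  have conv: "(\<lambda>n. W n z) \<longlonglongrightarrow> \<omega>0 z" if z: "z \<in> truncated_cone 3 (2 * R)" for z
  proof -
    have "cmod (W n z - \<omega>0 z) \<le> (1/4) ^ n * cmod (z - \<omega>0 z)" for n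
    proof (induction n)
      case (Suc n)
      have "cmod (W (Suc n) z - \<omega>0 z) = cmod (T z (W n z) - T z (\<omega>0 z))" using \<omega>0[OF z] by simp
      also have "\<dots> \<le> 1/4 * cmod (W n z - \<omega>0 z)" by (rule R(3)[OF z W_S[OF z] \<omega>0(1)[OF z]])
      also have "\<dots> \<le> 1/4 * ((1/4) ^ n * cmod (z - \<omega>0 z))" by (intro mult_left_mono Suc) auto
      finally show ?case by simp
    qed simp
    moreover have "(\<lambda>n. (1/4) ^ n * cmod (z - \<omega>0 z)) \<longlonglongrightarrow> 0"
      by (intro tendsto_mult_left_zero LIMSEQ_realpow_zero) auto
    ultimately have "(\<lambda>n. W n z - \<omega>0 z) \<longlonglongrightarrow> 0"
      by (rule Lim_null_comparison[OF always_eventually[OF allI]])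
    then show ?thesis by (simp add: LIM_zero_iff)
  qed
  have cone_sub: "truncated_cone 3 (2 * R) \<subseteq> upper_half_plane"
    using R(1) truncated_cone_upper by force
  have ne: "truncated_cone 3 (2 * R) \<noteq> {}" by (rule truncated_cone_not_empty) simp
  obtain \<omega>1 where lim: "\<omega>1 holomorphic_on upper_half_plane"
    "\<forall>z. 0 < Im z \<longrightarrow> Im z \<le> Im (\<omega>1 z)"
    "\<forall>z\<in>truncated_cone 3 (2 * R). \<omega>1 z = \<omega>0 z"
    by (rule upper_half_plane_self_map_limit[OF W_holomorphic Im_W ne cone_sub conv]) (auto intro: that)
  note \<omega>1 = lim[rule_format]
  define \<omega>2 where "\<omega>2 = (\<lambda>z. z + h1 (\<omega>1 z))"
  have \<omega>2_holo: "\<omega>2 holomorphic_on upper_half_plane"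
    unfolding \<omega>2_def by (intro holomorphic_intros holomorphic_h_compose[OF \<omega>1(1,2)])
  have Im2: "Im z \<le> Im (\<omega>2 z)" if "0 < Im z" for z
    using Im_h(1)[of "\<omega>1 z"] \<omega>1(2)[OF that] that by (simp add: \<omega>2_def)
  have eq1: "\<omega>1 z = z + h2 (\<omega>2 z)" if z: "0 < Im z" for z
  proof (rule upper_half_plane_identity[where f = \<omega>1 and g = "\<lambda>z. z + h2 (\<omega>2 z)" and S = "truncated_cone 3 (2 * R)"])
    show "(\<lambda>z. z + h2 (\<omega>2 z)) holomorphic_on upper_half_plane"
      by (intro holomorphic_intros holomorphic_h_compose[OF \<omega>2_holo Im2])
    show "\<omega>1 z = z + h2 (\<omega>2 z)" if "z \<in> truncated_cone 3 (2 * R)" for z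
      using \<omega>0(2)[OF that] \<omega>1(3)[OF that] by (simp add: \<omega>2_def T_def)
  qed (use \<omega>1 z cone_sub in \<open>auto intro: open_truncated_cone simp: truncated_cone_not_empty\<close>)
  show ?thesis
  proof (intro that[OF \<omega>1(1) \<omega>2_holo] allI impI ballI)
    show "0 < 2 * R" using R(1) by simp
    fix z assume z: "z \<in> truncated_cone 3 (2 * R)"
    show "\<omega>1 z \<in> ?S z \<and> \<omega>2 z \<in> ?S z"
      using \<omega>0(1)[OF z] \<omega>1(3)[OF z] R(2)[OF z] by (simp add: \<omega>2_def)
    show "\<omega>1 z = w" if "w \<in> ?S z" "w = T z w" for w
      using \<omega>0_eq[OF z that] \<omega>1(3)[OF z] by simp
  next
    fix z assume z: "0 < Im z"
    show "Im z \<le> Im (\<omega>1 z) \<and> Im z \<le> Im (\<omega>2 z)" using \<omega>1(2)[OF z] Im2[OF z] by blast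
    show "\<omega>1 z = z + h2 (\<omega>2 z) \<and> \<omega>2 z = z + h1 (\<omega>1 z)"
      using eq1[OF z] \<omega>2_def by blast
  qed
qed

text \<open>The function \<open>cauchy_transform \<mu> (\<omega>1 z)\<close> meets the conditions of
  \<open>pick_reciprocal\<close>, hence is the Cauchy transform of a probability measure. Since
  \<omega>1 is known exactly at the points z + \<phi> z + \<psi> z, additivity of the inverses comes
  from the same construction.\<close>

theorem free_convolution_exists:
  obtains \<rho> \<omega>1 \<omega>2 where "real_distribution \<rho>"
    "\<omega>1 holomorphic_on upper_half_plane" "\<omega>2 holomorphic_on upper_half_plane"
    "\<forall>z. 0 < Im z \<longrightarrow> Im z \<le> Im (\<omega>1 z) \<and> Im z \<le> Im (\<omega>2 z)"
    "\<forall>z. 0 < Im z \<longrightarrow> F_transform \<rho> z = F_transform \<mu> (\<omega>1 z)"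
    "\<forall>z. 0 < Im z \<longrightarrow> F_transform \<rho> z = F_transform \<nu> (\<omega>2 z)"
    "\<forall>z. 0 < Im z \<longrightarrow> \<omega>1 z + \<omega>2 z = z + F_transform \<rho> z"
    "\<forall>\<phi> \<psi> \<alpha>. asymptotic_inverse \<mu> \<phi> \<alpha> \<longrightarrow> asymptotic_inverse \<nu> \<psi> \<alpha> \<longrightarrow> \<alpha> \<le> 1 \<longrightarrow>
       asymptotic_inverse \<rho> (\<lambda>z. \<phi> z + \<psi> z) \<alpha>"
proof -
  obtain \<omega>1 \<omega>2 B where sub: "\<omega>1 holomorphic_on upper_half_plane" "\<omega>2 holomorphic_on upper_half_plane"
    "\<forall>z. 0 < Im z \<longrightarrow> Im z \<le> Im (\<omega>1 z) \<and> Im z \<le> Im (\<omega>2 z)"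
    "\<forall>z. 0 < Im z \<longrightarrow> \<omega>1 z = z + h2 (\<omega>2 z) \<and> \<omega>2 z = z + h1 (\<omega>1 z)"
    "0 < B" "\<forall>z\<in>truncated_cone 3 B.
      \<omega>1 z \<in> cball z (radius * cmod z) \<and> \<omega>2 z \<in> cball z (radius * cmod z)"
    "\<forall>z\<in>truncated_cone 3 B. \<forall>w\<in>cball z (radius * cmod z). w = T z w \<longrightarrow> \<omega>1 z = w"
    by (rule subordination) (rule that)
  note \<omega> = sub[rule_format]
  have h1\<omega>: "h1 (\<omega>1 z) = \<omega>2 z - z" if "0 < Im z" for z
    using conjunct2[OF \<omega>(4)[OF that]] by simp
  have h2\<omega>: "h2 (\<omega>2 z) = \<omega>1 z - z" if "0 < Im z" for z
    using conjunct1[OF \<omega>(4)[OF that]] by simp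
  have F1: "F_transform \<mu> (\<omega>1 z) = \<omega>1 z + \<omega>2 z - z" if "0 < Im z" for z
    using h1\<omega>[OF that] by (simp add: h1_def algebra_simps)
  have F2: "F_transform \<nu> (\<omega>2 z) = \<omega>1 z + \<omega>2 z - z" if "0 < Im z" for z
    using h2\<omega>[OF that] by (simp add: h2_def algebra_simps)
  define G where "G = (\<lambda>z. cauchy_transform \<mu> (\<omega>1 z))"
  have up: "0 < Im (\<omega>1 z)" if "0 < Im z" for z using \<omega>(3)[OF that] that by linarith
  \<comment> \<open>Along the imaginary axis F exceeds z by h1 + h2, and both terms are o(|z|). This
    is the normalisation of the total mass demanded by \<open>pick_reciprocal\<close>.\<close>
  have quot: "((\<lambda>y. F_transform \<mu> (\<omega>1 (\<i> * complex_of_real y)) / (\<i> * complex_of_real y)) \<longlongrightarrow> 1) at_top"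
  proof (rule tendstoI)
    fix e :: real assume e: "0 < e"
    then have "0 < e / 8" by simp
    then obtain R where R: "0 < R"
      "\<And>w. w \<in> truncated_cone 7 R \<Longrightarrow> cmod (h1 w) \<le> e / 8 * cmod w \<and> cmod (h2 w) \<le> e / 8 * cmod w"
      using cone_estimates by metis
    show "\<forall>\<^sub>F y in at_top. dist (F_transform \<mu> (\<omega>1 (\<i> * complex_of_real y)) / (\<i> * complex_of_real y)) 1 < e"
      using eventually_gt_at_top[of "max B (2 * R)"]
    proof eventually_elim
      case (elim y)
      define z where "z = \<i> * complex_of_real y"
      have y: "B < y" "2 * R < y" "0 < y" using elim R(1) by auto
      have z: "z \<in> truncated_cone 3 B" "z \<in> truncated_cone 3 (2 * R)" "0 < Im z"
        using y by (auto simp: z_def truncated_cone_def)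
      have near: "cmod (\<omega>1 z - z) \<le> radius * cmod z" "cmod (\<omega>2 z - z) \<le> radius * cmod z"
        using \<omega>(6)[OF z(1)] by (auto simp: dist_norm norm_minus_commute)
      have 1: "\<omega>1 z \<in> truncated_cone 7 R" "cmod (\<omega>1 z) \<le> 2 * cmod z"
        and 2: "\<omega>2 z \<in> truncated_cone 7 R" "cmod (\<omega>2 z) \<le> 2 * cmod z"
        using near_in_cone[OF less_imp_le[OF R(1)] z(2)] near by blast+
      have "cmod (h1 (\<omega>1 z)) \<le> e / 8 * (2 * cmod z)" "cmod (h2 (\<omega>2 z)) \<le> e / 8 * (2 * cmod z)"
        using R(2)[OF 1(1)] R(2)[OF 2(1)] mult_left_mono[OF 1(2), of "e / 8"]
          mult_left_mono[OF 2(2), of "e / 8"] e by linarith+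
      then have "cmod (h1 (\<omega>1 z) + h2 (\<omega>2 z)) \<le> e / 2 * cmod z"
        using norm_triangle_ineq[of "h1 (\<omega>1 z)" "h2 (\<omega>2 z)"] by simp
      moreover have "F_transform \<mu> (\<omega>1 z) = z + (h1 (\<omega>1 z) + h2 (\<omega>2 z))"
        using F1[OF z(3)] h1\<omega>[OF z(3)] h2\<omega>[OF z(3)] by simp
      moreover have "z \<noteq> 0" using z by auto
      moreover have "(z + d) / z - 1 = d / z" if "z \<noteq> 0" for d using that by (simp add: field_simps)
      ultimately have "cmod (F_transform \<mu> (\<omega>1 z) / z - 1) \<le> e / 2"
        by (simp add: norm_divide divide_le_eq)
      then show ?case using e by (simp add: z_def dist_norm)
    qed
  qed
  interpret pick_reciprocal G
  proof
    have "(cauchy_transform \<mu> \<circ> \<omega>1) holomorphic_on upper_half_plane"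
      by (rule holomorphic_on_compose_gen[OF \<omega>(1) holomorphic_cauchy_transform[OF mu.finite_borel_measure_M]])
        (auto intro: up)
    then show "G holomorphic_on upper_half_plane" by (simp add: G_def o_def)
    show "cmod (G z) \<le> 1 / Im z" if z: "0 < Im z" for z
    proof -
      have "cmod (G z) \<le> 1 / Im (\<omega>1 z)"
        unfolding G_def by (intro norm_cauchy_transform_le up z) unfold_locales
      also have "\<dots> \<le> 1 / Im z" using \<omega>(3)[OF z] z by (intro frac_le) auto
      finally show ?thesis .
    qed
    show "Im (G z) \<le> 0" if "0 < Im z" for z
      unfolding G_def using Im_cauchy_transform[OF mu.finite_borel_measure_M up[OF that]]
        mu.poisson_mass_pos[OF up[OF that]] up[OF that] by simp
    have "((\<lambda>y. Im (- \<i> / (F_transform \<mu> (\<omega>1 (\<i> * complex_of_real y)) / (\<i> * complex_of_real y)))) \<longlongrightarrow> Im (- \<i> / 1)) at_top"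
      by (intro tendsto_intros quot) auto
    moreover have "\<forall>\<^sub>F y in at_top. Im (- \<i> / (F_transform \<mu> (\<omega>1 (\<i> * complex_of_real y)) / (\<i> * complex_of_real y)))
       = y * Im (G (\<i> * complex_of_real y))"
      using eventually_gt_at_top[of 0]
    proof eventually_elim
      case (elim y)
      have "- \<i> / (F_transform \<mu> (\<omega>1 (\<i> * complex_of_real y)) / (\<i> * complex_of_real y))
        = complex_of_real y * G (\<i> * complex_of_real y)"
      proof -
        have "- \<i> / (1 / c / (\<i> * d)) = d * c" for c d :: complex
          by (simp add: complex_eq_iff)
        then show ?thesis by (simp only: G_def F_transform_def)
      qed
      then show ?case by simp
    qed
    ultimately show "((\<lambda>y. y * Im (G (\<i> * complex_of_real y))) \<longlongrightarrow> - 1) at_top"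
      by (rule Lim_transform_eventually[THEN tendsto_eq_rhs]) simp
  qed
  obtain \<rho> where \<rho>: "real_distribution \<rho>" "\<And>z. 0 < Im z \<Longrightarrow> G z = cauchy_transform \<rho> z"
    using cauchy_transform_representation by metis
  have F\<rho>: "F_transform \<rho> z = F_transform \<mu> (\<omega>1 z)" if "0 < Im z" for z
    using \<rho>(2)[OF that] by (simp add: F_transform_def G_def)
  show ?thesis
  proof (intro that[OF \<rho>(1) \<omega>(1,2)] allI impI)
    show "Im z \<le> Im (\<omega>1 z) \<and> Im z \<le> Im (\<omega>2 z)" "F_transform \<rho> z = F_transform \<mu> (\<omega>1 z)" if "0 < Im z" for z
      using \<omega>(3)[OF that] F\<rho>[OF that] by auto
    show "F_transform \<rho> z = F_transform \<nu> (\<omega>2 z)" "\<omega>1 z + \<omega>2 z = z + F_transform \<rho> z" if "0 < Im z" for z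
      using F\<rho>[OF that] F1[OF that] F2[OF that] by auto
    fix \<phi> \<psi> \<alpha>
    assume \<phi>: "asymptotic_inverse \<mu> \<phi> \<alpha>" and \<psi>: "asymptotic_inverse \<nu> \<psi> \<alpha>" and \<alpha>1: "\<alpha> \<le> 1"
    have \<alpha>: "0 < \<alpha>" using \<phi> by (simp add: asymptotic_inverse_def)
    have rad: "radius \<le> cone_radius \<alpha>" unfolding radius_def using \<alpha> \<alpha>1 by (intro cone_radius_antimono) auto
    \<comment> \<open>A third for each of \<phi> and \<psi>: their sum then stays within radius |z|,
      and since |z| \<le> 3 |u| the single term \<psi> z stays within radius |u|, which puts w into
      the ball around u.\<close>
    have rad3: "0 < radius / 3" using radius by simp
    obtain B1 where B1: "0 < B1" "\<And>z. z \<in> truncated_cone \<alpha> B1 \<Longrightarrow>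
        F_transform \<mu> (z + \<phi> z) = z \<and> cmod (\<phi> z) \<le> radius / 3 * cmod z"
      using asymptotic_inverse_small[OF mu.real_distribution_axioms \<phi> rad3] by metis
    obtain B2 where B2: "0 < B2" "\<And>z. z \<in> truncated_cone \<alpha> B2 \<Longrightarrow>
        F_transform \<nu> (z + \<psi> z) = z \<and> cmod (\<psi> z) \<le> radius / 3 * cmod z"
      using asymptotic_inverse_small[OF nu.real_distribution_axioms \<psi> rad3] by metis
    define C where "C = max (2 * B) (max B1 B2)"
    have "F_transform \<rho> (z + (\<phi> z + \<psi> z)) = z \<and> cmod (\<phi> z + \<psi> z) \<le> cone_radius \<alpha> * cmod z"
      if "z \<in> truncated_cone \<alpha> C" for z
    proof -
      have z: "z \<in> truncated_cone \<alpha> (2 * B)" "z \<in> truncated_cone \<alpha> B1" "z \<in> truncated_cone \<alpha> B2"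
        using that by (auto simp: C_def truncated_cone_def)
      note b1 = B1(2)[OF z(2)] and b2 = B2(2)[OF z(3)]
      \<comment> \<open>At u the two subordination functions ought to be w and v, because F of \<mu>
        maps w to z, F of \<nu> maps v to z, and w + v = u + z. Uniqueness of the fixed point
        confirms this for w.\<close>
      define u where "u = z + (\<phi> z + \<psi> z)"
      define w where "w = z + \<phi> z"
      define v where "v = z + \<psi> z"
      have d: "cmod (\<phi> z + \<psi> z) \<le> 2 * (radius / 3 * cmod z)"
        using b1 b2 norm_triangle_ineq[of "\<phi> z" "\<psi> z"] by linarith
      have "2 * (radius / 3 * cmod z) \<le> radius * cmod z" using radius by simp
      moreover have "radius * cmod z \<le> cone_radius \<alpha> * cmod z" using rad by (intro mult_right_mono) auto
      ultimately have le: "cmod (\<phi> z + \<psi> z) \<le> cone_radius \<alpha> * cmod z" using d by linarith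
      then have "u \<in> truncated_cone (2 * \<alpha> + 1) B"
        using truncated_cone_perturb[OF \<alpha> less_imp_le[OF \<omega>(5)] z(1), of u] by (simp add: u_def)
      then have u: "u \<in> truncated_cone 3 B"
        using truncated_cone_mono[of "2 * \<alpha> + 1" 3 B B] \<alpha>1 \<omega>(5) by auto
      have "radius * cmod z \<le> 1/4 * cmod z" using radius by (intro mult_right_mono) auto
      moreover have "cmod z - cmod (\<phi> z + \<psi> z) \<le> cmod u"
        using norm_triangle_ineq2[of z "- (\<phi> z + \<psi> z)"]
        by (simp only: u_def norm_minus_cancel diff_minus_eq_add)
      ultimately have zu: "cmod z \<le> 3 * cmod u"
        using d norm_ge_zero[of z] by linarith
      have "radius / 3 * cmod z \<le> radius * cmod u"
        using mult_left_mono[OF zu, of "radius / 3"] radius by simp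
      then have mem: "w \<in> cball u (radius * cmod u)"
        using b2 by (simp add: dist_norm u_def w_def)
      have "T u w = w"
      proof -
        have 1: "h1 w = z - w" using b1 by (simp add: h1_def w_def)
        have 2: "h2 v = z - v" using b2 by (simp add: h2_def v_def)
        have "u + h1 w = v" unfolding 1 by (simp add: u_def w_def v_def)
        then have "T u w = u + (z - v)" by (simp add: T_def 2)
        then show ?thesis by (simp add: u_def v_def w_def)
      qed
      then have "\<omega>1 u = w" using \<omega>(7)[OF u mem] by simp
      moreover have "0 < Im u" using truncated_cone_upper[OF u] \<omega>(5) by simp
      ultimately have "F_transform \<rho> u = z" using F\<rho>[of u] b1 by (simp add: w_def)
      then show ?thesis using le by (simp add: u_def)
    qed
    then show "asymptotic_inverse \<rho> (\<lambda>z. \<phi> z + \<psi> z) \<alpha>"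
      unfolding asymptotic_inverse_def using \<alpha> B1(1) by (auto intro!: exI[of _ C] simp: C_def)
  qed
qed

end

section \<open>Free convolution through subordination\<close>

definition subordination_pair ::
  "real measure \<Rightarrow> real measure \<Rightarrow> (complex \<Rightarrow> complex) \<Rightarrow> (complex \<Rightarrow> complex) \<Rightarrow> bool" where
  "subordination_pair \<mu> \<nu> \<omega>1 \<omega>2 \<longleftrightarrow>
    \<omega>1 holomorphic_on upper_half_plane \<and> \<omega>2 holomorphic_on upper_half_plane \<and>
    (\<forall>z. 0 < Im z \<longrightarrow> 0 < Im (\<omega>1 z) \<and> 0 < Im (\<omega>2 z) \<and>
      F_transform (\<mu> \<boxplus> \<nu>) z = F_transform \<mu> (\<omega>1 z) \<and>
      F_transform (\<mu> \<boxplus> \<nu>) z = F_transform \<nu> (\<omega>2 z) \<and>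
      \<omega>1 z + \<omega>2 z = z + F_transform (\<mu> \<boxplus> \<nu>) z)"

text \<open>The definite description requires uniqueness. A competitor may come with other cones and
  other branches; after shrinking to a common aperture its branches agree near infinity with the
  chosen ones, so it has the same F and is the same measure. The bound \<alpha> \<le> 1 comes from
  the apertures fixed in \<open>free_pair\<close>.\<close>

theorem free_conv_characterization:
  assumes "real_distribution \<mu>" "real_distribution \<nu>"
  shows free_conv_real_distribution: "real_distribution (\<mu> \<boxplus> \<nu>)"
    and free_conv_subordination: "\<exists>\<omega>1 \<omega>2. subordination_pair \<mu> \<nu> \<omega>1 \<omega>2"
    and asymptotic_inverse_free_conv: "\<And>\<phi> \<psi> \<alpha>. asymptotic_inverse \<mu> \<phi> \<alpha> \<Longrightarrow> asymptotic_inverse \<nu> \<psi> \<alpha> \<Longrightarrow>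
       \<alpha> \<le> 1 \<Longrightarrow> asymptotic_inverse (\<mu> \<boxplus> \<nu>) (\<lambda>z. \<phi> z + \<psi> z) \<alpha>"
proof -
  interpret free_pair \<mu> \<nu> using assms by (simp add: free_pair_def)
  obtain \<rho> \<omega>1 \<omega>2 where sub: "real_distribution \<rho>"
    "\<omega>1 holomorphic_on upper_half_plane" "\<omega>2 holomorphic_on upper_half_plane"
    "\<forall>z. 0 < Im z \<longrightarrow> Im z \<le> Im (\<omega>1 z) \<and> Im z \<le> Im (\<omega>2 z)"
    "\<forall>z. 0 < Im z \<longrightarrow> F_transform \<rho> z = F_transform \<mu> (\<omega>1 z)"
    "\<forall>z. 0 < Im z \<longrightarrow> F_transform \<rho> z = F_transform \<nu> (\<omega>2 z)"
    "\<forall>z. 0 < Im z \<longrightarrow> \<omega>1 z + \<omega>2 z = z + F_transform \<rho> z"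
    and add': "\<forall>\<phi> \<psi> \<alpha>. asymptotic_inverse \<mu> \<phi> \<alpha> \<longrightarrow> asymptotic_inverse \<nu> \<psi> \<alpha> \<longrightarrow> \<alpha> \<le> 1 \<longrightarrow>
       asymptotic_inverse \<rho> (\<lambda>z. \<phi> z + \<psi> z) \<alpha>"
    by (rule free_convolution_exists) (rule that)
  note * = sub[rule_format] and add = add'[rule_format]
  interpret rho: real_distribution \<rho> by fact
  obtain \<phi>1 where \<phi>1: "asymptotic_inverse \<mu> \<phi>1 1" using mu.asymptotic_inverse_exists[of 1] by auto
  obtain \<phi>2 where \<phi>2: "asymptotic_inverse \<nu> \<phi>2 1" using nu.asymptotic_inverse_exists[of 1] by auto
  note \<rho>12 = add[OF \<phi>1 \<phi>2 order_refl]
  have eq: "\<mu> \<boxplus> \<nu> = \<rho>"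
    unfolding free_conv_def
  proof (rule the_equality, intro conjI)
    obtain B1 where B1: "\<And>\<beta>. B1 \<le> \<beta> \<Longrightarrow> voiculescu_transform_on \<mu> \<phi>1 1 \<beta>"
      using mu.asymptotic_inverse_imp_voiculescu_transform_on[OF \<phi>1] by metis
    obtain B2 where B2: "\<And>\<beta>. B2 \<le> \<beta> \<Longrightarrow> voiculescu_transform_on \<nu> \<phi>2 1 \<beta>"
      using nu.asymptotic_inverse_imp_voiculescu_transform_on[OF \<phi>2] by metis
    obtain B3 where B3: "\<And>\<beta>. B3 \<le> \<beta> \<Longrightarrow> voiculescu_transform_on \<rho> (\<lambda>z. \<phi>1 z + \<phi>2 z) 1 \<beta>"
      using rho.asymptotic_inverse_imp_voiculescu_transform_on[OF \<rho>12] by metis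
    show "\<exists>\<alpha> \<beta> \<phi> \<psi>. voiculescu_transform_on \<mu> \<phi> \<alpha> \<beta> \<and> voiculescu_transform_on \<nu> \<psi> \<alpha> \<beta> \<and>
        voiculescu_transform_on \<rho> (\<lambda>z. \<phi> z + \<psi> z) \<alpha> \<beta>"
    proof (intro exI conjI)
      show "voiculescu_transform_on \<mu> \<phi>1 1 (max B1 (max B2 B3))" by (rule B1) simp
      show "voiculescu_transform_on \<nu> \<phi>2 1 (max B1 (max B2 B3))" by (rule B2) simp
      show "voiculescu_transform_on \<rho> (\<lambda>z. \<phi>1 z + \<phi>2 z) 1 (max B1 (max B2 B3))" by (rule B3) simp
    qed
    show "real_distribution \<rho>" by fact
    fix \<rho>'
    assume "real_distribution \<rho>' \<and> (\<exists>\<alpha> \<beta> \<phi> \<psi>. voiculescu_transform_on \<mu> \<phi> \<alpha> \<beta> \<and>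
      voiculescu_transform_on \<nu> \<psi> \<alpha> \<beta> \<and> voiculescu_transform_on \<rho>' (\<lambda>z. \<phi> z + \<psi> z) \<alpha> \<beta>)"
    then obtain \<alpha> \<beta> \<phi> \<psi> where \<rho>': "real_distribution \<rho>'"
      and v: "voiculescu_transform_on \<mu> \<phi> \<alpha> \<beta>" "voiculescu_transform_on \<nu> \<psi> \<alpha> \<beta>"
        "voiculescu_transform_on \<rho>' (\<lambda>z. \<phi> z + \<psi> z) \<alpha> \<beta>" by blast
    interpret rho': real_distribution \<rho>' by fact
    define a where "a = min \<alpha> 1"
    have a: "0 < a" "a \<le> \<alpha>" "a \<le> 1" using v(1) by (auto simp: a_def voiculescu_transform_on_def)
    note i = mu.voiculescu_transform_on_imp_asymptotic_inverse[OF v(1), THEN asymptotic_inverse_mono[OF _ a(1,2)]]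
      nu.voiculescu_transform_on_imp_asymptotic_inverse[OF v(2), THEN asymptotic_inverse_mono[OF _ a(1,2)]]
      rho'.voiculescu_transform_on_imp_asymptotic_inverse[OF v(3), THEN asymptotic_inverse_mono[OF _ a(1,2)]]
    note j = asymptotic_inverse_mono[OF \<phi>1 a(1,3)] asymptotic_inverse_mono[OF \<phi>2 a(1,3)]
      asymptotic_inverse_mono[OF \<rho>12 a(1,3)]
    obtain C1 where C1: "\<And>z. z \<in> truncated_cone a C1 \<Longrightarrow> \<phi> z = \<phi>1 z"
      using mu.asymptotic_inverse_unique[OF i(1) j(1)] by metis
    obtain C2 where C2: "\<And>z. z \<in> truncated_cone a C2 \<Longrightarrow> \<psi> z = \<phi>2 z"
      using nu.asymptotic_inverse_unique[OF i(2) j(2)] by metis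
    have "asymptotic_inverse \<rho>' (\<lambda>z. \<phi>1 z + \<phi>2 z) a"
    proof (rule asymptotic_inverse_cong[OF i(3), where C = "max C1 C2"])
      fix z assume "z \<in> truncated_cone a (max C1 C2)"
      then have "z \<in> truncated_cone a C1" "z \<in> truncated_cone a C2" by (auto simp: truncated_cone_def)
      then show "\<phi>1 z + \<phi>2 z = \<phi> z + \<psi> z" using C1 C2 by simp
    qed
    from F_transform_eqI[OF \<rho>' *(1) this j(3)]
    have "cauchy_transform \<rho>' z = cauchy_transform \<rho> z" if "0 < Im z" for z
      using that by (simp add: rho'.cauchy_transform_eq_inverse_F rho.cauchy_transform_eq_inverse_F)
    then show "\<rho>' = \<rho>" by (rule cauchy_transform_inj[OF \<rho>' *(1)])
  qed
  show "real_distribution (\<mu> \<boxplus> \<nu>)" unfolding eq by fact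
  show "asymptotic_inverse (\<mu> \<boxplus> \<nu>) (\<lambda>z. \<phi> z + \<psi> z) \<alpha>"
    if "asymptotic_inverse \<mu> \<phi> \<alpha>" "asymptotic_inverse \<nu> \<psi> \<alpha>" "\<alpha> \<le> 1" for \<phi> \<psi> \<alpha>
    unfolding eq using add that by blast
  have "subordination_pair \<mu> \<nu> \<omega>1 \<omega>2"
    unfolding subordination_pair_def eq
  proof (intro conjI allI impI)
    show "\<omega>1 holomorphic_on upper_half_plane" "\<omega>2 holomorphic_on upper_half_plane" by fact+
    fix z assume z: "0 < Im z"
    show "0 < Im (\<omega>1 z)" "0 < Im (\<omega>2 z)" using *(4)[OF z] z by auto
    show "F_transform \<rho> z = F_transform \<mu> (\<omega>1 z)" "F_transform \<rho> z = F_transform \<nu> (\<omega>2 z)"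
      "\<omega>1 z + \<omega>2 z = z + F_transform \<rho> z" using *(5-7)[OF z] by auto
  qed
  then show "\<exists>\<omega>1 \<omega>2. subordination_pair \<mu> \<nu> \<omega>1 \<omega>2" by blast
qed

section \<open>The semigroup at real times\<close>

lemma poisson_mass_le:
  assumes "real_distribution \<mu>" "0 < Im z"
  shows "poisson_mass \<mu> z \<le> 1 / (Im z)\<^sup>2"
proof -
  interpret real_distribution \<mu> by fact
  have "Im z * poisson_mass \<mu> z = - Im (cauchy_transform \<mu> z)"
    using Im_cauchy_transform[OF finite_borel_measure_M assms(2)] by simp
  also have "\<dots> \<le> 1 / Im z"
    using norm_cauchy_transform_le[OF assms] abs_Im_le_cmod[of "cauchy_transform \<mu> z"] by linarith
  finally show ?thesis using assms(2) by (simp add: field_simps power2_eq_square)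
qed

text \<open>The Lipschitz constant is the same for all probability measures, so that the measure and
  the point of evaluation may vary together in a limit.\<close>

lemma norm_cauchy_transform_diff_le:
  assumes "real_distribution \<mu>" "0 < c" "c \<le> Im u" "c \<le> Im v"
  shows "cmod (cauchy_transform \<mu> u - cauchy_transform \<mu> v) \<le> cmod (u - v) / c\<^sup>2"
proof -
  interpret real_distribution \<mu> by fact
  have Im: "0 < Im u" "0 < Im v" using assms by auto
  have le: "poisson_mass \<mu> w \<le> 1 / c\<^sup>2" if "c \<le> Im w" for w
  proof -
    have "1 / (Im w)\<^sup>2 \<le> 1 / c\<^sup>2"
      using that assms(2) by (intro divide_left_mono power_mono mult_pos_pos zero_less_power) auto
    then show ?thesis using poisson_mass_le[OF assms(1), of w] that assms(2) by linarith
  qed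
  have "cmod (kernel_form \<mu> (\<lambda>_. 1) u v) \<le> sqrt (poisson_mass \<mu> u * poisson_mass \<mu> v)"
    by (rule weighted_measure.norm_kernel_form_le[OF kernel_weight Im])
  also have "\<dots> \<le> sqrt (1 / c\<^sup>2 * (1 / c\<^sup>2))"
    using le[OF assms(3)] le[OF assms(4)] weighted_measure.kernel_norm_nonneg[OF kernel_weight]
    by (intro real_sqrt_le_mono mult_mono) auto
  also have "\<dots> = 1 / c\<^sup>2" by (simp add: real_sqrt_mult_self real_sqrt_mult abs_mult_self flip: power2_eq_square)
  finally have *: "cmod (kernel_form \<mu> (\<lambda>_. 1) u v) \<le> 1 / c\<^sup>2" .
  show ?thesis
    unfolding cauchy_transform_diff[OF finite_borel_measure_M Im]
    using mult_left_mono[OF *, of "cmod (u - v)"] by (simp add: norm_mult norm_minus_commute)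
qed

lemma real_distribution_return: "real_distribution (return borel (x::real))"
  unfolding real_distribution_def real_distribution_axioms_def
  by (auto intro: prob_space_return)

lemma cauchy_transform_return: "cauchy_transform (return borel x) z = 1 / (z - complex_of_real x)"
  unfolding cauchy_transform_def by (subst integral_return) auto

lemma F_transform_return: "F_transform (return borel x) z = z - complex_of_real x"
  by (simp add: F_transform_def cauchy_transform_return)

text \<open>The Levy-Hincin formula is assumed at time 1 only, and all other times are derived from
  it. The bound on \<alpha> is the range in which asymptotic inverses are known to add.\<close>

locale levy_semigroup =
  fixes \<mu> :: "real \<Rightarrow> real measure" and \<sigma> :: "real measure" and \<gamma> \<alpha> :: real
  assumes semigroup: "free_semigroup \<mu>"
    and \<sigma>: "finite_borel_measure \<sigma>"
    and \<alpha>_le_1: "\<alpha> \<le> 1"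
    and levy: "asymptotic_inverse (\<mu> 1) (\<lambda>z. complex_of_real \<gamma> + levy_integral \<sigma> z) \<alpha>"
begin

definition \<Phi> :: "complex \<Rightarrow> complex" where
  "\<Phi> z = complex_of_real \<gamma> + levy_integral \<sigma> z"

lemma \<Phi>_holomorphic: "\<Phi> holomorphic_on upper_half_plane"
  unfolding \<Phi>_def by (intro holomorphic_intros holomorphic_levy_integral \<sigma>)

lemma Im_\<Phi>: "0 < Im z \<Longrightarrow> Im (\<Phi> z) = - Im z * levy_mass \<sigma> z"
  by (simp add: \<Phi>_def Im_levy_integral[OF \<sigma>])

lemma norm_\<Phi>_diff_le:
  "0 < Im u \<Longrightarrow> 0 < Im v \<Longrightarrow> cmod (\<Phi> u - \<Phi> v) \<le> cmod (u - v) * sqrt (levy_mass \<sigma> u * levy_mass \<sigma> v)"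
  using norm_levy_integral_diff_le[OF \<sigma>] by (simp add: \<Phi>_def)

lemma levy_mass_nonneg: "0 \<le> levy_mass \<sigma> z"
  by (rule weighted_measure.kernel_norm_nonneg[OF weighted_measure_square[OF \<sigma>]])

lemma mu_distribution: "0 \<le> t \<Longrightarrow> real_distribution (\<mu> t)"
  using semigroup by (simp add: free_semigroup_def)

lemma mu_add: "0 \<le> s \<Longrightarrow> 0 \<le> t \<Longrightarrow> \<mu> (t + s) = \<mu> t \<boxplus> \<mu> s"
  using semigroup by (simp add: free_semigroup_def)

lemma \<alpha>_pos: "0 < \<alpha>"
  using levy by (simp add: asymptotic_inverse_def)

lemma multiple:
  assumes "0 \<le> s" "asymptotic_inverse (\<mu> s) \<phi> \<alpha>"
  shows "asymptotic_inverse (\<mu> (real (Suc k) * s)) (\<lambda>z. of_nat (Suc k) * \<phi> z) \<alpha>"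
proof (induction k)
  case 0
  then show ?case using assms by simp
next
  case (Suc k)
  have eq: "\<mu> (real (Suc (Suc k)) * s) = \<mu> (real (Suc k) * s) \<boxplus> \<mu> s"
    using mu_add[OF assms(1), of "real (Suc k) * s"] assms(1) by (simp add: algebra_simps)
  have "asymptotic_inverse (\<mu> (real (Suc k) * s) \<boxplus> \<mu> s) (\<lambda>z. of_nat (Suc k) * \<phi> z + \<phi> z) \<alpha>"
    by (rule asymptotic_inverse_free_conv[OF mu_distribution mu_distribution Suc assms(2) \<alpha>_le_1]) (use assms in auto)
  then show ?case unfolding eq by (simp add: algebra_simps)
qed

text \<open>Both q + 1 times the inverse at time 1 / (q + 1) and \<Phi> are asymptotic inverses at
  time 1, so uniqueness near infinity determines the former; p + 1 copies of it are then
  added.\<close>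

lemma rational_inverse:
  "asymptotic_inverse (\<mu> (real (Suc p) / real (Suc q))) (\<lambda>z. complex_of_real (real (Suc p) / real (Suc q)) * \<Phi> z) \<alpha>"
proof -
  define s where "s = 1 / real (Suc q)"
  have s: "0 \<le> s" "real (Suc q) * s = 1" by (auto simp: s_def simp del: of_nat_Suc)
  interpret s: real_distribution "\<mu> s" by (rule mu_distribution[OF s(1)])
  interpret one: real_distribution "\<mu> 1" by (rule mu_distribution) simp
  obtain \<phi> where \<phi>: "asymptotic_inverse (\<mu> s) \<phi> \<alpha>" using s.asymptotic_inverse_exists[OF \<alpha>_pos] by blast
  have "asymptotic_inverse (\<mu> 1) (\<lambda>z. of_nat (Suc q) * \<phi> z) \<alpha>"
    using multiple[OF s(1) \<phi>, of q] unfolding s(2) .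
  moreover have "asymptotic_inverse (\<mu> 1) \<Phi> \<alpha>" using levy by (simp add: \<Phi>_def[abs_def])
  ultimately obtain B where B: "\<And>z. z \<in> truncated_cone \<alpha> B \<Longrightarrow> of_nat (Suc q) * \<phi> z = \<Phi> z"
    using one.asymptotic_inverse_unique by metis
  have "asymptotic_inverse (\<mu> s) (\<lambda>z. complex_of_real s * \<Phi> z) \<alpha>"
  proof (rule asymptotic_inverse_cong[OF \<phi>])
    fix z assume "z \<in> truncated_cone \<alpha> B"
    from B[OF this] show "complex_of_real s * \<Phi> z = \<phi> z"
      by (simp add: s_def field_simps flip: of_nat_Suc del: of_nat_Suc)
  qed
  from multiple[OF s(1) this, of p]
  show ?thesis by (simp add: s_def field_simps)
qed

lemma rational_identity:
  assumes "q \<in> \<rat>" "0 < q" "0 < Im z"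
  shows "F_transform (\<mu> q) z + complex_of_real q * \<Phi> (F_transform (\<mu> q) z) = z"
proof -
  obtain m n :: nat where mn: "n \<noteq> 0" "\<bar>q\<bar> = real m / real n"
    using Rats_abs_nat_div_natE[OF assms(1)] by metis
  have "m \<noteq> 0" using mn assms(2) by (cases "m = 0") auto
  then obtain p r where "m = Suc p" "n = Suc r" using mn(1) by (metis not0_implies_Suc)
  then have q: "q = real (Suc p) / real (Suc r)" using mn(2) assms(2) by simp
  interpret real_distribution "\<mu> q" by (rule mu_distribution) (use assms in simp)
  show ?thesis
    by (rule global_left_inverse[OF rational_inverse[of p r, folded q] _ assms(3)])
      (intro holomorphic_intros \<Phi>_holomorphic)
qed

text \<open>
  Rational times approximate \<open>t\<close> from below, and the subordination function into the remaining small
  time converges to \<open>z - t \<Phi> u\<close> because \<open>\<mu> (t - q n)\<close> tends to the point mass at \<open>0\<close>.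
\<close>

theorem F_transform_identity:
  assumes t: "0 < t" and z: "0 < Im z"
  shows "F_transform (\<mu> t) z + complex_of_real t * \<Phi> (F_transform (\<mu> t) z) = z"
proof -
  define u where "u = F_transform (\<mu> t) z"
  interpret t: real_distribution "\<mu> t" by (rule mu_distribution) (use t in simp)
  have u: "0 < Im u" unfolding u_def by (rule t.Im_F_transform_pos[OF z])
  have "\<exists>q\<in>\<rat>. max 0 (t - 1 / real (Suc n)) < q \<and> q < t" for n
    using Rats_dense_in_real[of "max 0 (t - 1 / real (Suc n))" t] t by auto
  then obtain q where q: "\<And>n. q n \<in> \<rat>" "\<And>n. max 0 (t - 1 / real (Suc n)) < q n" "\<And>n. q n < t"
    by metis
  have q': "0 < q n" "t - 1 / real (Suc n) < q n" for n using q(2)[of n] by auto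
  have lim: "q \<longlonglongrightarrow> t"
  proof (rule tendsto_sandwich[of "\<lambda>n. t - 1 / real (Suc n)" q _ "\<lambda>_. t"])
    show "(\<lambda>n. t - 1 / real (Suc n)) \<longlonglongrightarrow> t" by real_asymp
  qed (use q q' in \<open>auto intro!: always_eventually less_imp_le\<close>)
  define b where "b = (\<lambda>n. z - complex_of_real (q n) * \<Phi> u)"
  define b0 where "b0 = z - complex_of_real t * \<Phi> u"
  have b_lim: "b \<longlonglongrightarrow> b0" unfolding b_def b0_def by (intro tendsto_intros lim)
  have Im_b: "Im z \<le> Im (b n)" for n
    using q'(1)[of n] u levy_mass_nonneg[of u] by (simp add: b_def Im_\<Phi>[OF u])
  have Im_b0: "Im z \<le> Im b0"
    using t u levy_mass_nonneg[of u] by (simp add: b0_def Im_\<Phi>[OF u])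
  \<comment> \<open>Split the time t at q n. By the identity at the rational time, the first
    subordination function has the value u + q n \<Phi> u at z, so the second one has the value
    \<open>b n\<close>. Here u does not depend on n, which makes the limit possible.\<close>
  have G_b: "cauchy_transform (\<mu> (t - q n)) (b n) = 1 / u" for n
  proof -
    have d: "real_distribution (\<mu> (q n))" "real_distribution (\<mu> (t - q n))"
      using q'(1)[of n] q(3)[of n] by (auto intro!: mu_distribution)
    have eq: "\<mu> t = \<mu> (q n) \<boxplus> \<mu> (t - q n)"
      using mu_add[of "t - q n" "q n"] q'(1)[of n] q(3)[of n] by simp
    have u_eq: "u = F_transform (\<mu> (q n) \<boxplus> \<mu> (t - q n)) z" by (simp only: u_def eq[symmetric])
    obtain \<omega>1 \<omega>2 where s: "subordination_pair (\<mu> (q n)) (\<mu> (t - q n)) \<omega>1 \<omega>2"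
      using free_conv_subordination[OF d] by blast
    note s[unfolded subordination_pair_def, THEN conjunct2, THEN conjunct2, rule_format, OF z, folded u_eq]
    then have \<omega>: "0 < Im (\<omega>1 z)" "u = F_transform (\<mu> (q n)) (\<omega>1 z)"
      "u = F_transform (\<mu> (t - q n)) (\<omega>2 z)" "\<omega>1 z + \<omega>2 z = z + u"
      by blast+
    have 1: "u + complex_of_real (q n) * \<Phi> u = \<omega>1 z"
      using rational_identity[OF q(1) q'(1) \<omega>(1), of n] unfolding \<omega>(2)[symmetric] .
    have "\<omega>2 z = z + u - \<omega>1 z" using \<omega>(4) by (simp only: eq_diff_eq add.commute)
    then have "\<omega>2 z = b n" by (simp add: b_def 1[symmetric])
    then show ?thesis using \<omega>(3) by (simp add: F_transform_def)
  qed
  have "filterlim (\<lambda>n. t - q n) (at_right 0) sequentially"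
    unfolding filterlim_at
    using tendsto_diff[OF tendsto_const[of t] lim] q(3) by (auto intro!: always_eventually)
  then have wc: "weak_conv_m (\<lambda>n. \<mu> (t - q n)) (return borel 0)"
    using semigroup by (simp add: free_semigroup_def)
  have d: "real_distribution (\<mu> (t - q n))" for n using q(3)[of n] by (intro mu_distribution) simp
  have "(\<lambda>n. cauchy_transform (\<mu> (t - q n)) b0) \<longlonglongrightarrow> cauchy_transform (return borel 0) b0"
    by (rule weak_conv_cauchy_transform[OF d real_distribution_return wc]) (use Im_b0 z in simp)
  moreover have "(\<lambda>n. cauchy_transform (\<mu> (t - q n)) (b n) - cauchy_transform (\<mu> (t - q n)) b0) \<longlonglongrightarrow> 0"
  proof (rule Lim_null_comparison)
    show "\<forall>\<^sub>F n in sequentially. norm (cauchy_transform (\<mu> (t - q n)) (b n) - cauchy_transform (\<mu> (t - q n)) b0)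
        \<le> cmod (b n - b0) / (Im z)\<^sup>2"
      by (intro always_eventually allI norm_cauchy_transform_diff_le d z Im_b Im_b0)
    show "(\<lambda>n. cmod (b n - b0) / (Im z)\<^sup>2) \<longlonglongrightarrow> 0"
      using z by (auto intro!: tendsto_eq_intros b_lim)
  qed
  ultimately have "(\<lambda>n. 1 / u) \<longlonglongrightarrow> 0 + 1 / b0"
    unfolding G_b using tendsto_add[of "\<lambda>n. 1 / u - cauchy_transform (\<mu> (t - q n)) b0" 0 sequentially
        "\<lambda>n. cauchy_transform (\<mu> (t - q n)) b0" "1 / b0"]
    by (simp add: cauchy_transform_return)
  then have "1 / u = 1 / b0" using LIMSEQ_unique[OF tendsto_const] by fastforce
  moreover have "u \<noteq> 0" "b0 \<noteq> 0" using u Im_b0 z by auto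
  ultimately have "u = b0" by (simp add: field_simps)
  then show ?thesis by (simp add: b0_def u_def algebra_simps)
qed

end

lemma levy_semigroup_exists:
  assumes "free_semigroup \<mu>" "free_levy_measure (\<mu> 1) \<sigma>"
  obtains \<gamma> \<alpha> where "levy_semigroup \<mu> \<sigma> \<gamma> \<alpha>"
proof -
  have d: "real_distribution (\<mu> 1)" using assms(1) by (simp add: free_semigroup_def)
  obtain \<gamma> \<alpha> \<beta> where v: "voiculescu_transform_on (\<mu> 1)
      (\<lambda>z. complex_of_real \<gamma> + levy_integral \<sigma> z) \<alpha> \<beta>" and \<sigma>: "finite_borel_measure \<sigma>"
    using assms(2) by (auto simp: free_levy_measure_def levy_integral_def)
  have \<alpha>: "0 < \<alpha>" using v by (simp add: voiculescu_transform_on_def)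
  have "asymptotic_inverse (\<mu> 1) (\<lambda>z. complex_of_real \<gamma> + levy_integral \<sigma> z) (min \<alpha> 1)"
    using real_distribution.voiculescu_transform_on_imp_asymptotic_inverse[OF d v]
    by (rule asymptotic_inverse_mono) (use \<alpha> in auto)
  then have "levy_semigroup \<mu> \<sigma> \<gamma> (min \<alpha> 1)"
    using assms(1) \<sigma> by (simp add: levy_semigroup_def)
  then show ?thesis using that by blast
qed

section \<open>Densities and boundary values\<close>

text \<open>For real increments the imaginary part can be taken coefficient by coefficient, and the
  resulting real series converges at least where the complex one does.\<close>

lemma real_has_fps_expansion_Im:
  assumes "E analytic_on {complex_of_real x}"
    and f: "\<forall>\<^sub>F h in nhds 0. f (x + h) = - Im (E (complex_of_real (x + h))) / pi"
  shows "\<exists>A. (\<lambda>h::real. f (x + h)) has_fps_expansion A"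
proof -
  define A where "A = fps_expansion E (complex_of_real x)"
  have A: "fps_conv_radius A > 0" "\<forall>\<^sub>F h in nhds 0. eval_fps A h = E (complex_of_real x + h)"
    using analytic_at_imp_has_fps_expansion[OF assms(1)] by (auto simp: has_fps_expansion_def A_def)
  define B :: "real fps" where "B = Abs_fps (\<lambda>n. - Im (fps_nth A n) / pi)"
  have sums: "(\<lambda>n. fps_nth B n * h ^ n) sums (- Im (eval_fps A (complex_of_real h)) / pi)"
    if "norm h < fps_conv_radius A" for h
  proof -
    have "(\<lambda>n. fps_nth A n * complex_of_real h ^ n) sums eval_fps A (complex_of_real h)"
      by (rule sums_eval_fps) (use that in simp)
    then have "(\<lambda>n. Im (fps_nth A n * complex_of_real h ^ n)) sums Im (eval_fps A (complex_of_real h))"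
      by (rule sums_Im)
    then have "(\<lambda>n. - (Im (fps_nth A n * complex_of_real h ^ n) / pi)) sums - (Im (eval_fps A (complex_of_real h)) / pi)"
      by (intro sums_minus sums_divide)
    moreover have "Im (fps_nth A n * complex_of_real h ^ n) = Im (fps_nth A n) * h ^ n" for n
      by (simp flip: of_real_power)
    ultimately show ?thesis by (simp add: B_def)
  qed
  have radius: "fps_conv_radius B \<ge> fps_conv_radius A"
    unfolding fps_conv_radius_def
  proof (rule conv_radius_geI_ex')
    fix r assume r: "0 < r" "ereal r < conv_radius (fps_nth A)"
    then show "summable (\<lambda>n. fps_nth B n * of_real r ^ n)"
      using sums[of r] by (auto simp: sums_iff fps_conv_radius_def)
  qed
  have "\<forall>\<^sub>F h in nhds (0::real). norm h < fps_conv_radius A"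
  proof -
    obtain r where r: "0 < ereal r" "ereal r < fps_conv_radius A" using ereal_dense2[OF A(1)] by auto
    have "\<forall>\<^sub>F h in nhds (0::real). h \<in> ball 0 r" using r by (intro eventually_nhds_in_open) auto
    then show ?thesis by eventually_elim (use r in \<open>auto simp: less_trans[of _ "ereal r"]\<close>)
  qed
  moreover have "\<forall>\<^sub>F h in nhds 0. eval_fps A (complex_of_real h) = E (complex_of_real x + complex_of_real h)"
    by (rule eventually_compose_filterlim[OF A(2)])
      (auto intro!: tendsto_eq_intros filterlim_ident)
  ultimately have "\<forall>\<^sub>F h in nhds 0. eval_fps B h = f (x + h)"
    using f
  proof eventually_elim
    case (elim h)
    have "eval_fps B h = - Im (eval_fps A (complex_of_real h)) / pi"
      using sums[OF elim(1)] by (simp add: eval_fps_def sums_iff)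
    then show ?case using elim by simp
  qed
  moreover have "fps_conv_radius B > 0" using radius A(1) by simp
  ultimately show ?thesis unfolding has_fps_expansion_def by blast
qed

context real_distribution
begin

text \<open>At a real point all local extensions share one value, the vertical limit of the Cauchy
  transform. They therefore glue to a continuous function on the closed half-plane, whose boundary
  values give the density.\<close>

theorem positive_analytic_densityI:
  assumes ext: "\<And>x::real. \<exists>V E. open V \<and> complex_of_real x \<in> V \<and> E holomorphic_on V \<and>
      (\<forall>z\<in>V. 0 < Im z \<longrightarrow> E z = cauchy_transform M z) \<and> Im (E (complex_of_real x)) < 0"
  shows "\<exists>f. (\<forall>x. 0 < f x) \<and> real_analytic f \<and> M = density lborel (\<lambda>x. ennreal (f x))"
proof -
  obtain V E where VE: "\<And>x. open (V x)" "\<And>x. complex_of_real x \<in> V x" "\<And>x. E x holomorphic_on V x"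
    "\<And>x z. z \<in> V x \<Longrightarrow> 0 < Im z \<Longrightarrow> E x z = cauchy_transform M z"
    "\<And>x. Im (E x (complex_of_real x)) < 0"
    using ext by metis
  define H where "H = (\<lambda>z. if 0 < Im z then cauchy_transform M z else E (Re z) z)"
  have real: "E y (complex_of_real y) = E x (complex_of_real y)" if y: "complex_of_real y \<in> V x" for x y
  proof -
    let ?s = "\<lambda>n. complex_of_real y + \<i> * complex_of_real (1 / real (Suc n))"
    have "?s \<longlonglongrightarrow> complex_of_real y + \<i> * complex_of_real 0"
      by (intro tendsto_intros) real_asymp
    then have s: "?s \<longlonglongrightarrow> complex_of_real y" by simp
    have conv: "(\<lambda>n. cauchy_transform M (?s n)) \<longlonglongrightarrow> E x (complex_of_real y)"
      if y: "complex_of_real y \<in> V x" for x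
    proof (rule Lim_transform_eventually)
      have "isCont (E x) (complex_of_real y)"
        using holomorphic_on_imp_continuous_on[OF VE(3)] y VE(1) by (simp add: continuous_on_eq_continuous_at)
      then show "(\<lambda>n. E x (?s n)) \<longlonglongrightarrow> E x (complex_of_real y)" by (rule isCont_tendsto_compose[OF _ s])
      have "\<forall>\<^sub>F n in sequentially. ?s n \<in> V x"
        using s VE(1) y by (rule topological_tendstoD)
      then show "\<forall>\<^sub>F n in sequentially. E x (?s n) = cauchy_transform M (?s n)"
        by eventually_elim (rule VE(4), auto)
    qed
    show ?thesis by (rule LIMSEQ_unique[OF conv[OF VE(2)] conv[OF y]])
  qed
  have H_eq: "H z = E x z" if "z \<in> V x" "0 \<le> Im z" for x z
  proof (cases "0 < Im z")
    case True
    then show ?thesis using VE(4)[OF that(1)] by (simp add: H_def)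
  next
    case False
    then have "z = complex_of_real (Re z)" using that by (simp add: complex_eq_iff)
    then show ?thesis using real[of "Re z" x] that False by (simp add: H_def)
  qed
  have "continuous_on {z. 0 \<le> Im z} H"
    unfolding continuous_on_def
  proof
    fix z assume "z \<in> {z. 0 \<le> Im z}"
    then consider "0 < Im z" | "Im z = 0" by fastforce
    then show "(H \<longlongrightarrow> H z) (at z within {z. 0 \<le> Im z})"
    proof cases
      case 1
      have "isCont (cauchy_transform M) z"
        using holomorphic_on_imp_continuous_on[OF holomorphic_cauchy_transform[OF finite_borel_measure_M]] 1 open_upper_half_plane
        by (simp add: continuous_on_eq_continuous_at)
      then have "(cauchy_transform M \<longlongrightarrow> H z) (at z within {z. 0 \<le> Im z})"
        using 1 by (auto simp: H_def isCont_def intro: tendsto_within_subset)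
      moreover have "\<forall>\<^sub>F w in at z within {z. 0 \<le> Im z}. cauchy_transform M w = H w"
        using eventually_nhds_in_open[OF open_upper_half_plane, of z] 1
        by (auto simp: eventually_at_filter H_def elim: eventually_mono)
      ultimately show ?thesis by (rule Lim_transform_eventually)
    next
      case 2
      then have z: "z = complex_of_real (Re z)" by (simp add: complex_eq_iff)
      define x where "x = Re z"
      have zV: "z \<in> V x" using VE(2)[of x] z by (simp add: x_def)
      have "isCont (E x) z"
        using holomorphic_on_imp_continuous_on[OF VE(3)] zV VE(1) by (simp add: continuous_on_eq_continuous_at)
      then have "(E x \<longlongrightarrow> H z) (at z within {z. 0 \<le> Im z})"
        using 2 zV by (auto simp: H_eq isCont_def intro: tendsto_within_subset)
      moreover have "\<forall>\<^sub>F w in at z within {z. 0 \<le> Im z}. E x w = H w"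
        using eventually_nhds_in_open[OF VE(1) zV]
        by (auto simp: eventually_at_filter H_eq elim: eventually_mono)
      ultimately show ?thesis by (rule Lim_transform_eventually)
    qed
  qed
  then have dens: "M = density lborel (\<lambda>x. ennreal (- Im (H (complex_of_real x)) / pi))"
    by (rule eq_density_boundary_values) (simp add: H_def)
  define f where "f = (\<lambda>x. - Im (H (complex_of_real x)) / pi)"
  have "0 < f x" for x
    unfolding f_def using VE(5)[of x] H_eq[OF VE(2)] by (intro divide_pos_pos) auto
  moreover have "real_analytic f"
    unfolding real_analytic_def
  proof
    fix x
    show "\<exists>A. (\<lambda>h. f (x + h)) has_fps_expansion A"
    proof (rule real_has_fps_expansion_Im)
      show "E x analytic_on {complex_of_real x}"
        using VE(1-3) by (auto simp: analytic_at)
      have "\<forall>\<^sub>F h in nhds 0. complex_of_real (x + h) \<in> V x"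
      proof -
        have "((\<lambda>h. complex_of_real (x + h)) \<longlongrightarrow> complex_of_real (x + 0)) (nhds 0)"
          by (intro tendsto_intros filterlim_ident)
        then show ?thesis using VE(1,2) by (auto dest: topological_tendstoD)
      qed
      then show "\<forall>\<^sub>F h in nhds 0. f (x + h) = - Im (E x (complex_of_real (x + h))) / pi"
        by eventually_elim (simp add: f_def H_eq)
    qed
  qed
  moreover have "M = density lborel (\<lambda>x. ennreal (f x))" using dens unfolding f_def .
  ultimately show ?thesis by blast
qed

text \<open>Made for contradictions: near a real point the imaginary part can neither vanish nor
  explode, and this holds for every approach, not only a vertical one.\<close>

lemma density_boundary_bounds:
  assumes dens: "M = density lborel (\<lambda>x. ennreal (f x))"
    and f: "\<And>x. 0 < f x" "isCont f x" "f \<in> borel_measurable borel"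
  obtains c C \<delta> where "0 < c" "0 < \<delta>"
    "\<And>z. 0 < Im z \<Longrightarrow> cmod (z - complex_of_real x) < \<delta> \<Longrightarrow>
       c \<le> - Im (cauchy_transform M z) \<and> - Im (cauchy_transform M z) \<le> C"
proof -
  have "\<exists>d>0. \<forall>s. dist s x < d \<longrightarrow> dist (f s) (f x) < f x / 2"
    using f(2) f(1)[of x] unfolding continuous_at_eps_delta by (metis half_gt_zero)
  then obtain d where d: "0 < d" "\<And>s. \<bar>s - x\<bar> < d \<Longrightarrow> \<bar>f s - f x\<bar> < f x / 2"
    by (auto simp: dist_real_def)
  note [measurable] = f(3)
  have ennr: "ennreal (- Im (cauchy_transform M z)) = (\<integral>\<^sup>+s. ennreal (f s) * ennreal (poisson_kernel (Im z) (s - Re z)) \<partial>lborel)"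
    if "0 < Im z" for z
  proof -
    have "z = complex_of_real (Re z) + \<i> * complex_of_real (Im z)" by (simp add: complex_eq_iff)
    then have "ennreal (- Im (cauchy_transform M z)) = (\<integral>\<^sup>+s. ennreal (poisson_kernel (Im z) (s - Re z)) \<partial>M)"
      using ennreal_Im_cauchy_transform[OF that, of "Re z"] by simp
    also have "\<dots> = (\<integral>\<^sup>+s. ennreal (poisson_kernel (Im z) (s - Re z)) \<partial>density lborel (\<lambda>x. ennreal (f x)))"
      using dens by simp
    also have "\<dots> = (\<integral>\<^sup>+s. ennreal (f s) * ennreal (poisson_kernel (Im z) (s - Re z)) \<partial>lborel)"
      by (subst nn_integral_density) auto
    finally show ?thesis .
  qed
  have mass: "(\<integral>\<^sup>+s. ennreal (f s) \<partial>lborel) = 1"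
  proof -
    have "1 = emeasure M (space M)" using emeasure_space_1 by simp
    also have "\<dots> = emeasure (density lborel (\<lambda>x. ennreal (f x))) UNIV" using dens by simp
    also have "\<dots> = (\<integral>\<^sup>+s. ennreal (f s) \<partial>lborel)" by (subst emeasure_density) auto
    finally show ?thesis by simp
  qed
  show ?thesis
  \<comment> \<open>Lower bound: on [a - y, a + y] the kernel is at least 1 / (2 y) and f is at
    least f x / 2. Upper bound: at distance below d from x, f is at most 2 f x and the kernel has
    mass pi; further out the kernel is at most 2 / d and f has mass 1.\<close>
  proof (rule that[of "f x / 2" "d / 2" "2 * f x * pi + 2 / d"])
    fix z assume z: "0 < Im z" "cmod (z - complex_of_real x) < d / 2"
    define a where "a = Re z"
    define y where "y = Im z"
    have ay: "\<bar>a - x\<bar> < d / 2" "y < d / 2" "0 < y"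
      using z abs_Re_le_cmod[of "z - complex_of_real x"] abs_Im_le_cmod[of "z - complex_of_real x"]
      by (auto simp: a_def y_def)
    have "ennreal (f x / 2) = (\<integral>\<^sup>+s. ennreal (f x / 2 * (1 / (2 * y))) * indicator {a - y..a + y} s \<partial>lborel)"
      using ay f(1)[of x] by (simp add: nn_integral_cmult_indicator flip: ennreal_mult)
    also have "\<dots> \<le> (\<integral>\<^sup>+s. ennreal (f s) * ennreal (poisson_kernel y (s - a)) \<partial>lborel)"
    proof (intro nn_integral_mono)
      fix s
      show "ennreal (f x / 2 * (1 / (2 * y))) * indicator {a - y..a + y} s \<le> ennreal (f s) * ennreal (poisson_kernel y (s - a))"
      proof (cases "s \<in> {a - y..a + y}")
        case True
        then have s: "\<bar>s - a\<bar> \<le> y" by auto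
        then have "\<bar>s - x\<bar> < d" using ay by linarith
        then have fs: "f x / 2 \<le> f s" using d(2)[of s] by linarith
        have "(s - a)\<^sup>2 \<le> y\<^sup>2" using s ay by (metis abs_le_square_iff abs_of_pos)
        then have "y / (2 * y\<^sup>2) \<le> poisson_kernel y (s - a)"
          unfolding poisson_kernel_def using ay by (intro divide_left_mono mult_pos_pos add_nonneg_pos) auto
        then have "1 / (2 * y) \<le> poisson_kernel y (s - a)" using ay by (simp add: power2_eq_square)
        then have "f x / 2 * (1 / (2 * y)) \<le> f s * poisson_kernel y (s - a)"
          using fs f(1)[of x] ay by (intro mult_mono) auto
        then show ?thesis using True f(1)[of s] ay poisson_kernel_nonneg[of y]
          by (simp flip: ennreal_mult)
      qed simp
    qed
    also have "\<dots> = ennreal (- Im (cauchy_transform M z))" using ennr[OF z(1)] by (simp add: a_def y_def)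
    finally have 1: "ennreal (f x / 2) \<le> ennreal (- Im (cauchy_transform M z))" .
    have nn: "0 \<le> - Im (cauchy_transform M z)"
      using Im_cauchy_transform[OF finite_borel_measure_M z(1)] z(1) poisson_mass_pos[OF z(1)] by simp
    have low: "f x / 2 \<le> - Im (cauchy_transform M z)" using 1 nn by (simp add: ennreal_le_iff)
    have "ennreal (- Im (cauchy_transform M z)) = (\<integral>\<^sup>+s. ennreal (f s) * ennreal (poisson_kernel y (s - a)) \<partial>lborel)"
      using ennr[OF z(1)] by (simp add: a_def y_def)
    also have "\<dots> \<le> (\<integral>\<^sup>+s. ennreal (2 * f x) * ennreal (poisson_kernel y (s - a)) + ennreal (2 / d) * ennreal (f s) \<partial>lborel)"
    proof (intro nn_integral_mono)
      fix s
      have "f s * poisson_kernel y (s - a) \<le> 2 * f x * poisson_kernel y (s - a) + 2 / d * f s"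
      proof (cases "\<bar>s - x\<bar> < d")
        case True
        then have "f s \<le> 2 * f x" using d(2)[OF True] f(1)[of x] by linarith
        then have "f s * poisson_kernel y (s - a) \<le> 2 * f x * poisson_kernel y (s - a)"
          using ay by (intro mult_right_mono poisson_kernel_nonneg) auto
        then show ?thesis using d(1) f(1)[of s] by (simp add: add_increasing2)
      next
        case False
        then have "d / 2 \<le> \<bar>s - a\<bar>" using ay by linarith
        then have "(d / 2)\<^sup>2 \<le> (s - a)\<^sup>2" using d(1) by (metis abs_le_square_iff abs_of_pos half_gt_zero)
        then have "poisson_kernel y (s - a) \<le> y / (d / 2)\<^sup>2"
          unfolding poisson_kernel_def using ay d(1)
          by (intro divide_left_mono mult_pos_pos add_nonneg_pos) (auto intro: add_increasing2)
        also have "\<dots> \<le> (d / 2) / (d / 2)\<^sup>2" using ay by (intro divide_right_mono) auto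
        also have "\<dots> = 2 / d" using d(1) by (simp add: power2_eq_square field_simps)
        finally have "f s * poisson_kernel y (s - a) \<le> f s * (2 / d)"
          using f(1)[of s] by (intro mult_left_mono) auto
        then show ?thesis using f(1)[of x] poisson_kernel_nonneg[of y "s - a"] ay
          by (simp add: add_increasing mult.commute)
      qed
      then have "ennreal (f s * poisson_kernel y (s - a)) \<le> ennreal (2 * f x * poisson_kernel y (s - a) + 2 / d * f s)"
        by (rule ennreal_leI)
      moreover have "0 \<le> 2 * f x" "0 \<le> f s" "0 \<le> 2 / d" "0 \<le> poisson_kernel y (s - a)"
        using f(1)[of x] f(1)[of s] d(1) ay by (auto intro: poisson_kernel_nonneg less_imp_le)
      ultimately show "ennreal (f s) * ennreal (poisson_kernel y (s - a))
        \<le> ennreal (2 * f x) * ennreal (poisson_kernel y (s - a)) + ennreal (2 / d) * ennreal (f s)"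
        by (simp only: ennreal_mult[symmetric] ennreal_plus[symmetric] mult_nonneg_nonneg)
    qed
    also have "\<dots> = ennreal (2 * f x) * (\<integral>\<^sup>+s. ennreal (poisson_kernel y (s - a)) \<partial>lborel) + ennreal (2 / d) * 1"
      by (subst nn_integral_add) (auto simp: nn_integral_cmult mass)
    also have "(\<integral>\<^sup>+s. ennreal (poisson_kernel y (s - a)) \<partial>lborel) = ennreal pi"
    proof -
      have "(\<integral>\<^sup>+s. ennreal (poisson_kernel y (s - a)) \<partial>lborel) = (\<integral>\<^sup>+s. ennreal (poisson_kernel y s) \<partial>lborel)"
        by (subst nn_integral_real_affine[where c = 1 and t = a]) auto
      also have "\<dots> = ennreal pi"
        using has_bochner_integral_poisson_kernel[OF ay(3)] ay poisson_kernel_nonneg[of y]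
        by (subst nn_integral_eq_integral) (auto simp: has_bochner_integral_iff)
      finally show ?thesis .
    qed
    also have "ennreal (2 * f x) * ennreal pi + ennreal (2 / d) * 1 = ennreal (2 * f x * pi + 2 / d)"
      using f(1)[of x] d(1) by (simp add: ennreal_mult[symmetric] ennreal_plus[symmetric] del: ennreal_plus)
    finally have "- Im (cauchy_transform M z) \<le> 2 * f x * pi + 2 / d"
      using f(1)[of x] d(1) by (subst (asm) ennreal_le_iff) (auto intro!: add_nonneg_nonneg mult_nonneg_nonneg)
    then show "f x / 2 \<le> - Im (cauchy_transform M z) \<and> - Im (cauchy_transform M z) \<le> 2 * f x * pi + 2 / d"
      using low by blast
  qed (use f(1)[of x] d(1) in auto)
qed

end

section \<open>Necessity\<close>

lemma ennreal_levy_mass: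
  assumes "finite_borel_measure \<sigma>" "0 < Im u"
  shows "ennreal (levy_mass \<sigma> u) = (\<integral>\<^sup>+s. ennreal ((1 + s\<^sup>2) / (cmod (u - complex_of_real s))\<^sup>2) \<partial>\<sigma>)"
  unfolding kernel_norm_def
  using weighted_measure.integrable_kernel_norm[OF weighted_measure_square[OF assms(1)] assms(2)]
  by (subst nn_integral_eq_integral) auto

text \<open>On the vertical line over \<open>x\<close> the kernel grows as \<open>y\<close>
  decreases, and the singular integral has the pointwise limit as its integrand; at s = x that
  integrand is infinite.\<close>

lemma levy_mass_le_singular_integral:
  assumes \<sigma>: "finite_borel_measure \<sigma>" and fin: "singular_integral \<sigma> x \<noteq> \<infinity>" and y: "0 < y"
  shows "levy_mass \<sigma> (complex_of_real x + \<i> * complex_of_real y) \<le> enn2real (singular_integral \<sigma> x)"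
proof -
  let ?u = "complex_of_real x + \<i> * complex_of_real y"
  have "ennreal (levy_mass \<sigma> ?u) \<le> singular_integral \<sigma> x"
    unfolding ennreal_levy_mass[OF \<sigma>, of ?u, simplified, OF y] singular_integral_def
  proof (rule nn_integral_mono)
    fix s
    show "ennreal ((1 + s\<^sup>2) / (cmod (?u - complex_of_real s))\<^sup>2) \<le> ennreal (1 + s\<^sup>2) / ennreal ((x - s)\<^sup>2)"
    proof (cases "x = s")
      case True
      have "ennreal (1 + s\<^sup>2) \<noteq> 0" by (simp add: ennreal_eq_0_iff add_nonneg_eq_0_iff not_le add_pos_nonneg)
      then show ?thesis using True by simp
    next
      case False
      then have "0 < (x - s)\<^sup>2" by simp
      moreover have "(cmod (?u - complex_of_real s))\<^sup>2 = (x - s)\<^sup>2 + y\<^sup>2" by (simp add: cmod_power2)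
      ultimately have "(1 + s\<^sup>2) / (cmod (?u - complex_of_real s))\<^sup>2 \<le> (1 + s\<^sup>2) / (x - s)\<^sup>2"
        by (auto intro!: divide_left_mono mult_pos_pos add_pos_nonneg)
      then show ?thesis using \<open>0 < (x - s)\<^sup>2\<close>
        by (subst divide_ennreal) (auto intro: ennreal_leI simp del: ennreal_plus)
    qed
  qed
  then show ?thesis
    using fin weighted_measure.kernel_norm_nonneg[OF weighted_measure_square[OF \<sigma>]]
    by (metis enn2real_ennreal enn2real_mono infinity_ennreal_def less_top)
qed

lemma integrable_one_plus_square:
  assumes "finite_borel_measure \<sigma>" "second_moment \<sigma> \<noteq> \<infinity>"
  shows "integrable \<sigma> (\<lambda>s. 1 + s\<^sup>2)"
proof -
  interpret finite_borel_measure \<sigma> by fact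
  note M_is_borel[measurable_cong]
  have "integrable \<sigma> (\<lambda>s. s\<^sup>2)"
    using assms(2) by (intro integrableI_nonneg) (auto simp: second_moment_def less_top)
  then show ?thesis by simp
qed

lemma levy_mass_imaginary_le:
  assumes \<sigma>: "finite_borel_measure \<sigma>" and int: "integrable \<sigma> (\<lambda>s. 1 + s\<^sup>2)" and Y: "0 < Y"
  shows "levy_mass \<sigma> (\<i> * complex_of_real Y) \<le> (\<integral>s. 1 + s\<^sup>2 \<partial>\<sigma>) / Y\<^sup>2"
proof -
  have "levy_mass \<sigma> (\<i> * complex_of_real Y) \<le> (\<integral>s. (1 + s\<^sup>2) / Y\<^sup>2 \<partial>\<sigma>)"
    unfolding kernel_norm_def
  proof (rule integral_mono)
    show "integrable \<sigma> (\<lambda>s. (1 + s\<^sup>2) / (cmod (\<i> * complex_of_real Y - complex_of_real s))\<^sup>2)"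
      by (rule weighted_measure.integrable_kernel_norm[OF weighted_measure_square[OF \<sigma>]]) (use Y in simp)
    show "integrable \<sigma> (\<lambda>s. (1 + s\<^sup>2) / Y\<^sup>2)" by (intro integrable_divide_zero int)
    fix s
    have "(cmod (\<i> * complex_of_real Y - complex_of_real s))\<^sup>2 = s\<^sup>2 + Y\<^sup>2" by (simp add: cmod_power2)
    then show "(1 + s\<^sup>2) / (cmod (\<i> * complex_of_real Y - complex_of_real s))\<^sup>2 \<le> (1 + s\<^sup>2) / Y\<^sup>2"
      using Y by (auto intro!: divide_left_mono mult_pos_pos add_nonneg_pos)
  qed
  then show ?thesis by simp
qed

section \<open>The map H inverting the subordination function\<close>

locale subordinated = levy_semigroup + nu: real_distribution \<nu> for \<nu> +
  fixes t :: real
  assumes t_pos: "0 < t"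
begin

abbreviation F where "F \<equiv> F_transform \<nu>"

definition H :: "complex \<Rightarrow> complex" where
  "H w = w + complex_of_real t * \<Phi> (F w)"

definition contraction :: "complex \<Rightarrow> real" where
  "contraction w = t * levy_mass \<sigma> (F w) * ((cmod (F w))\<^sup>2 * poisson_mass \<nu> w)"

lemma contraction_nonneg: "0 \<le> contraction w"
  unfolding contraction_def using t_pos
  by (intro mult_nonneg_nonneg levy_mass_nonneg weighted_measure.kernel_norm_nonneg[OF nu.kernel_weight]) auto

lemma Im_H:
  assumes "0 < Im w"
  shows "Im (H w) = Im w * (1 - contraction w)"
  using Im_\<Phi>[OF nu.Im_F_transform_pos[OF assms]] nu.Im_F_transform[OF assms]
  by (simp add: H_def contraction_def algebra_simps)

lemma H_holomorphic: "H holomorphic_on upper_half_plane"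
proof -
  have "(\<Phi> \<circ> F) holomorphic_on upper_half_plane"
    by (rule holomorphic_on_compose_gen[OF nu.F_transform_holomorphic \<Phi>_holomorphic])
      (auto intro: nu.Im_F_transform_pos)
  then show ?thesis unfolding H_def by (intro holomorphic_intros) (simp add: o_def)
qed

lemma H_inj:
  assumes "0 < Im w" "0 < Im v" "0 < Im (H w)" "0 < Im (H v)" "H w = H v"
  shows "w = v"
proof (rule ccontr)
  assume "w \<noteq> v"
  let ?Lw = "levy_mass \<sigma> (F w)" and ?Lv = "levy_mass \<sigma> (F v)"
  let ?Pw = "poisson_mass \<nu> w" and ?Pv = "poisson_mass \<nu> v"
  have Im: "0 < Im (F w)" "0 < Im (F v)" using assms by (auto intro: nu.Im_F_transform_pos)
  have "w - v = complex_of_real t * (\<Phi> (F v) - \<Phi> (F w))"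
    using assms(5) by (simp add: H_def algebra_simps)
  then have "cmod (w - v) = t * cmod (\<Phi> (F w) - \<Phi> (F v))"
    using t_pos by (simp add: norm_mult norm_minus_commute)
  also have "\<dots> \<le> t * (cmod (F w - F v) * sqrt (?Lw * ?Lv))"
    using t_pos by (intro mult_left_mono norm_\<Phi>_diff_le Im) auto
  also have "\<dots> \<le> t * (cmod (w - v) * (cmod (F w) * cmod (F v) * sqrt (?Pw * ?Pv)) * sqrt (?Lw * ?Lv))"
    using t_pos levy_mass_nonneg by (intro mult_left_mono mult_right_mono nu.norm_F_transform_diff_le assms) auto
  also have "\<dots> = cmod (w - v) * sqrt (contraction w * contraction v)"
  proof -
    have "contraction w * contraction v = t\<^sup>2 * (cmod (F w) * cmod (F v))\<^sup>2 * ((?Pw * ?Pv) * (?Lw * ?Lv))"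
      by (simp add: contraction_def power2_eq_square algebra_simps)
    then have "sqrt (contraction w * contraction v) = t * (cmod (F w) * cmod (F v)) * (sqrt (?Pw * ?Pv) * sqrt (?Lw * ?Lv))"
      using t_pos by (simp add: real_sqrt_mult)
    then show ?thesis by (simp add: algebra_simps)
  qed
  finally have "1 \<le> sqrt (contraction w * contraction v)" using \<open>w \<noteq> v\<close> by simp
  moreover have "contraction w < 1" "contraction v < 1"
    using assms(3)[unfolded Im_H[OF assms(1)]] assms(4)[unfolded Im_H[OF assms(2)]] assms(1,2)
    by (simp_all add: zero_less_mult_iff)
  then have "contraction w * contraction v < 1 * 1"
    using contraction_nonneg by (intro mult_strict_mono') auto
  ultimately show False by (simp add: real_sqrt_ge_1_iff)
qed

definition \<rho> :: "real measure" where "\<rho> = \<mu> t \<boxplus> \<nu>"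

lemma rho_distribution: "real_distribution \<rho>"
  unfolding \<rho>_def by (intro free_conv_real_distribution mu_distribution nu.real_distribution_axioms) (use t_pos in simp)

text \<open>\<omega> is the second subordination function \<omega>2. The first one is expressed
  through the common value of F in two ways, by \<open>F_transform_identity\<close> and by \<omega>1
  + \<omega>2 = z + F; equating them gives H (\<omega>2 z) = z.\<close>

lemma right_inverse:
  obtains \<omega> where "\<forall>z. 0 < Im z \<longrightarrow> 0 < Im (\<omega> z) \<and> F_transform \<rho> z = F (\<omega> z) \<and> H (\<omega> z) = z"
proof -
  have d: "real_distribution (\<mu> t)" using t_pos by (intro mu_distribution) simp
  obtain \<omega>1 \<omega>2 where s: "subordination_pair (\<mu> t) \<nu> \<omega>1 \<omega>2"
    using free_conv_subordination[OF d nu.real_distribution_axioms] by blast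
  note s' = s[unfolded subordination_pair_def, THEN conjunct2, THEN conjunct2, rule_format, folded \<rho>_def]
  show ?thesis
  proof (rule that[of \<omega>2], intro allI impI)
    fix z assume z: "0 < Im z"
    from s'[OF z] have *: "0 < Im (\<omega>1 z)" "0 < Im (\<omega>2 z)"
      "F_transform \<rho> z = F_transform (\<mu> t) (\<omega>1 z)" "F_transform \<rho> z = F (\<omega>2 z)"
      "\<omega>1 z + \<omega>2 z = z + F_transform \<rho> z" by blast+
    have "F (\<omega>2 z) + complex_of_real t * \<Phi> (F (\<omega>2 z)) = \<omega>1 z"
      using F_transform_identity[OF t_pos *(1)] unfolding *(3)[symmetric] *(4) .
    moreover have "\<omega>1 z = z + F (\<omega>2 z) - \<omega>2 z" using *(5) unfolding *(4) by (simp only: eq_diff_eq)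
    ultimately have "H (\<omega>2 z) = z" by (simp add: H_def algebra_simps)
    then show "0 < Im (\<omega>2 z) \<and> F_transform \<rho> z = F (\<omega>2 z) \<and> H (\<omega>2 z) = z"
      using * by blast
  qed
qed

text \<open>Injectivity turns the right inverse into a two-sided one. The convolution is then known
  at H w without knowledge of \<omega>, so test paths can be chosen in the w-plane.\<close>

lemma F_transform_H:
  assumes "0 < Im w" "0 < Im (H w)"
  shows "F_transform \<rho> (H w) = F w"
proof -
  obtain \<omega> where \<omega>: "\<forall>z. 0 < Im z \<longrightarrow> 0 < Im (\<omega> z) \<and> F_transform \<rho> z = F (\<omega> z) \<and> H (\<omega> z) = z"
    by (rule right_inverse)
  then have a: "0 < Im (\<omega> (H w))" "F_transform \<rho> (H w) = F (\<omega> (H w))" "H (\<omega> (H w)) = H w"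
    using assms(2) by blast+
  have "\<omega> (H w) = w" by (rule H_inj[OF a(1) assms(1) _ assms(2) a(3)]) (simp only: a(3) assms(2))
  then show ?thesis using a(2) by (simp only:)
qed

lemma cauchy_transform_H:
  "0 < Im w \<Longrightarrow> 0 < Im (H w) \<Longrightarrow> cauchy_transform \<rho> (H w) = cauchy_transform \<nu> w"
  by (simp add: real_distribution.cauchy_transform_eq_inverse_F[OF rho_distribution]
      nu.cauchy_transform_eq_inverse_F F_transform_H)

text \<open>Since 0 < Im (H w) \<le> Im w, the images accumulate at a real point, where the density
  of the convolution gives two-sided bounds. Through \<open>cauchy_transform_H\<close> they become
  bounds for \<nu> along the path, so necessity only needs a measure \<nu> and a path that violate
  them.\<close>

lemma property_H_boundary_bounds:
  assumes pH: "property_H (\<mu> t)"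
    and w: "\<And>n. 0 < Im (w n)" "\<And>n. 0 < Im (H (w n))"
    and lim: "(\<lambda>n. Im (w n)) \<longlonglongrightarrow> 0"
    and bdd: "bounded (range w)" "bounded (range (\<lambda>n. \<Phi> (F (w n))))"
  obtains r c C where "strict_mono (r :: nat \<Rightarrow> nat)" "0 < c"
    "\<forall>\<^sub>F n in sequentially. c \<le> - Im (cauchy_transform \<nu> (w (r n))) \<and> - Im (cauchy_transform \<nu> (w (r n))) \<le> C"
proof -
  interpret rho: real_distribution \<rho> by (rule rho_distribution)
  obtain f where f: "\<And>x. 0 < f x" "real_analytic f" "\<rho> = density lborel (\<lambda>x. ennreal (f x))"
    using pH nu.real_distribution_axioms unfolding property_H_def \<rho>_def by metis
  have cont: "isCont f x" for x
  proof -
    obtain A where "(\<lambda>h. f (x + h)) has_fps_expansion A" using f(2) unfolding real_analytic_def by blast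
    then have "isCont (\<lambda>h. f (x + h)) 0" by (rule has_fps_expansion_imp_continuous)
    then have "((\<lambda>h. f (x + h)) \<longlongrightarrow> f x) (at 0)" by (simp add: isCont_def)
    then show ?thesis by (simp only: isCont_iff)
  qed
  then have meas: "f \<in> borel_measurable borel"
    by (intro borel_measurable_continuous_onI) (simp add: continuous_at_imp_continuous_on)
  have "bounded (range (\<lambda>n. H (w n)))"
  proof -
    obtain A where A: "\<And>n. cmod (w n) \<le> A" using bdd(1) by (auto simp: bounded_iff)
    obtain B where B: "\<And>n. cmod (\<Phi> (F (w n))) \<le> B" using bdd(2) by (auto simp: bounded_iff)
    have "cmod (H (w n)) \<le> A + t * B" for n
    proof -
      have "cmod (H (w n)) \<le> cmod (w n) + t * cmod (\<Phi> (F (w n)))"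
        unfolding H_def using t_pos norm_triangle_ineq[of "w n" "complex_of_real t * \<Phi> (F (w n))"] by (simp add: norm_mult)
      then show ?thesis using A[of n] mult_left_mono[OF B[of n], of t] t_pos by linarith
    qed
    then show ?thesis by (auto simp: bounded_iff)
  qed
  then obtain l r where r: "strict_mono (r :: nat \<Rightarrow> nat)" "((\<lambda>n. H (w n)) \<circ> r) \<longlonglongrightarrow> l"
    using bounded_imp_convergent_subsequence by blast
  have "(\<lambda>n. Im (H (w (r n)))) \<longlonglongrightarrow> Im l" using tendsto_Im[OF r(2)] by (simp add: o_def)
  moreover have "(\<lambda>n. Im (H (w (r n)))) \<longlonglongrightarrow> 0"
  proof (rule tendsto_sandwich[of "\<lambda>_. 0" _ _ "\<lambda>n. Im (w (r n))"])
    show "\<forall>\<^sub>F n in sequentially. 0 \<le> Im (H (w (r n)))" using w(2) by (auto intro!: always_eventually less_imp_le)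
    show "\<forall>\<^sub>F n in sequentially. Im (H (w (r n))) \<le> Im (w (r n))"
    proof (intro always_eventually allI)
      fix n
      have "Im (w (r n)) * (1 - contraction (w (r n))) \<le> Im (w (r n)) * 1"
        using w(1)[of "r n"] contraction_nonneg by (intro mult_left_mono) auto
      then show "Im (H (w (r n))) \<le> Im (w (r n))" using Im_H[OF w(1)] by simp
    qed
    show "(\<lambda>n. Im (w (r n))) \<longlonglongrightarrow> 0" using LIMSEQ_subseq_LIMSEQ[OF lim r(1)] by (simp add: o_def)
  qed auto
  ultimately have "Im l = 0" using LIMSEQ_unique by blast
  then have l: "l = complex_of_real (Re l)" by (simp add: complex_eq_iff)
  obtain c C \<delta> where b: "0 < c" "0 < \<delta>"
    "\<And>z. 0 < Im z \<Longrightarrow> cmod (z - complex_of_real (Re l)) < \<delta> \<Longrightarrow>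
       c \<le> - Im (cauchy_transform \<rho> z) \<and> - Im (cauchy_transform \<rho> z) \<le> C"
    using rho.density_boundary_bounds[OF f(3,1) cont meas] by metis
  have "\<forall>\<^sub>F n in sequentially. dist (((\<lambda>n. H (w n)) \<circ> r) n) l < \<delta>" using r(2) b(2) by (rule tendstoD)
  then have "\<forall>\<^sub>F n in sequentially. c \<le> - Im (cauchy_transform \<nu> (w (r n))) \<and> - Im (cauchy_transform \<nu> (w (r n))) \<le> C"
  proof eventually_elim
    case (elim n)
    then have "cmod (H (w (r n)) - complex_of_real (Re l)) < \<delta>" using l by (simp add: dist_norm)
    from b(3)[OF w(2) this] show ?case using cauchy_transform_H[OF w] by simp
  qed
  then show ?thesis using that r(1) b(1) by blast
qed

end

section \<open>Test measures and paths that violate property (H)\<close>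

context levy_semigroup
begin

lemma property_H_imp_singular_integral_infinite:
  assumes pH: "\<And>t. 0 < t \<Longrightarrow> property_H (\<mu> t)"
  shows "singular_integral \<sigma> x = \<infinity>"
proof (rule ccontr)
  assume fin: "singular_integral \<sigma> x \<noteq> \<infinity>"
  define S where "S = enn2real (singular_integral \<sigma> x)"
  \<comment> \<open>Keeps t times the Levy mass at most 1/2 on the vertical line over x, so that H
    maps this line into the half-plane; S + 1 avoids a zero denominator.\<close>
  define t where "t = 1 / (2 * (S + 1))"
  have S: "0 \<le> S" by (simp add: S_def)
  have t: "0 < t" "t * S \<le> 1 / 2" using S by (auto simp: t_def field_simps)
  interpret d: real_distribution "return borel (0::real)" by (rule real_distribution_return)
  interpret subordinated \<mu> \<sigma> \<gamma> \<alpha> "return borel 0" t by unfold_locales (rule t)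
  have F: "F z = z" for z by (simp add: F_transform_return)
  define w where "w = (\<lambda>n. complex_of_real x + \<i> * complex_of_real (1 / real (Suc n)))"
  have Im_w: "0 < Im (w n)" "Im (w n) = 1 / real (Suc n)" for n by (auto simp: w_def)
  have L: "levy_mass \<sigma> (w n) \<le> S" for n
    unfolding w_def S_def by (rule levy_mass_le_singular_integral[OF \<sigma> fin]) simp
  have Im_Hw: "0 < Im (H (w n))" for n
  proof -
    have "t * levy_mass \<sigma> (w n) \<le> t * S" using L t(1) by (intro mult_left_mono) auto
    then have "0 < 1 - t * levy_mass \<sigma> (w n)" using t(2) by linarith
    then have "0 < Im (w n) * (1 - t * levy_mass \<sigma> (w n))" using Im_w(1)[of n] by (rule mult_pos_pos[rotated])
    then show ?thesis using Im_\<Phi>[OF Im_w(1), of n] by (simp add: H_def F algebra_simps)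
  qed
  have norm_w: "cmod (w n) \<le> \<bar>x\<bar> + 1" for n
  proof -
    have "cmod (w n) \<le> \<bar>x\<bar> + 1 / real (Suc n)"
      unfolding w_def using norm_triangle_ineq[of "complex_of_real x" "\<i> * complex_of_real (1 / real (Suc n))"]
      by (simp add: norm_mult norm_divide del: of_nat_Suc)
    moreover have "1 / real (Suc n) \<le> 1" by simp
    ultimately show ?thesis by linarith
  qed
  \<comment> \<open>Comparison with the reference point i: bounded Levy mass along a bounded path
    bounds \<Phi>.\<close>
  have bdd_\<Phi>: "cmod (\<Phi> (F (w n))) \<le> cmod (\<Phi> \<i>) + (\<bar>x\<bar> + 2) * sqrt (S * levy_mass \<sigma> \<i>)" for n
  proof -
    have "cmod (\<Phi> (w n) - \<Phi> \<i>) \<le> cmod (w n - \<i>) * sqrt (levy_mass \<sigma> (w n) * levy_mass \<sigma> \<i>)"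
      by (rule norm_\<Phi>_diff_le[OF Im_w(1)]) simp
    also have "\<dots> \<le> (\<bar>x\<bar> + 2) * sqrt (S * levy_mass \<sigma> \<i>)"
      using norm_triangle_ineq4[of "w n" \<i>] norm_w[of n] L[of n] levy_mass_nonneg
      by (intro mult_mono real_sqrt_le_mono mult_right_mono) auto
    finally show ?thesis using norm_triangle_ineq2[of "\<Phi> (w n)" "\<Phi> \<i>"] by (simp add: F)
  qed
  have lim: "(\<lambda>n. Im (w n)) \<longlonglongrightarrow> 0" unfolding Im_w(2) by real_asymp
  obtain r c C where r: "strict_mono (r :: nat \<Rightarrow> nat)" "0 < c"
    "\<forall>\<^sub>F n in sequentially. c \<le> - Im (cauchy_transform (return borel 0) (w (r n))) \<and> - Im (cauchy_transform (return borel 0) (w (r n))) \<le> C"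
  proof (rule property_H_boundary_bounds[OF pH[OF t(1)] Im_w(1) Im_Hw lim])
    show "bounded (range w)" using norm_w by (auto simp: bounded_iff)
    show "bounded (range (\<lambda>n. \<Phi> (F (w n))))" using bdd_\<Phi> by (auto simp: bounded_iff)
  qed
  have G: "- Im (cauchy_transform (return borel 0) (w n)) = Im (w n) / (x\<^sup>2 + (Im (w n))\<^sup>2)" for n
    by (simp add: cauchy_transform_return Im_divide w_def)
  have lim_r: "(\<lambda>n. Im (w (r n))) \<longlonglongrightarrow> 0" using LIMSEQ_subseq_LIMSEQ[OF lim r(1)] by (simp add: o_def)
  show False
  \<comment> \<open>The Cauchy transform of the point mass at 0 is 1 / z. Its imaginary part tends
    to 0 along the path if x is not 0 and is unbounded if x = 0, so different halves of the bounds
    are violated.\<close>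
  proof (cases "x = 0")
    case False
    have "(\<lambda>n. Im (w (r n)) / (x\<^sup>2 + (Im (w (r n)))\<^sup>2)) \<longlonglongrightarrow> 0 / (x\<^sup>2 + 0\<^sup>2)"
      by (intro tendsto_intros lim_r) (use False in auto)
    then have "\<forall>\<^sub>F n in sequentially. Im (w (r n)) / (x\<^sup>2 + (Im (w (r n)))\<^sup>2) < c"
      using r(2) by (intro order_tendstoD(2)) auto
    with r(3) have "\<forall>\<^sub>F n in sequentially. False"
      unfolding G by eventually_elim linarith
    then show False by simp
  next
    case True
    have "\<forall>\<^sub>F n in sequentially. Im (w (r n)) < 1 / (\<bar>C\<bar> + 1)"
      by (rule order_tendstoD(2)[OF lim_r]) simp
    with r(3) have "\<forall>\<^sub>F n in sequentially. False"
    proof eventually_elim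
      case (elim n)
      have "\<bar>C\<bar> + 1 < 1 / Im (w (r n))" using elim(2) Im_w(1)[of "r n"] by (simp add: field_simps)
      moreover have "Im (w (r n)) / (x\<^sup>2 + (Im (w (r n)))\<^sup>2) = 1 / Im (w (r n))"
        using True by (simp add: power2_eq_square)
      ultimately show ?case using elim(1) unfolding G by linarith
    qed
    then show False by simp
  qed
qed

text \<open>Its reciprocal Cauchy transform \<open>z - 1 / z\<close> has a pole at the real point \<open>0\<close>.\<close>

definition two_point :: "real measure" where
  "two_point = distr (measure_pmf (pmf_of_set {-1, 1::real})) borel (\<lambda>x. x)"

lemma real_distribution_two_point: "real_distribution two_point"
  unfolding two_point_def real_distribution_def real_distribution_axioms_def
  by (auto intro!: prob_space.prob_space_distr measure_pmf.prob_space_axioms)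

lemma cauchy_transform_two_point:
  assumes "0 < y"
  shows "cauchy_transform two_point (\<i> * complex_of_real y) = - \<i> * complex_of_real (y / (1 + y\<^sup>2))"
proof -
  let ?z = "\<i> * complex_of_real y"
  have "cauchy_transform two_point ?z = (1 / (?z - complex_of_real (-1)) + 1 / (?z - complex_of_real 1)) / 2"
  proof -
    have "cauchy_transform two_point ?z = (\<integral>s. 1 / (?z - complex_of_real s) \<partial>measure_pmf (pmf_of_set {-1, 1}))"
      unfolding cauchy_transform_def two_point_def by (subst integral_distr) auto
    also have "\<dots> = (\<Sum>s\<in>{-1, 1}. pmf (pmf_of_set {-1, 1}) s *\<^sub>R (1 / (?z - complex_of_real s)))"
      by (rule integral_measure_pmf) auto
    finally show ?thesis by (simp add: scaleR_conv_of_real add_divide_distrib mult.commute)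
  qed
  also have "\<dots> = - \<i> * complex_of_real (y / (1 + y\<^sup>2))"
  proof -
    have "(1 / (a + 1) + 1 / (a - 1)) / 2 = a / (a * a - 1)" if "a + 1 \<noteq> 0" "a - 1 \<noteq> 0" for a :: complex
    proof -
      have "a * a - 1 = (a + 1) * (a - 1)" by (simp add: algebra_simps)
      then show ?thesis using that by (simp add: add_frac_eq)
    qed
    from this[of ?z] assms
    have "(1 / (?z + 1) + 1 / (?z - 1)) / 2 = ?z / (?z * ?z - 1)" by (simp add: complex_eq_iff)
    moreover have "?z * ?z - 1 = - complex_of_real (1 + y\<^sup>2)"
      by (simp add: complex_eq_iff power2_eq_square)
    ultimately show ?thesis by (simp del: of_real_add)
  qed
  finally show ?thesis .
qed

lemma property_H_imp_second_moment_infinite: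
  assumes pH: "\<And>t. 0 < t \<Longrightarrow> property_H (\<mu> t)"
  shows "second_moment \<sigma> = \<infinity>"
proof (rule ccontr)
  assume fin: "second_moment \<sigma> \<noteq> \<infinity>"
  have int: "integrable \<sigma> (\<lambda>s. 1 + s\<^sup>2)" by (rule integrable_one_plus_square[OF \<sigma> fin])
  define m where "m = (\<integral>s. 1 + s\<^sup>2 \<partial>\<sigma>)"
  have m: "0 \<le> m" unfolding m_def by (intro integral_nonneg_AE) auto
  define t where "t = 1 / (2 * (m + 1))"
  have t: "0 < t" "t * m \<le> 1 / 2" using m by (auto simp: t_def field_simps)
  interpret d: real_distribution two_point by (rule real_distribution_two_point)
  interpret subordinated \<mu> \<sigma> \<gamma> \<alpha> two_point t by unfold_locales (rule t)
  define y where "y = (\<lambda>n. 1 / real (Suc n))"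
  have y: "0 < y n" "y n \<le> 1" for n by (auto simp: y_def)
  \<comment> \<open>For the two-point measure F (i y) = i (y + 1 / y), so F sends the path w n to
    the points i Y, which go to infinity as y tends to 0.\<close>
  define Y where "Y = (\<lambda>n. (1 + (y n)\<^sup>2) / y n)"
  have Y: "1 \<le> Y n" "0 < Y n" "1 / Y n \<le> y n" for n
  proof -
    have p: "0 < 1 + (y n)\<^sup>2" by (intro add_pos_nonneg) auto
    show "1 \<le> Y n" using y[of n] by (simp add: Y_def field_simps add_increasing2)
    then show "0 < Y n" by linarith
    show "1 / Y n \<le> y n" using y[of n] p by (simp add: Y_def field_simps)
  qed
  define w where "w = (\<lambda>n. \<i> * complex_of_real (y n))"
  have Im_w: "0 < Im (w n)" "Im (w n) = y n" for n using y by (auto simp: w_def)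
  have Gw: "cauchy_transform two_point (w n) = - \<i> * complex_of_real (y n / (1 + (y n)\<^sup>2))" for n
    unfolding w_def by (rule cauchy_transform_two_point) (rule y)
  have F: "F (w n) = \<i> * complex_of_real (Y n)" for n
  proof -
    have "F (w n) = 1 / (- \<i> * complex_of_real (y n / (1 + (y n)\<^sup>2)))" by (simp add: F_transform_def Gw)
    also have "\<dots> = \<i> * complex_of_real (Y n)" by (simp add: Y_def complex_eq_iff Re_divide Im_divide power2_eq_square)
    finally show ?thesis .
  qed
  have L: "levy_mass \<sigma> (\<i> * complex_of_real (Y n)) \<le> m / (Y n)\<^sup>2" for n
    unfolding m_def by (rule levy_mass_imaginary_le[OF \<sigma> int Y(2)])
  have Im_Hw: "0 < Im (H (w n))" for n
  proof -
    \<comment> \<open>Positivity of Im (H w) means that t Y times the Levy mass at i Y is below y.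
      The second moment bounds this mass by m / Y^2, and then t m \<le> 1/2 and 1 / Y \<le> y give
      the bound y / 2.\<close>
    have "t * (Y n * levy_mass \<sigma> (\<i> * complex_of_real (Y n))) \<le> t * (Y n * (m / (Y n)\<^sup>2))"
      using L[of n] Y(2)[of n] t(1) by (intro mult_left_mono) auto
    also have "\<dots> = t * m * (1 / Y n)" using Y(2)[of n] by (simp add: power2_eq_square)
    also have "\<dots> \<le> 1 / 2 * y n" using t Y[of n] m by (intro mult_mono) auto
    finally have "t * (Y n * levy_mass \<sigma> (\<i> * complex_of_real (Y n))) < y n" using y(1)[of n] by linarith
    moreover have "Im (H (w n)) = y n + t * Im (\<Phi> (\<i> * complex_of_real (Y n)))"
      by (simp add: H_def F Im_w(2))
    ultimately show ?thesis
      using Im_\<Phi>[of "\<i> * complex_of_real (Y n)"] Y(2)[of n] by simp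
  qed
  \<comment> \<open>The points i Y are unbounded, yet \<Phi> is bounded on them: the distance to i
    grows like Y, while the square root of the Levy mass decays like 1 / Y.\<close>
  have bdd_\<Phi>: "cmod (\<Phi> (F (w n))) \<le> cmod (\<Phi> \<i>) + sqrt (m * levy_mass \<sigma> \<i>)" for n
  proof -
    have "cmod (\<Phi> (\<i> * complex_of_real (Y n)) - \<Phi> \<i>) \<le>
        cmod (\<i> * complex_of_real (Y n) - \<i>) * sqrt (levy_mass \<sigma> (\<i> * complex_of_real (Y n)) * levy_mass \<sigma> \<i>)"
      by (rule norm_\<Phi>_diff_le) (use Y(2) in auto)
    also have "\<dots> \<le> Y n * sqrt (m / (Y n)\<^sup>2 * levy_mass \<sigma> \<i>)"
    proof (intro mult_mono real_sqrt_le_mono mult_right_mono L levy_mass_nonneg)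
      have "\<i> * complex_of_real (Y n) - \<i> = \<i> * complex_of_real (Y n - 1)" by (simp add: algebra_simps)
      then show "cmod (\<i> * complex_of_real (Y n) - \<i>) \<le> Y n" using Y(1)[of n] by (simp only: norm_mult norm_of_real) simp
    qed (use m less_imp_le[OF Y(2)] levy_mass_nonneg in \<open>auto intro!: mult_nonneg_nonneg divide_nonneg_nonneg\<close>)
    also have "\<dots> = sqrt (m * levy_mass \<sigma> \<i>)"
      using Y(2)[of n] by (simp add: real_sqrt_mult real_sqrt_divide)
    finally show ?thesis using norm_triangle_ineq2[of "\<Phi> (\<i> * complex_of_real (Y n))" "\<Phi> \<i>"] by (simp add: F)
  qed
  have y_lim: "y \<longlonglongrightarrow> 0" unfolding y_def by real_asymp
  have lim: "(\<lambda>n. Im (w n)) \<longlonglongrightarrow> 0" unfolding Im_w(2) by (rule y_lim)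
  obtain r c C where r: "strict_mono (r :: nat \<Rightarrow> nat)" "0 < c"
    "\<forall>\<^sub>F n in sequentially. c \<le> - Im (cauchy_transform two_point (w (r n))) \<and> - Im (cauchy_transform two_point (w (r n))) \<le> C"
  proof (rule property_H_boundary_bounds[OF pH[OF t(1)] Im_w(1) Im_Hw lim])
    have "cmod (w n) \<le> 1" for n using y[of n] by (simp add: w_def norm_mult)
    then show "bounded (range w)" by (auto simp: bounded_iff)
    show "bounded (range (\<lambda>n. \<Phi> (F (w n))))" using bdd_\<Phi> by (auto simp: bounded_iff)
  qed
  have "\<forall>\<^sub>F n in sequentially. y (r n) < c"
    using LIMSEQ_subseq_LIMSEQ[OF y_lim r(1)] r(2) by (auto simp: o_def intro: order_tendstoD)
  with r(3) have "\<forall>\<^sub>F n in sequentially. False"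
  proof eventually_elim
    case (elim n)
    have "- Im (cauchy_transform two_point (w (r n))) = y (r n) / (1 + (y (r n))\<^sup>2)" by (simp add: Gw)
    also have "\<dots> \<le> y (r n) / 1" using y(1)[of "r n"] by (intro divide_left_mono) (auto intro: add_pos_nonneg)
    finally show ?case using elim by linarith
  qed
  then show False by simp
qed

end

section \<open>Sufficiency\<close>

lemma nn_integral_limit_le:
  fixes f :: "nat \<Rightarrow> 'a \<Rightarrow> ennreal"
  assumes [measurable]: "\<And>n. f n \<in> borel_measurable M"
    and lim: "\<And>s. (\<lambda>n. f n s) \<longlonglongrightarrow> g s"
    and le: "\<And>n. (\<integral>\<^sup>+s. f n s \<partial>M) \<le> K"
  shows "(\<integral>\<^sup>+s. g s \<partial>M) \<le> K"
proof -
  have "(\<integral>\<^sup>+s. g s \<partial>M) = (\<integral>\<^sup>+s. liminf (\<lambda>n. f n s) \<partial>M)"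
    using lim by (intro nn_integral_cong) (metis lim_imp_Liminf trivial_limit_sequentially)
  also have "\<dots> \<le> liminf (\<lambda>n. \<integral>\<^sup>+s. f n s \<partial>M)" by (rule nn_integral_liminf) measurable
  also have "\<dots> \<le> K"
    by (rule Liminf_le) (auto intro: always_eventually le)
  finally show ?thesis .
qed

lemma ennreal_weight_divide:
  assumes "0 < Im u"
  shows "ennreal ((1 + s\<^sup>2) / (cmod (u - complex_of_real s))\<^sup>2) = ennreal (1 + s\<^sup>2) / ennreal ((cmod (u - complex_of_real s))\<^sup>2)"
  using diff_real_nonzero[OF assms, of s] by (subst divide_ennreal) auto

lemma singular_integral_le_limit:
  assumes \<sigma>: "finite_borel_measure \<sigma>" and Im: "\<And>n. 0 < Im (u n)"
    and lim: "u \<longlonglongrightarrow> complex_of_real x" and le: "\<And>n. levy_mass \<sigma> (u n) \<le> K"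
  shows "singular_integral \<sigma> x \<le> ennreal K"
  unfolding singular_integral_def
proof (rule nn_integral_limit_le)
  interpret finite_borel_measure \<sigma> by fact
  note M_is_borel[measurable_cong]
  show "(\<lambda>s. ennreal ((1 + s\<^sup>2) / (cmod (u n - complex_of_real s))\<^sup>2)) \<in> borel_measurable \<sigma>" for n
    by measurable
  show "(\<integral>\<^sup>+s. ennreal ((1 + s\<^sup>2) / (cmod (u n - complex_of_real s))\<^sup>2) \<partial>\<sigma>) \<le> ennreal K" for n
    using ennreal_levy_mass[OF \<sigma> Im, of n] le[of n] by (metis ennreal_leI)
  fix s
  have "(\<lambda>n. (cmod (u n - complex_of_real s))\<^sup>2) \<longlonglongrightarrow> (cmod (complex_of_real x - complex_of_real s))\<^sup>2"
    by (intro tendsto_intros lim)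
  also have "(cmod (complex_of_real x - complex_of_real s))\<^sup>2 = (x - s)\<^sup>2"
    by (simp flip: of_real_diff)
  finally have "(\<lambda>n. ennreal ((cmod (u n - complex_of_real s))\<^sup>2)) \<longlonglongrightarrow> ennreal ((x - s)\<^sup>2)"
    by (rule tendsto_ennrealI)
  \<comment> \<open>Inversion on the extended nonnegative reals is continuous at 0 too, so the point
    s = x is covered by the same limit.\<close>
  moreover have "continuous_on UNIV (inverse :: ennreal \<Rightarrow> ennreal)"
    by (intro continuous_on_inverse_ennreal continuous_on_id)
  ultimately have "(\<lambda>n. inverse (ennreal ((cmod (u n - complex_of_real s))\<^sup>2))) \<longlonglongrightarrow> inverse (ennreal ((x - s)\<^sup>2))"
    by (rule continuous_on_tendsto_compose[OF _ _ UNIV_I always_eventually[OF allI[OF UNIV_I]], rotated])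
  then have "(\<lambda>n. ennreal (1 + s\<^sup>2) * inverse (ennreal ((cmod (u n - complex_of_real s))\<^sup>2)))
      \<longlonglongrightarrow> ennreal (1 + s\<^sup>2) * inverse (ennreal ((x - s)\<^sup>2))"
    by (intro ennreal_tendsto_cmult) auto
  then show "(\<lambda>n. ennreal ((1 + s\<^sup>2) / (cmod (u n - complex_of_real s))\<^sup>2)) \<longlonglongrightarrow> ennreal (1 + s\<^sup>2) / ennreal ((x - s)\<^sup>2)"
    unfolding ennreal_weight_divide[OF Im] divide_ennreal_def .
qed

text \<open>The factor |u|^2 compensates the decay of the kernel: |u|^2 (1 + s^2) / |u - s|^2 tends
  to 1 + s^2 in whatever direction u goes to infinity. Fatou's lemma does the rest.\<close>

lemma second_moment_le_limit:
  assumes \<sigma>: "finite_borel_measure \<sigma>" and Im: "\<And>n. 0 < Im (u n)"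
    and lim: "\<And>n. real n \<le> cmod (u n)" and le: "\<And>n. (cmod (u n))\<^sup>2 * levy_mass \<sigma> (u n) \<le> K"
  shows "second_moment \<sigma> \<le> ennreal K"
proof -
  interpret finite_borel_measure \<sigma> by fact
  note M_is_borel[measurable_cong]
  have "(\<integral>\<^sup>+s. ennreal (1 + s\<^sup>2) \<partial>\<sigma>) \<le> ennreal K"
  proof (rule nn_integral_limit_le)
    show "(\<lambda>s. ennreal ((cmod (u n))\<^sup>2 * ((1 + s\<^sup>2) / (cmod (u n - complex_of_real s))\<^sup>2))) \<in> borel_measurable \<sigma>" for n
      by measurable
    show "(\<integral>\<^sup>+s. ennreal ((cmod (u n))\<^sup>2 * ((1 + s\<^sup>2) / (cmod (u n - complex_of_real s))\<^sup>2)) \<partial>\<sigma>) \<le> ennreal K" for n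
    proof -
      have "(\<integral>\<^sup>+s. ennreal ((cmod (u n))\<^sup>2 * ((1 + s\<^sup>2) / (cmod (u n - complex_of_real s))\<^sup>2)) \<partial>\<sigma>)
        = ennreal ((cmod (u n))\<^sup>2) * ennreal (levy_mass \<sigma> (u n))"
      proof -
        have "ennreal ((cmod (u n))\<^sup>2 * ((1 + s\<^sup>2) / (cmod (u n - complex_of_real s))\<^sup>2))
          = ennreal ((cmod (u n))\<^sup>2) * ennreal ((1 + s\<^sup>2) / (cmod (u n - complex_of_real s))\<^sup>2)" for s
          by (rule ennreal_mult) auto
        then show ?thesis
          unfolding ennreal_levy_mass[OF \<sigma> Im] by (simp only:) (rule nn_integral_cmult, measurable)
      qed
      also have "\<dots> = ennreal ((cmod (u n))\<^sup>2 * levy_mass \<sigma> (u n))"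
        by (rule ennreal_mult[symmetric])
          (auto intro: weighted_measure.kernel_norm_nonneg[OF weighted_measure_square[OF \<sigma>]])
      finally show ?thesis using le[of n] by (simp add: ennreal_leI)
    qed
    fix s
    have inf: "filterlim u at_infinity sequentially"
      by (rule filterlim_norm_at_top_imp_at_infinity)
        (rule filterlim_at_top_mono[OF filterlim_real_sequentially], simp add: lim)
    have "(\<lambda>n. complex_of_real s / u n) \<longlonglongrightarrow> 0"
      using tendsto_divide_0[OF tendsto_const inf] .
    then have "(\<lambda>n. (1 + s\<^sup>2) / (cmod (1 - complex_of_real s / u n))\<^sup>2) \<longlonglongrightarrow> (1 + s\<^sup>2) / (cmod (1 - 0))\<^sup>2"
      by (intro tendsto_intros) auto
    moreover have "(1 + s\<^sup>2) / (cmod (1 - complex_of_real s / u n))\<^sup>2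
        = (cmod (u n))\<^sup>2 * ((1 + s\<^sup>2) / (cmod (u n - complex_of_real s))\<^sup>2)" for n
    proof -
      have "u n \<noteq> 0" using Im[of n] by auto
      then have "1 - complex_of_real s / u n = (u n - complex_of_real s) / u n" by (simp add: field_simps)
      then show ?thesis by (simp add: norm_divide power_divide)
    qed
    ultimately show "(\<lambda>n. ennreal ((cmod (u n))\<^sup>2 * ((1 + s\<^sup>2) / (cmod (u n - complex_of_real s))\<^sup>2))) \<longlonglongrightarrow> ennreal (1 + s\<^sup>2)"
      by (intro tendsto_ennrealI) simp
  qed
  moreover have "second_moment \<sigma> \<le> (\<integral>\<^sup>+s. ennreal (1 + s\<^sup>2) \<partial>\<sigma>)"
    unfolding second_moment_def by (intro nn_integral_mono ennreal_leI) simp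
  ultimately show ?thesis by (rule order_trans[rotated])
qed

text \<open>Supplies a reference point with Levy mass as small as desired. The integrand is at most
  1 because the height is at least 1.\<close>

lemma levy_mass_imaginary_tendsto_0:
  assumes \<sigma>: "finite_borel_measure \<sigma>"
  shows "(\<lambda>n. levy_mass \<sigma> (\<i> * complex_of_real (real (Suc n)))) \<longlonglongrightarrow> 0"
proof -
  interpret finite_borel_measure \<sigma> by fact
  note M_is_borel[measurable_cong]
  have c: "(cmod (\<i> * complex_of_real (real (Suc n)) - complex_of_real s))\<^sup>2 = s\<^sup>2 + (real (Suc n))\<^sup>2" for n s
    by (simp add: cmod_power2 del: of_nat_Suc)
  have "(\<lambda>n. levy_mass \<sigma> (\<i> * complex_of_real (real (Suc n)))) \<longlonglongrightarrow> (\<integral>s. 0 \<partial>\<sigma>)"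
    unfolding kernel_norm_def c
  proof (rule integral_dominated_convergence[where w = "\<lambda>_. 1"])
    show "AE s in \<sigma>. (\<lambda>n. (1 + s\<^sup>2) / (s\<^sup>2 + (real (Suc n))\<^sup>2)) \<longlonglongrightarrow> 0"
    proof (rule AE_I2)
      fix s :: real
      have "filterlim (\<lambda>n. s\<^sup>2 + (real (Suc n))\<^sup>2) at_infinity sequentially"
        by (intro filterlim_at_top_imp_at_infinity filterlim_tendsto_add_at_top[OF tendsto_const]) real_asymp
      then show "(\<lambda>n. (1 + s\<^sup>2) / (s\<^sup>2 + (real (Suc n))\<^sup>2)) \<longlonglongrightarrow> 0"
        by (rule tendsto_divide_0[OF tendsto_const])
    qed
    show "AE s in \<sigma>. norm ((1 + s\<^sup>2) / (s\<^sup>2 + (real (Suc n))\<^sup>2)) \<le> 1" for n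
    proof (rule AE_I2)
      fix s :: real
      have "1 \<le> (real (Suc n))\<^sup>2" by (rule one_le_power) simp
      then have "1 + s\<^sup>2 \<le> s\<^sup>2 + (real (Suc n))\<^sup>2" "0 < s\<^sup>2 + (real (Suc n))\<^sup>2"
        using zero_le_power2[of s] by linarith+
      then have "(1 + s\<^sup>2) / (s\<^sup>2 + (real (Suc n))\<^sup>2) \<le> 1" "0 \<le> (1 + s\<^sup>2) / (s\<^sup>2 + (real (Suc n))\<^sup>2)"
        by (simp_all only: divide_le_eq_1_pos) (intro divide_nonneg_pos, auto)
      then show "norm ((1 + s\<^sup>2) / (s\<^sup>2 + (real (Suc n))\<^sup>2)) \<le> 1"
        by (simp only: real_norm_def abs_of_nonneg)
    qed
  qed auto
  then show ?thesis by simp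
qed

text \<open>Equality would make (u - s)^2 / |u - s|^2 constant almost everywhere. Since Im u is
  fixed, this direction determines s, so the measure would be concentrated at one point or be zero,
  and its second moment would be finite.\<close>

lemma norm_kernel_form_less_levy_mass:
  assumes \<sigma>: "finite_borel_measure \<sigma>" and inf: "second_moment \<sigma> = \<infinity>" and u: "0 < Im u"
  shows "cmod (kernel_form \<sigma> (\<lambda>s. 1 + s\<^sup>2) u u) < levy_mass \<sigma> u"
proof (rule ccontr)
  interpret finite_borel_measure \<sigma> by fact
  interpret w: weighted_measure \<sigma> "\<lambda>s. 1 + s\<^sup>2" by (rule weighted_measure_square[OF \<sigma>])
  let ?d = "\<lambda>s. u - complex_of_real s"
  let ?K = "kernel_form \<sigma> (\<lambda>s. 1 + s\<^sup>2) u u"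
  assume "\<not> cmod ?K < levy_mass \<sigma> u"
  then have eq: "cmod ?K = levy_mass \<sigma> u" using w.norm_kernel_form_diag_le[OF u] by simp
  \<comment> \<open>A phase that rotates the integral onto the nonnegative real axis; equality in
    the triangle inequality then says that the nonnegative function \<open>g\<close> has integral
    0.\<close>
  obtain c where c: "cmod c = 1" "c * ?K = complex_of_real (cmod ?K)"
  proof (cases "?K = 0")
    case True
    then show ?thesis using that[of 1] by simp
  next
    case False
    show ?thesis
    proof (rule that[of "cnj ?K / complex_of_real (cmod ?K)"])
      show "cnj ?K / complex_of_real (cmod ?K) * ?K = complex_of_real (cmod ?K)"
        using False complex_norm_square[of ?K] by (simp add: field_simps power2_eq_square)
    qed (use False in \<open>simp add: norm_divide\<close>)
  qed
  let ?k = "\<lambda>s. complex_of_real (1 + s\<^sup>2) / (?d s * ?d s)"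
  define g where "g = (\<lambda>s. (1 + s\<^sup>2) / (cmod (?d s))\<^sup>2 - Re (c * ?k s))"
  have int: "integrable \<sigma> (\<lambda>s. (1 + s\<^sup>2) / (cmod (?d s))\<^sup>2)" "integrable \<sigma> (\<lambda>s. c * ?k s)"
    by (intro w.integrable_kernel_norm u, intro integrable_mult_right w.integrable_kernel_form u)
  have norm_k: "cmod (c * ?k s) = (1 + s\<^sup>2) / (cmod (?d s))\<^sup>2" for s
  proof -
    have "cmod (complex_of_real (1 + s\<^sup>2)) = 1 + s\<^sup>2" unfolding norm_of_real by simp
    then show ?thesis using c(1) by (simp only: norm_mult norm_divide power2_eq_square mult_1)
  qed
  have g_nonneg: "0 \<le> g s" for s
    unfolding g_def norm_k[symmetric] using complex_Re_le_cmod[of "c * ?k s"] by simp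
  have int_g: "integrable \<sigma> g" unfolding g_def using int by simp
  have "integral\<^sup>L \<sigma> g = levy_mass \<sigma> u - Re (c * ?K)"
  proof -
    have "integral\<^sup>L \<sigma> g = (\<integral>s. (1 + s\<^sup>2) / (cmod (?d s))\<^sup>2 \<partial>\<sigma>) - (\<integral>s. Re (c * ?k s) \<partial>\<sigma>)"
      unfolding g_def using int by (intro Bochner_Integration.integral_diff) auto
    also have "(\<integral>s. Re (c * ?k s) \<partial>\<sigma>) = Re (\<integral>s. c * ?k s \<partial>\<sigma>)" by (rule integral_Re[OF int(2)])
    also have "(\<integral>s. c * ?k s \<partial>\<sigma>) = c * ?K" unfolding kernel_form_def by (rule integral_mult_right_zero)
    finally show ?thesis by (simp add: kernel_norm_def)
  qed
  then have "integral\<^sup>L \<sigma> g = 0" unfolding c(2) eq by simp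
  then have "AE s in \<sigma>. g s = 0"
    using integral_nonneg_eq_0_iff_AE[OF int_g] g_nonneg by simp
  moreover have g0: "c * (cmod (?d s))\<^sup>2 = (?d s)\<^sup>2" if "g s = 0" for s
  proof -
    have nz: "?d s \<noteq> 0" by (rule diff_real_nonzero[OF u])
    have "Re (c * ?k s) = cmod (c * ?k s)" using that norm_k[of s] by (simp add: g_def)
    then have "c * ?k s = complex_of_real (cmod (c * ?k s))"
      using cmod_power2[of "c * ?k s"] unfolding complex_eq_iff by simp
    then have "c * (complex_of_real (1 + s\<^sup>2) / (?d s * ?d s)) = complex_of_real (1 + s\<^sup>2) / complex_of_real ((cmod (?d s))\<^sup>2)"
      unfolding norm_k by (simp only: of_real_divide)
    moreover have "complex_of_real (1 + s\<^sup>2) \<noteq> 0"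
      by (metis add_pos_nonneg of_real_eq_0_iff order_less_irrefl zero_le_power2 zero_less_one)
    ultimately show ?thesis using nz by (simp add: frac_eq_eq power2_eq_square divide_simps)
  qed
  ultimately have ae: "AE s in \<sigma>. c * (cmod (?d s))\<^sup>2 = (?d s)\<^sup>2"
    by (auto elim: eventually_mono)
  have unique: "s = s'" if "c * (cmod (?d s))\<^sup>2 = (?d s)\<^sup>2" "c * (cmod (?d s'))\<^sup>2 = (?d s')\<^sup>2" for s s'
  proof -
    define p where "p = cmod (?d s)"
    define q where "q = cmod (?d s')"
    have pq: "0 < p" "0 < q" using diff_real_nonzero[OF u] by (auto simp: p_def q_def)
    have "(?d s * q)\<^sup>2 = (?d s' * p)\<^sup>2"
      using that by (simp add: p_def q_def power_mult_distrib flip: that)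
    then consider "?d s * q = ?d s' * p" | "?d s * q = - (?d s' * p)"
      by (metis power2_eq_iff)
    \<comment> \<open>The squares determine the two sides up to sign; both have positive imaginary
      part, which selects the plus sign.\<close>
    then have "?d s * q = ?d s' * p"
    proof cases
      case 2
      then have "Im (?d s * q) = Im (- (?d s' * p))" by (simp only:)
      then have "Im u * q = - (Im u * p)" by simp
      moreover have "0 < Im u * q" "0 < Im u * p" using u pq by auto
      ultimately show ?thesis by linarith
    qed
    moreover from this have "Im (?d s * q) = Im (?d s' * p)" by (simp only:)
    then have "q = p" using u by simp
    ultimately have "?d s = ?d s'" using pq by simp
    then show ?thesis by simp
  qed
  have "second_moment \<sigma> < \<infinity>"
  proof (cases "\<exists>s0. c * (cmod (?d s0))\<^sup>2 = (?d s0)\<^sup>2")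
    case True
    then obtain s0 where s0: "c * (cmod (?d s0))\<^sup>2 = (?d s0)\<^sup>2" by blast
    have "second_moment \<sigma> = (\<integral>\<^sup>+s. ennreal (s0\<^sup>2) \<partial>\<sigma>)"
      unfolding second_moment_def
    proof (rule nn_integral_cong_AE)
      show "AE s in \<sigma>. ennreal (s\<^sup>2) = ennreal (s0\<^sup>2)"
        using ae
      proof eventually_elim
        case (elim s)
        show ?case by (simp only: unique[OF elim s0])
      qed
    qed
    also have "\<dots> < \<infinity>" using emeasure_finite by (simp add: ennreal_mult_eq_top_iff less_top[symmetric])
    finally show ?thesis .
  next
    case False
    then have "AE s in \<sigma>. False" using ae by simp
    then have "second_moment \<sigma> = (\<integral>\<^sup>+s. 0 \<partial>\<sigma>)"
      unfolding second_moment_def by (intro nn_integral_cong_AE) (auto elim: eventually_mono)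
    then show ?thesis by simp
  qed
  then show False using inf by simp
qed

section \<open>Boundary points as values of H\<close>

context subordinated
begin

lemma boundary_preimage:
  assumes inf: "second_moment \<sigma> = \<infinity>" and sing: "\<And>x. singular_integral \<sigma> x = \<infinity>"
  obtains w0 where "0 < Im w0" "H w0 = complex_of_real x"
proof -
  obtain \<omega> where \<omega>: "\<forall>z. 0 < Im z \<longrightarrow> 0 < Im (\<omega> z) \<and> F_transform \<rho> z = F (\<omega> z) \<and> H (\<omega> z) = z"
    by (rule right_inverse)
  define z where "z = (\<lambda>n. complex_of_real x + \<i> * complex_of_real (1 / real (Suc n)))"
  have Im_z: "0 < Im (z n)" for n by (simp add: z_def)
  have "z \<longlonglongrightarrow> complex_of_real x + \<i> * complex_of_real 0"
    unfolding z_def by (intro tendsto_intros) real_asymp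
  then have z_lim: "z \<longlonglongrightarrow> complex_of_real x" by simp
  then obtain Z where Z: "\<And>n. cmod (z n) \<le> Z"
    by (metis BseqE convergentI convergent_imp_Bseq)
  define w where "w = (\<lambda>n. \<omega> (z n))"
  define u where "u = (\<lambda>n. F (w n))"
  have Im_w: "0 < Im (w n)" and H_w: "H (w n) = z n" for n using \<omega> Im_z unfolding w_def by blast+
  have Im_u: "0 < Im (u n)" for n unfolding u_def by (rule nu.Im_F_transform_pos[OF Im_w])
  have w_eq: "w n = z n - complex_of_real t * \<Phi> (u n)" for n
    using H_w[of n] by (simp add: H_def u_def algebra_simps)
  \<comment> \<open>Positivity of Im (z n) puts \<open>contraction\<close> below 1 at
    \<open>w n\<close>. Its factors are used in two ways: \<open>levy_le\<close> will exclude real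
    limits of u, and \<open>weighted\<close> will exclude an infinite one.\<close>
  have contr: "t * levy_mass \<sigma> (u n) * ((cmod (u n))\<^sup>2 * poisson_mass \<nu> (w n)) < 1" for n
    using Im_H[OF Im_w, of n] Im_z[of n] Im_w[of n] unfolding H_w
    by (auto simp: zero_less_mult_iff contraction_def u_def)
  have pm: "1 \<le> (cmod (u n))\<^sup>2 * poisson_mass \<nu> (w n)" for n
    using nu.norm_cauchy_transform_square_le[OF Im_w, of n] nu.cauchy_transform_nonzero[OF Im_w, of n]
    by (simp add: u_def F_transform_def norm_divide power_divide divide_simps)
  have levy_le: "levy_mass \<sigma> (u n) \<le> 1 / t" for n
  proof -
    have "t * levy_mass \<sigma> (u n) * 1 \<le> t * levy_mass \<sigma> (u n) * ((cmod (u n))\<^sup>2 * poisson_mass \<nu> (w n))"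
      using pm[of n] t_pos levy_mass_nonneg by (intro mult_left_mono) auto
    then have "t * levy_mass \<sigma> (u n) \<le> 1" using contr[of n] by linarith
    then show ?thesis using t_pos by (simp add: field_simps)
  qed
  obtain c where c: "0 < c" "\<And>z. 0 < Im z \<Longrightarrow> c / (1 + cmod z)\<^sup>2 \<le> poisson_mass \<nu> z"
    using nu.poisson_mass_lower by metis
  have weighted: "(cmod (u n))\<^sup>2 * (t * levy_mass \<sigma> (u n)) \<le> (1 + cmod (w n))\<^sup>2 / c" for n
  proof -
    have p: "0 < (1 + cmod (w n))\<^sup>2" by (intro zero_less_power add_pos_nonneg) auto
    have "(cmod (u n))\<^sup>2 * (t * levy_mass \<sigma> (u n)) * (c / (1 + cmod (w n))\<^sup>2)
      \<le> (cmod (u n))\<^sup>2 * (t * levy_mass \<sigma> (u n)) * poisson_mass \<nu> (w n)"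
      using c(2)[OF Im_w, of n] t_pos levy_mass_nonneg by (intro mult_left_mono mult_nonneg_nonneg) auto
    also have "\<dots> < 1" using contr[of n] by (simp add: algebra_simps)
    finally show ?thesis using p c(1) by (simp add: field_simps)
  qed
  have "(\<lambda>n. levy_mass \<sigma> (\<i> * complex_of_real (real (Suc n)))) \<longlonglongrightarrow> 0"
    by (rule levy_mass_imaginary_tendsto_0[OF \<sigma>])
  then have "\<forall>\<^sub>F n in sequentially. levy_mass \<sigma> (\<i> * complex_of_real (real (Suc n))) < c / (16 * t)"
    by (rule order_tendstoD(2)) (use c t_pos in auto)
  then obtain N where N: "levy_mass \<sigma> (\<i> * complex_of_real (real (Suc N))) < c / (16 * t)"
    by (auto simp: eventually_sequentially)
  \<comment> \<open>A reference point with small Levy mass. The constant 16 turns the square root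
    below into (1 + |w|) / 4, and the factor 2 from |u - v| \<le> 2 |u| turns this into (1 + |w|) /
    2.\<close>
  define v where "v = \<i> * complex_of_real (real (Suc N))"
  have v: "0 < Im v" "levy_mass \<sigma> v < c / (16 * t)" using N by (auto simp: v_def)
  define B where "B = 2 * (Z + t * cmod (\<Phi> v)) + 1"
  \<comment> \<open>The estimate |w| \<le> Z + t |\<Phi> v| + (1 + |w|) / 2 has |w| on both sides
    and can be solved for it. This rules out that u and w escape to infinity together.\<close>
  have w_bound: "cmod (w n) \<le> B" if "cmod v \<le> cmod (u n)" for n
  proof -
    let ?L = "levy_mass \<sigma> (u n)" and ?l = "levy_mass \<sigma> v"
    have "t * cmod (\<Phi> (u n) - \<Phi> v) \<le> t * (cmod (u n - v) * sqrt (?L * ?l))"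
      using t_pos by (intro mult_left_mono norm_\<Phi>_diff_le Im_u v) auto
    also have "\<dots> \<le> t * (2 * cmod (u n) * sqrt (?L * ?l))"
      using norm_triangle_ineq4[of "u n" v] that t_pos levy_mass_nonneg
      by (intro mult_left_mono mult_right_mono) auto
    also have "\<dots> = 2 * sqrt ((cmod (u n))\<^sup>2 * (t * ?L) * (t * ?l))"
      using t_pos by (simp add: real_sqrt_mult)
    also have "\<dots> \<le> 2 * sqrt ((1 + cmod (w n))\<^sup>2 / c * (c / 16))"
    proof -
      have "t * ?l \<le> c / 16" using v(2) t_pos by (simp add: field_simps)
      then have "(cmod (u n))\<^sup>2 * (t * ?L) * (t * ?l) \<le> (1 + cmod (w n))\<^sup>2 / c * (c / 16)"
        using weighted[of n] t_pos levy_mass_nonneg c(1) by (intro mult_mono) auto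
      then show ?thesis by simp
    qed
    also have "\<dots> = (1 + cmod (w n)) / 2"
    proof -
      have "(1 + cmod (w n))\<^sup>2 / c * (c / 16) = ((1 + cmod (w n)) / 4)\<^sup>2" using c(1) by (simp add: power_divide)
      then show ?thesis by (simp add: add_nonneg_nonneg)
    qed
    finally have 1: "t * cmod (\<Phi> (u n) - \<Phi> v) \<le> (1 + cmod (w n)) / 2" .
    have "cmod (w n) \<le> cmod (z n) + t * cmod (\<Phi> (u n))"
      unfolding w_eq[of n] using t_pos norm_triangle_ineq4[of "z n" "complex_of_real t * \<Phi> (u n)"] by (simp add: norm_mult)
    moreover have "t * cmod (\<Phi> (u n)) \<le> t * cmod (\<Phi> v) + t * cmod (\<Phi> (u n) - \<Phi> v)"
      unfolding distrib_left[symmetric] using t_pos norm_triangle_sub[of "\<Phi> (u n)" "\<Phi> v"]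
      by (intro mult_left_mono) auto
    ultimately have "cmod (w n) \<le> Z + t * cmod (\<Phi> v) + (1 + cmod (w n)) / 2" using 1 Z[of n] by linarith
    then show ?thesis by (simp add: B_def field_simps)
  qed
  have "bounded (range u)"
  proof (rule ccontr)
    assume "\<not> bounded (range u)"
    then have "\<exists>n. max (cmod v) (real m) < cmod (u n)" for m :: nat
      unfolding bounded_iff by (metis (no_types, lifting) not_le rangeE)
    then obtain k where k: "\<And>m. max (cmod v) (real m) < cmod (u (k m))" by metis
    have "second_moment \<sigma> \<le> ennreal ((1 + B)\<^sup>2 / (c * t))"
    proof (rule second_moment_le_limit[OF \<sigma>, of "\<lambda>m. u (k m)"])
      show "0 < Im (u (k m))" for m by (rule Im_u)
      show "real m \<le> cmod (u (k m))" for m using k[of m] by simp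
      show "(cmod (u (k m)))\<^sup>2 * levy_mass \<sigma> (u (k m)) \<le> (1 + B)\<^sup>2 / (c * t)" for m
      proof -
        have "cmod (w (k m)) \<le> B" using k[of m] by (intro w_bound) simp
        then have "(1 + cmod (w (k m)))\<^sup>2 / c \<le> (1 + B)\<^sup>2 / c"
          using c(1) by (intro divide_right_mono power_mono) auto
        then have "(cmod (u (k m)))\<^sup>2 * (t * levy_mass \<sigma> (u (k m))) \<le> (1 + B)\<^sup>2 / c"
          using weighted[of "k m"] by linarith
        then show ?thesis using t_pos c(1) by (simp add: field_simps)
      qed
    qed
    then show False using inf by (simp add: top_unique)
  qed
  then obtain u0 r where r: "strict_mono (r :: nat \<Rightarrow> nat)" "(u \<circ> r) \<longlonglongrightarrow> u0"
    using bounded_imp_convergent_subsequence by blast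
  have r': "(\<lambda>n. u (r n)) \<longlonglongrightarrow> u0" using r(2) by (simp add: o_def)
  have "0 \<le> Im u0"
    by (rule LIMSEQ_le_const[OF tendsto_Im[OF r']]) (use Im_u in \<open>auto intro: less_imp_le\<close>)
  moreover have "Im u0 \<noteq> 0"
  proof
    assume "Im u0 = 0"
    then have u0: "u0 = complex_of_real (Re u0)" by (simp add: complex_eq_iff)
    have "singular_integral \<sigma> (Re u0) \<le> ennreal (1 / t)"
      by (rule singular_integral_le_limit[OF \<sigma>, of "\<lambda>n. u (r n)"]) (use Im_u r' u0 levy_le in auto)
    then show False using sing[of "Re u0"] by (simp add: top_unique)
  qed
  ultimately have u0: "0 < Im u0" by simp
  \<comment> \<open>Only the convergence of u is known so far, so the limit of w is defined through
    w n = z n - t \<Phi> (u n). It lies in the open half-plane because the Levy mass at u0 is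
    positive.\<close>
  define w0 where "w0 = complex_of_real x - complex_of_real t * \<Phi> u0"
  have pos: "0 < levy_mass \<sigma> u0"
    using norm_kernel_form_less_levy_mass[OF \<sigma> inf u0] norm_ge_zero by (rule le_less_trans[rotated])
  have w0: "0 < Im w0" using Im_\<Phi>[OF u0] t_pos u0 pos by (simp add: w0_def)
  have cont: "isCont f a" if "f holomorphic_on upper_half_plane" "0 < Im a" for f :: "complex \<Rightarrow> complex" and a
    using holomorphic_on_imp_continuous_on[OF that(1)] that(2) open_upper_half_plane
    by (simp add: continuous_on_eq_continuous_at)
  have "(\<lambda>n. z (r n) - complex_of_real t * \<Phi> (u (r n))) \<longlonglongrightarrow> w0"
    unfolding w0_def using LIMSEQ_subseq_LIMSEQ[OF z_lim r(1)]
    by (intro tendsto_intros isCont_tendsto_compose[OF cont[OF \<Phi>_holomorphic u0] r']) (simp add: o_def)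
  then have "(\<lambda>n. w (r n)) \<longlonglongrightarrow> w0" by (simp only: w_eq[symmetric])
  from isCont_tendsto_compose[OF cont[OF nu.F_transform_holomorphic w0] this]
  have "(\<lambda>n. u (r n)) \<longlonglongrightarrow> F w0" by (simp add: u_def)
  then have "F w0 = u0" using r' LIMSEQ_unique by blast
  then have "H w0 = complex_of_real x" by (simp add: H_def w0_def)
  then show ?thesis using that w0 by blast
qed

text \<open>At such a point \<open>contraction\<close> equals 1, which bounds the derivative of H w
  - w by 1 in modulus. The strict kernel inequality for \<sigma> makes this bound strict, so adding
  1 cannot give 0.\<close>

lemma deriv_H_nonzero:
  assumes inf: "second_moment \<sigma> = \<infinity>" and w: "0 < Im w" "Im (H w) = 0"
  shows "deriv H w \<noteq> 0"
proof -
  let ?k = "\<lambda>s::real. 1 + s\<^sup>2"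
  define u where "u = F w"
  have u: "0 < Im u" unfolding u_def by (rule nu.Im_F_transform_pos[OF w(1)])
  have "contraction w = 1" using w Im_H[OF w(1)] by simp
  then have one: "t * levy_mass \<sigma> u * ((cmod u)\<^sup>2 * poisson_mass \<nu> w) = 1"
    by (simp add: contraction_def u_def)
  have d\<Phi>: "(\<Phi> has_field_derivative - kernel_form \<sigma> ?k u u) (at u)"
    unfolding \<Phi>_def by (auto intro!: derivative_eq_intros has_field_derivative_levy_integral[OF \<sigma> u])
  have "((\<lambda>w. \<Phi> (F w)) has_field_derivative - kernel_form \<sigma> ?k u u * (u\<^sup>2 * kernel_form \<nu> (\<lambda>_. 1) w w)) (at w)"
    using DERIV_chain2[OF d\<Phi>[unfolded u_def] nu.has_field_derivative_F_transform[OF w(1)]] by (simp add: u_def)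
  then have dH: "(H has_field_derivative 1 + complex_of_real t * (- kernel_form \<sigma> ?k u u * (u\<^sup>2 * kernel_form \<nu> (\<lambda>_. 1) w w))) (at w)"
    unfolding H_def by (intro DERIV_add DERIV_ident DERIV_cmult)
  have X: "0 < (cmod u)\<^sup>2 * poisson_mass \<nu> w"
    using u nu.poisson_mass_pos[OF w(1)] by (intro mult_pos_pos zero_less_power) auto
  have "cmod (complex_of_real t * (- kernel_form \<sigma> ?k u u * (u\<^sup>2 * kernel_form \<nu> (\<lambda>_. 1) w w)))
    = t * cmod (kernel_form \<sigma> ?k u u) * ((cmod u)\<^sup>2 * cmod (kernel_form \<nu> (\<lambda>_. 1) w w))"
    using t_pos by (simp only: norm_mult norm_minus_cancel norm_power norm_of_real abs_of_pos)
  also have "\<dots> \<le> t * cmod (kernel_form \<sigma> ?k u u) * ((cmod u)\<^sup>2 * poisson_mass \<nu> w)"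
    using t_pos weighted_measure.norm_kernel_form_diag_le[OF nu.kernel_weight w(1)]
    by (intro mult_left_mono) auto
  also have "\<dots> < t * levy_mass \<sigma> u * ((cmod u)\<^sup>2 * poisson_mass \<nu> w)"
    using norm_kernel_form_less_levy_mass[OF \<sigma> inf u] t_pos X by (intro mult_strict_right_mono mult_strict_left_mono)
  finally have "cmod (complex_of_real t * (- kernel_form \<sigma> ?k u u * (u\<^sup>2 * kernel_form \<nu> (\<lambda>_. 1) w w))) < 1"
    unfolding one .
  moreover have "1 + a \<noteq> 0" if "cmod a < 1" for a :: complex
    using that by (metis add_eq_0_iff2 norm_minus_cancel norm_one order_less_irrefl)
  ultimately show ?thesis unfolding DERIV_imp_deriv[OF dH] by blast
qed

text \<open>The local inverse g of H at a preimage of x provides the continuation: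
  \<open>cauchy_transform \<nu>\<close> composed with g agrees with the Cauchy transform of the
  convolution above the axis. Its imaginary part at x is negative because g x lies in the open
  half-plane.\<close>

theorem positive_analytic_density:
  assumes inf: "second_moment \<sigma> = \<infinity>" and sing: "\<And>x. singular_integral \<sigma> x = \<infinity>"
  shows "\<exists>f. (\<forall>x. 0 < f x) \<and> real_analytic f \<and> \<mu> t \<boxplus> \<nu> = density lborel (\<lambda>x. ennreal (f x))"
proof -
  interpret rho: real_distribution \<rho> by (rule rho_distribution)
  have "\<exists>f. (\<forall>x. 0 < f x) \<and> real_analytic f \<and> \<rho> = density lborel (\<lambda>x. ennreal (f x))"
  proof (rule rho.positive_analytic_densityI)
    fix x :: real
    obtain w0 where w0: "0 < Im w0" "H w0 = complex_of_real x"
      using boundary_preimage[OF inf sing] by blast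
    have "deriv H w0 \<noteq> 0" by (rule deriv_H_nonzero[OF inf w0(1)]) (simp add: w0(2))
    moreover have "w0 \<in> upper_half_plane" using w0(1) by simp
    ultimately obtain r where r: "0 < r" "ball w0 r \<subseteq> upper_half_plane" "open (H ` ball w0 r)" "inj_on H (ball w0 r)"
      using has_complex_derivative_locally_invertible[OF H_holomorphic _ open_upper_half_plane] by metis
    have holo: "H holomorphic_on ball w0 r" using H_holomorphic r(2) by (rule holomorphic_on_subset)
    obtain g where g: "g holomorphic_on (H ` ball w0 r)" "\<And>w. w \<in> ball w0 r \<Longrightarrow> g (H w) = w"
      using holomorphic_has_inverse[OF holo open_ball r(4)] by metis
    define V where "V = H ` ball w0 r"
    have gV: "g z \<in> ball w0 r" "H (g z) = z" "0 < Im (g z)" if "z \<in> V" for z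
      using that g(2) r(2) by (auto simp: V_def)
    show "\<exists>V E. open V \<and> complex_of_real x \<in> V \<and> E holomorphic_on V \<and>
      (\<forall>z\<in>V. 0 < Im z \<longrightarrow> E z = cauchy_transform \<rho> z) \<and> Im (E (complex_of_real x)) < 0"
    proof (intro exI[of _ V] exI[of _ "\<lambda>z. cauchy_transform \<nu> (g z)"] conjI ballI impI)
      show "open V" using r(3) by (simp add: V_def)
      show xV: "complex_of_real x \<in> V"
        using r(1) w0(2) unfolding V_def by (metis centre_in_ball imageI)
      have "(cauchy_transform \<nu> \<circ> g) holomorphic_on V"
        by (rule holomorphic_on_compose_gen[OF g(1)[folded V_def] holomorphic_cauchy_transform[OF nu.finite_borel_measure_M]])
          (use gV in auto)
      then show "(\<lambda>z. cauchy_transform \<nu> (g z)) holomorphic_on V" by (simp add: o_def)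
      show "cauchy_transform \<nu> (g z) = cauchy_transform \<rho> z" if "z \<in> V" "0 < Im z" for z
        using cauchy_transform_H[OF gV(3)[OF that(1)]] gV(2)[OF that(1)] that(2) by simp
      show "Im (cauchy_transform \<nu> (g (complex_of_real x))) < 0"
        using Im_cauchy_transform[OF nu.finite_borel_measure_M gV(3)[OF xV]]
          nu.poisson_mass_pos[OF gV(3)[OF xV]] gV(3)[OF xV] by simp
    qed
  qed
  then show ?thesis by (simp only: \<rho>_def)
qed

end

theorem corollary3p15:
  fixes \<mu> :: "real \<Rightarrow> real measure" and \<sigma> :: "real measure"
  assumes "free_semigroup \<mu>"
    and "free_levy_measure (\<mu> 1) \<sigma>"
  shows "(\<forall>t>0. property_H (\<mu> t)) \<longleftrightarrow>
    second_moment \<sigma> = \<infinity> \<and> (\<forall>x. singular_integral \<sigma> x = \<infinity>)"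
proof -
  obtain \<gamma> \<alpha> where "levy_semigroup \<mu> \<sigma> \<gamma> \<alpha>" using levy_semigroup_exists[OF assms] .
  then interpret levy_semigroup \<mu> \<sigma> \<gamma> \<alpha> .
  show ?thesis
  proof (intro iffI conjI allI impI)
    assume "\<forall>t>0. property_H (\<mu> t)"
    then have pH: "\<And>t. 0 < t \<Longrightarrow> property_H (\<mu> t)" by blast
    show "second_moment \<sigma> = \<infinity>" by (rule property_H_imp_second_moment_infinite[OF pH])
    show "singular_integral \<sigma> x = \<infinity>" for x by (rule property_H_imp_singular_integral_infinite[OF pH])
  next
    fix t :: real
    assume inf: "second_moment \<sigma> = \<infinity> \<and> (\<forall>x. singular_integral \<sigma> x = \<infinity>)" and t: "0 < t"
    show "property_H (\<mu> t)"
      unfolding property_H_def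
    proof (intro allI impI)
      fix \<nu> :: "real measure" assume "real_distribution \<nu>"
      then interpret nu: real_distribution \<nu> .
      interpret subordinated \<mu> \<sigma> \<gamma> \<alpha> \<nu> t by unfold_locales (rule t)
      show "\<exists>f. (\<forall>x. 0 < f x) \<and> real_analytic f \<and> \<mu> t \<boxplus> \<nu> = density lborel (\<lambda>x. ennreal (f x))"
        by (rule positive_analytic_density) (use inf in auto)
    qed
  qed
qed

end
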